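(* Let $d\in\mathbb{N}$, let $\Omega\subseteq\mathbb{R}^d$ be measurable, and let $T=(e^{-tH})_{t\ge 0}$ be a selfadjoint positivity preserving $C_0$-semigroup on $L_2(\Omega)$, with generator $-H$, that is dominated by the free heat semigroup. Let $\varphi$ be an eigenfunction of $H$ with eigenvalue $\lambda<\inf\sigma_{\mathrm{ess}}(H)$. Then $$\|\varphi\|_1^2\le c_d\,(t-\lambda)^{-d/2}\Bigl(\ln\frac{3t}{t-\lambda}\Bigr)^d N_t(H)\,\|\varphi\|_2^2\qquad\text{for all } t \text{ with } \lambda<t<\inf\sigma_{\mathrm{ess}}(H),$$ where $c_d=35^{d+1}d^{d/2}$.
   Context: Functions on $\Omega$ are extended by $0$ to $\mathbb{R}^d$, so $L_2(\Omega)\subseteq L_2(\mathbb{R}^d)$. The semigroup $T$ being dominated by the free heat semigroup means $0\le T(t)f\le e^{t\Delta}f$ for all $t\ge0$ and all $0\le f\in L_2(\Omega)$, where $(e^{t\Delta})_{t\ge0}$ is the heat semigroup on $L_2(\mathbb{R}^d)$, with convolution kernel $k_t(x)=(4\pi t)^{-d/2}\exp(-|x|^2/(4t))$. $\sigma_{\mathrm{ess}}(H)$ is the essential spectrum of the selfadjoint operator $H$, with $\inf\varnothing=\infty$. For $t<\inf\sigma_{\mathrm{ess}}(H)$, the eigenvalue counting function $N_t(H)$ is the number of eigenvalues of $H$ that are $\le t$, counted with multiplicity. $\|\cdot\|_p$ is the norm of $L_p(\Omega)$ with respect to Lebesgue measure; in particular the assertion includes $\varphi\in L_1(\Omega)$.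 *)

theory Defs
  imports "HOL-Probability.Probability" "HOL-Library.Complex_Order"
begin

section \<open>The complex Hilbert space of square integrable functions\<close>

definition square_integrable :: "('a::euclidean_space \<Rightarrow> complex) \<Rightarrow> bool" where
  "square_integrable f \<longleftrightarrow>
     f \<in> borel_measurable lebesgue \<and> integrable lebesgue (\<lambda>x. (cmod (f x))\<^sup>2)"

definition L2_rel :: "('a::euclidean_space \<Rightarrow> complex) \<Rightarrow> ('a \<Rightarrow> complex) \<Rightarrow> bool" where
  "L2_rel f g \<longleftrightarrow> square_integrable f \<and> square_integrable g \<and> (AE x in lebesgue. f x = g x)"

lemma L2_rel_AE1:
  assumes "L2_rel f f'"
  shows "AE x in lebesgue. h (f x) = h (f' x)"
proof -
  have "AE x in lebesgue. f x = f' x"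
    using assms by (simp add: L2_rel_def)
  then show ?thesis by eventually_elim simp
qed

lemma L2_rel_AE2:
  assumes "L2_rel f f'" "L2_rel g g'"
  shows "AE x in lebesgue. h (f x) (g x) = h (f' x) (g' x)"
proof -
  have "AE x in lebesgue. f x = f' x" "AE x in lebesgue. g x = g' x"
    using assms by (simp_all add: L2_rel_def)
  then show ?thesis by eventually_elim simp
qed

lemma L2_relD:
  assumes "L2_rel f g"
  shows "square_integrable f" "square_integrable g"
    "f \<in> borel_measurable lebesgue" "g \<in> borel_measurable lebesgue"
    "AE x in lebesgue. f x = g x"
  using assms by (simp_all add: L2_rel_def square_integrable_def)

lemma square_integrable_zero: "square_integrable (\<lambda>x. 0)"
  by (simp add: square_integrable_def)

lemma square_integrable_scale:
  "square_integrable f \<Longrightarrow> square_integrable (\<lambda>x. c * f x)"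
  by (auto simp: square_integrable_def norm_mult power_mult_distrib)

lemma square_integrable_add:
  assumes "square_integrable f" "square_integrable g"
  shows "square_integrable (\<lambda>x. f x + g x)"
proof -
  have [measurable]: "f \<in> borel_measurable lebesgue" "g \<in> borel_measurable lebesgue"
    using assms by (auto simp: square_integrable_def)
  have "integrable lebesgue (\<lambda>x. 2 * (cmod (f x))\<^sup>2 + 2 * (cmod (g x))\<^sup>2)"
    using assms by (auto simp: square_integrable_def)
  moreover have "(cmod (f x + g x))\<^sup>2 \<le> 2 * (cmod (f x))\<^sup>2 + 2 * (cmod (g x))\<^sup>2" for x
  proof -
    have "(cmod (f x + g x))\<^sup>2 \<le> (cmod (f x) + cmod (g x))\<^sup>2"
      by (intro power_mono norm_triangle_ineq norm_ge_zero)
    also have "\<dots> \<le> 2 * (cmod (f x))\<^sup>2 + 2 * (cmod (g x))\<^sup>2"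
      using zero_le_power2[of "cmod (f x) - cmod (g x)"]
      by (simp add: power2_eq_square algebra_simps)
    finally show ?thesis .
  qed
  ultimately have "integrable lebesgue (\<lambda>x. (cmod (f x + g x))\<^sup>2)"
    by (intro Bochner_Integration.integrable_bound[where g = "\<lambda>x. (cmod (f x + g x))\<^sup>2"]) auto
  then show ?thesis
    by (simp add: square_integrable_def)
qed

lemma square_integrable_minus: "square_integrable f \<Longrightarrow> square_integrable (\<lambda>x. - f x)"
  by (auto simp: square_integrable_def)

lemma square_integrable_diff:
  "square_integrable f \<Longrightarrow> square_integrable g \<Longrightarrow> square_integrable (\<lambda>x. f x - g x)"
  using square_integrable_add[of f "\<lambda>x. - g x"] square_integrable_minus[of g] by simp

lemma square_integrable_mult_cnj:
  assumes "square_integrable f" "square_integrable g"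
  shows "integrable lebesgue (\<lambda>x. f x * cnj (g x))"
proof -
  have [measurable]: "f \<in> borel_measurable lebesgue" "g \<in> borel_measurable lebesgue"
    using assms by (auto simp: square_integrable_def)
  have "cnj \<in> borel_measurable borel"
    by (intro borel_measurable_continuous_onI continuous_intros)
  then have [measurable]: "(\<lambda>x. cnj (g x)) \<in> borel_measurable lebesgue"
    by (rule measurable_compose[rotated]) fact
  have m: "(\<lambda>x. f x * cnj (g x)) \<in> borel_measurable lebesgue"
    by measurable
  have "integrable lebesgue (\<lambda>x. (cmod (f x))\<^sup>2 + (cmod (g x))\<^sup>2)"
    using assms by (auto simp: square_integrable_def)
  moreover have "norm (f x * cnj (g x)) \<le> norm ((cmod (f x))\<^sup>2 + (cmod (g x))\<^sup>2)" for x
  proof -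
    have "2 * (cmod (f x) * cmod (g x)) \<le> (cmod (f x))\<^sup>2 + (cmod (g x))\<^sup>2"
      using sum_squares_bound[of "cmod (f x)" "cmod (g x)"] by simp
    moreover have "0 \<le> cmod (f x) * cmod (g x)" by simp
    ultimately have "cmod (f x) * cmod (g x) \<le> (cmod (f x))\<^sup>2 + (cmod (g x))\<^sup>2" by linarith
    then show ?thesis by (simp add: norm_mult)
  qed
  ultimately show ?thesis
    using m by (blast intro: Bochner_Integration.integrable_bound AE_I2)
qed

lemma part_equivp_L2_rel: "part_equivp (L2_rel :: ('a::euclidean_space \<Rightarrow> complex) \<Rightarrow> _)"
proof (rule part_equivpI)
  show "\<exists>f :: 'a \<Rightarrow> complex. L2_rel f f"
    by (rule exI[of _ "\<lambda>x. 0"]) (simp add: L2_rel_def square_integrable_zero)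
  show "symp (L2_rel :: ('a \<Rightarrow> complex) \<Rightarrow> _)"
  proof (rule sympI)
    fix f g :: "'a \<Rightarrow> complex"
    assume "L2_rel f g"
    then have "square_integrable g" "square_integrable f" "AE x in lebesgue. f x = g x"
      by (simp_all add: L2_rel_def)
    moreover from this(3) have "AE x in lebesgue. g x = f x" by eventually_elim simp
    ultimately show "L2_rel g f" by (simp add: L2_rel_def)
  qed
  show "transp (L2_rel :: ('a \<Rightarrow> complex) \<Rightarrow> _)"
  proof (rule transpI)
    fix f g h :: "'a \<Rightarrow> complex"
    assume *: "L2_rel f g" "L2_rel g h"
    have "AE x in lebesgue. f x = h x"
      using L2_relD(5)[OF *(1)] L2_relD(5)[OF *(2)] by eventually_elim simp
    with * show "L2_rel f h"
      by (simp add: L2_rel_def)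
  qed
qed

text \<open>\<open>'a L2\<close> is the space of square integrable functions on the whole Euclidean space \<open>'a\<close>,
  modulo equality almost everywhere.\<close>

quotient_type (overloaded) 'a L2 = "'a::euclidean_space \<Rightarrow> complex" / partial: L2_rel
  by (rule part_equivp_L2_rel)

lift_definition scaleC :: "complex \<Rightarrow> 'a::euclidean_space L2 \<Rightarrow> 'a L2" (infixr \<open>*\<^sub>C\<close> 75)
  is "\<lambda>c f x. c * f x"
  by (auto simp: L2_rel_def intro: square_integrable_scale)

lift_definition cinner :: "'a::euclidean_space L2 \<Rightarrow> 'a L2 \<Rightarrow> complex"
  is "\<lambda>f g. \<integral>x. f x * cnj (g x) \<partial>lebesgue"
proof -
  fix f f' g g' :: "'a \<Rightarrow> complex"
  assume *: "L2_rel f f'" "L2_rel g g'"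
  show "(\<integral>x. f x * cnj (g x) \<partial>lebesgue) = (\<integral>x. f' x * cnj (g' x) \<partial>lebesgue)"
    by (intro integral_cong_AE borel_measurable_integrable square_integrable_mult_cnj
        L2_relD[OF *(1)] L2_relD[OF *(2)] L2_rel_AE2[OF *, of "\<lambda>a b. a * cnj b"])
qed

instantiation L2 :: (euclidean_space) real_vector
begin

lift_definition zero_L2 :: "'a L2" is "\<lambda>x. 0"
  by (simp add: L2_rel_def square_integrable_zero)

lift_definition plus_L2 :: "'a L2 \<Rightarrow> 'a L2 \<Rightarrow> 'a L2" is "\<lambda>f g x. f x + g x"
  using L2_rel_AE2[where h = "(+)"] by (simp add: L2_rel_def square_integrable_add)

lift_definition minus_L2 :: "'a L2 \<Rightarrow> 'a L2 \<Rightarrow> 'a L2" is "\<lambda>f g x. f x - g x"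
  using L2_rel_AE2[where h = "(-)"] by (simp add: L2_rel_def square_integrable_diff)

lift_definition uminus_L2 :: "'a L2 \<Rightarrow> 'a L2" is "\<lambda>f x. - f x"
  by (auto simp: L2_rel_def intro: square_integrable_minus)

definition scaleR_L2 :: "real \<Rightarrow> 'a L2 \<Rightarrow> 'a L2" where
  "scaleR_L2 r f = complex_of_real r *\<^sub>C f"

instance
proof
  fix f g h :: "'a L2" and r s :: real
  show "f + g + h = f + (g + h)"
    by transfer (auto simp: L2_rel_def add.assoc intro: square_integrable_add)
  show "f + g = g + f"
    by transfer (auto simp: L2_rel_def add.commute intro: square_integrable_add)
  show "0 + f = f"
    by transfer (auto simp: L2_rel_def)
  show "- f + f = 0"
    by transfer (auto simp: L2_rel_def square_integrable_zero)
  show "f - g = f + - g"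
    by transfer (auto simp: L2_rel_def intro: square_integrable_diff)
  show "r *\<^sub>R (f + g) = r *\<^sub>R f + r *\<^sub>R g"
    unfolding scaleR_L2_def
    by transfer (auto simp: L2_rel_def ring_distribs
      intro!: square_integrable_add square_integrable_scale)
  show "(r + s) *\<^sub>R f = r *\<^sub>R f + s *\<^sub>R f"
    unfolding scaleR_L2_def
    by transfer (auto simp: L2_rel_def ring_distribs
      intro!: square_integrable_add square_integrable_scale)
  show "r *\<^sub>R s *\<^sub>R f = (r * s) *\<^sub>R f"
    unfolding scaleR_L2_def
    by transfer (auto simp: L2_rel_def mult.assoc intro!: square_integrable_scale)
  show "1 *\<^sub>R f = f"
    unfolding scaleR_L2_def by transfer (auto simp: L2_rel_def)
qed

end

lemma Re_integral_cnj:
  assumes "square_integrable f"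
  shows "Re (\<integral>x. f x * cnj (f x) \<partial>lebesgue) = (\<integral>x. (cmod (f x))\<^sup>2 \<partial>lebesgue)"
  unfolding complex_norm_square[symmetric] integral_complex_of_real by simp

instantiation L2 :: (euclidean_space) real_inner
begin

definition inner_L2 :: "'a L2 \<Rightarrow> 'a L2 \<Rightarrow> real" where
  "inner_L2 f g = Re (cinner f g)"

lift_definition norm_L2 :: "'a L2 \<Rightarrow> real" is "\<lambda>f. sqrt (\<integral>x. (cmod (f x))\<^sup>2 \<partial>lebesgue)"
proof -
  fix f g :: "'a \<Rightarrow> complex"
  assume *: "L2_rel f g"
  then have "AE x in lebesgue. (cmod (f x))\<^sup>2 = (cmod (g x))\<^sup>2"
    by (rule L2_rel_AE1)
  with * show "sqrt (\<integral>x. (cmod (f x))\<^sup>2 \<partial>lebesgue) = sqrt (\<integral>x. (cmod (g x))\<^sup>2 \<partial>lebesgue)"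
    by (intro arg_cong[of _ _ sqrt] integral_cong_AE)
       (auto simp: L2_rel_def square_integrable_def)
qed

definition dist_L2 :: "'a L2 \<Rightarrow> 'a L2 \<Rightarrow> real" where
  "dist_L2 f g = norm (f - g)"

definition sgn_L2 :: "'a L2 \<Rightarrow> 'a L2" where
  "sgn_L2 f = f /\<^sub>R norm f"

definition uniformity_L2 :: "('a L2 \<times> 'a L2) filter" where
  "uniformity_L2 = (INF e\<in>{0 <..}. principal {(f, g). dist f g < e})"

definition open_L2 :: "'a L2 set \<Rightarrow> bool" where
  "open_L2 U \<longleftrightarrow> (\<forall>f\<in>U. \<forall>\<^sub>F (f', g) in uniformity. f' = f \<longrightarrow> g \<in> U)"

instance
proof
  fix f g h :: "'a L2" and r :: real
  show "dist f g = norm (f - g)" by (rule dist_L2_def)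
  show "sgn f = f /\<^sub>R norm f" by (rule sgn_L2_def)
  show "uniformity = (INF e\<in>{0 <..}. principal {(f :: 'a L2, g). dist f g < e})"
    by (rule uniformity_L2_def)
  show "open U \<longleftrightarrow> (\<forall>f\<in>U. \<forall>\<^sub>F (f', g) in uniformity. f' = f \<longrightarrow> g \<in> U)" for U :: "'a L2 set"
    by (rule open_L2_def)
  show "inner f g = inner g f"
    unfolding inner_L2_def
  proof transfer
    fix f g :: "'a \<Rightarrow> complex"
    have "(\<integral>x. g x * cnj (f x) \<partial>lebesgue) = (\<integral>x. cnj (f x * cnj (g x)) \<partial>lebesgue)"
      by (simp add: mult.commute)
    also have "\<dots> = cnj (\<integral>x. f x * cnj (g x) \<partial>lebesgue)"
      by (rule Bochner_Integration.integral_cnj)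
    finally show "Re (\<integral>x. f x * cnj (g x) \<partial>lebesgue) = Re (\<integral>x. g x * cnj (f x) \<partial>lebesgue)"
      by simp
  qed
  show "inner (f + g) h = inner f h + inner g h"
    unfolding inner_L2_def
    by transfer (simp add: L2_rel_def ring_distribs square_integrable_mult_cnj)
  show "inner (r *\<^sub>R f) g = r * inner f g"
    unfolding inner_L2_def scaleR_L2_def
    by transfer (simp add: mult.assoc)
  show "0 \<le> inner f f"
    unfolding inner_L2_def by transfer (simp add: L2_rel_def Re_integral_cnj)
  show "inner f f = 0 \<longleftrightarrow> f = 0"
    unfolding inner_L2_def
    by transfer (auto simp: L2_rel_def Re_integral_cnj square_integrable_zero
      square_integrable_def integral_nonneg_eq_0_iff_AE)
  show "norm f = sqrt (inner f f)"
    unfolding inner_L2_def by transfer (simp add: L2_rel_def Re_integral_cnj)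
qed

end

global_interpretation cvec: vector_space "scaleC :: complex \<Rightarrow> 'a::euclidean_space L2 \<Rightarrow> 'a L2"
  defines cspan = cvec.span and cdim = cvec.dim
proof
  fix c d :: complex and f g :: "'a L2"
  show "c *\<^sub>C (f + g) = c *\<^sub>C f + c *\<^sub>C g"
    by transfer (auto simp: L2_rel_def ring_distribs
      intro!: square_integrable_add square_integrable_scale)
  show "(c + d) *\<^sub>C f = c *\<^sub>C f + d *\<^sub>C f"
    by transfer (auto simp: L2_rel_def ring_distribs
      intro!: square_integrable_add square_integrable_scale)
  show "c *\<^sub>C d *\<^sub>C f = (c * d) *\<^sub>C f"
    by transfer (auto simp: L2_rel_def mult.assoc intro!: square_integrable_scale)
  show "1 *\<^sub>C f = f"
    by transfer (auto simp: L2_rel_def)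
qed

instantiation L2 :: (euclidean_space) order
begin

text \<open>The pointwise order is the one of \<^theory>\<open>HOL-Library.Complex_Order\<close>; in particular
  \<open>0 \<le> f\<close> says that \<open>f\<close> is real-valued and nonnegative almost everywhere.\<close>

lift_definition less_eq_L2 :: "'a L2 \<Rightarrow> 'a L2 \<Rightarrow> bool" is "\<lambda>f g. AE x in lebesgue. f x \<le> g x"
proof -
  fix f f' g g' :: "'a \<Rightarrow> complex"
  assume "L2_rel f f'" "L2_rel g g'"
  then have "AE x in lebesgue. f x = f' x" "AE x in lebesgue. g x = g' x"
    by (auto simp: L2_rel_def)
  then have "AE x in lebesgue. f x \<le> g x \<longleftrightarrow> f' x \<le> g' x"
    by eventually_elim simp
  then show "(AE x in lebesgue. f x \<le> g x) \<longleftrightarrow> (AE x in lebesgue. f' x \<le> g' x)"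
    by (rule eventually_subst)
qed

definition less_L2 :: "'a L2 \<Rightarrow> 'a L2 \<Rightarrow> bool" where
  "less_L2 f g \<longleftrightarrow> f \<le> g \<and> \<not> g \<le> f"

instance
proof
  fix f g h :: "'a L2"
  show "f < g \<longleftrightarrow> f \<le> g \<and> \<not> g \<le> f" by (rule less_L2_def)
  show "f \<le> f" by transfer simp
  show "f \<le> h" if "f \<le> g" "g \<le> h"
    using that
  proof transfer
    fix f g h :: "'a \<Rightarrow> complex"
    assume "AE x in lebesgue. f x \<le> g x" "AE x in lebesgue. g x \<le> h x"
    then show "AE x in lebesgue. f x \<le> h x" by eventually_elim (rule order.trans)
  qed
  show "f = g" if "f \<le> g" "g \<le> f"
    using that
  proof transfer
    fix f g :: "'a \<Rightarrow> complex"
    assume *: "L2_rel f f" "L2_rel g g"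
    assume "AE x in lebesgue. f x \<le> g x" "AE x in lebesgue. g x \<le> f x"
    then have "AE x in lebesgue. f x = g x" by eventually_elim (rule order.antisym)
    with * show "L2_rel f g" by (simp add: L2_rel_def)
  qed
qed

end

text \<open>The subspace of functions vanishing almost everywhere outside \<open>\<Omega>\<close>, that is, the functions
  on \<open>\<Omega>\<close> extended by \<open>0\<close>.\<close>

lift_definition in_L2_on :: "'a::euclidean_space set \<Rightarrow> 'a L2 \<Rightarrow> bool"
  is "\<lambda>\<Omega> f. AE x in lebesgue. x \<notin> \<Omega> \<longrightarrow> f x = 0"
proof -
  fix \<Omega> :: "'a set" and f g :: "'a \<Rightarrow> complex"
  assume "L2_rel f g"
  then have "AE x in lebesgue. f x = g x"
    by (auto simp: L2_rel_def)
  then have "AE x in lebesgue. (x \<notin> \<Omega> \<longrightarrow> f x = 0) \<longleftrightarrow> (x \<notin> \<Omega> \<longrightarrow> g x = 0)"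
    by eventually_elim simp
  then show "(AE x in lebesgue. x \<notin> \<Omega> \<longrightarrow> f x = 0) \<longleftrightarrow> (AE x in lebesgue. x \<notin> \<Omega> \<longrightarrow> g x = 0)"
    by (rule eventually_subst)
qed

definition L2_on :: "'a::euclidean_space set \<Rightarrow> 'a L2 set" where
  "L2_on \<Omega> = {f. in_L2_on \<Omega> f}"

text \<open>The value is \<open>\<infinity>\<close> if the function is not integrable.\<close>

lift_definition L1_norm :: "'a::euclidean_space L2 \<Rightarrow> ennreal"
  is "\<lambda>f. \<integral>\<^sup>+x. ennreal (cmod (f x)) \<partial>lebesgue"
  by (intro nn_integral_cong_AE L2_rel_AE1)


section \<open>The free heat semigroup\<close>

definition heat_kernel :: "real \<Rightarrow> 'a::euclidean_space \<Rightarrow> real" where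
  "heat_kernel t x =
     (4 * pi * t) powr (- (real DIM('a) / 2)) * exp (- ((norm x)\<^sup>2 / (4 * t)))"

lemma heat_kernel_nonneg: "0 \<le> heat_kernel t x"
  by (simp add: heat_kernel_def)

lemma heat_kernel_measurable [measurable]: "heat_kernel t \<in> borel_measurable borel"
  unfolding heat_kernel_def [abs_def] by measurable

lemma nn_integral_heat_kernel_finite:
  assumes "t > 0"
  shows "(\<integral>\<^sup>+x. ennreal (heat_kernel t (x :: 'a::euclidean_space)) \<partial>lborel) < \<infinity>"
proof -
  let ?c = "(4 * pi * t) powr (- (real DIM('a) / 2))"
  let ?g = "\<lambda>s::real. exp (- (s\<^sup>2 / (4 * t)))"
  have prod: "exp (- ((norm x)\<^sup>2 / (4 * t))) = (\<Prod>b\<in>Basis. ?g (x \<bullet> b))" for x :: 'a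
    by (subst exp_sum[symmetric], simp)
       (simp add: sum_negf sum_divide_distrib[symmetric] norm_eq_sqrt_inner euclidean_inner[of x x]
         power2_eq_square[symmetric] sum_nonneg)
  have "integrable lborel (\<lambda>s. normal_density 0 (sqrt (2 * t)) s * sqrt (2 * pi * (sqrt (2 * t))\<^sup>2))"
    using assms by (intro integrable_mult_left integrable_normal_density) auto
  also have "(\<lambda>s. normal_density 0 (sqrt (2 * t)) s * sqrt (2 * pi * (sqrt (2 * t))\<^sup>2)) = ?g"
    using assms by (auto simp: normal_density_def fun_eq_iff)
  finally have 1: "(\<integral>\<^sup>+s. ennreal (?g s) \<partial>lborel) < \<infinity>"
    by (simp add: integrable_iff_bounded)
  have "(\<integral>\<^sup>+x. ennreal (heat_kernel t (x :: 'a)) \<partial>lborel)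
      = (\<integral>\<^sup>+x. ennreal ?c * (\<Prod>b\<in>Basis. ennreal (?g (x \<bullet> b))) \<partial>(lborel :: 'a measure))"
    unfolding heat_kernel_def prod by (simp add: ennreal_mult prod_ennreal prod_nonneg)
  also have "\<dots> = ennreal ?c * (\<integral>\<^sup>+x. (\<Prod>b\<in>Basis. ennreal (?g (x \<bullet> b))) \<partial>(lborel :: 'a measure))"
    by (intro nn_integral_cmult) measurable
  also have "\<dots> = ennreal ?c * (\<Prod>b\<in>(Basis::'a set). (\<integral>\<^sup>+s. ennreal (?g s) \<partial>lborel))"
    by (subst nn_integral_lborel_prod) auto
  also have "\<dots> < \<infinity>"
    using 1 by (auto simp: ennreal_mult_less_top power_less_top_ennreal)
  finally show ?thesis .
qed

lemma lebesgue_ex_borel: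
  fixes f :: "'a::euclidean_space \<Rightarrow> complex"
  assumes "f \<in> borel_measurable lebesgue"
  shows "\<exists>g\<in>borel_measurable borel. AE x in lebesgue. f x = g x"
proof -
  have "(\<lambda>x. Re (f x)) \<in> borel_measurable lebesgue" "(\<lambda>x. Im (f x)) \<in> borel_measurable lebesgue"
    using assms by (auto intro: measurable_compose borel_measurable_Re borel_measurable_Im)
  then obtain u v where uv: "u \<in> borel_measurable lborel" "AE x in lborel. Re (f x) = u x"
      "v \<in> borel_measurable lborel" "AE x in lborel. Im (f x) = v x"
    by (auto dest!: completion_ex_borel_measurable_real)
  show ?thesis
  proof (rule bexI[of _ "\<lambda>x. Complex (u x) (v x)"])
    have "AE x in lborel. f x = Complex (u x) (v x)"
      using uv(2,4) by eventually_elim (simp add: complex_eq_iff)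
    then show "AE x in lebesgue. f x = Complex (u x) (v x)"
      by (rule AE_completion)
    show "(\<lambda>x. Complex (u x) (v x)) \<in> borel_measurable borel"
      using uv(1,3) by (simp add: Complex_eq)
  qed
qed

lemma square_integrable_heat:
  fixes f :: "'a::euclidean_space \<Rightarrow> complex"
  assumes t: "t > 0" and f: "square_integrable f"
  shows "square_integrable (\<lambda>x. \<integral>y. of_real (heat_kernel t (x - y)) * f y \<partial>lebesgue)"
proof -
  let ?k = "heat_kernel t :: 'a \<Rightarrow> real"
  have fm [measurable]: "f \<in> borel_measurable lebesgue"
    using f by (simp add: square_integrable_def)
  obtain g where g [measurable]: "g \<in> borel_measurable borel" and fg: "AE x in lebesgue. f x = g x"
    using lebesgue_ex_borel[OF fm] by auto
  have gL: "g \<in> borel_measurable lebesgue"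
    using g by (simp add: measurable_completion)
  have g2: "(\<integral>\<^sup>+x. ennreal ((cmod (g x))\<^sup>2) \<partial>lborel) < \<infinity>"
  proof -
    have "(\<integral>\<^sup>+x. ennreal ((cmod (g x))\<^sup>2) \<partial>lborel) = (\<integral>\<^sup>+x. ennreal ((cmod (g x))\<^sup>2) \<partial>lebesgue)"
      by (simp add: nn_integral_completion)
    also have "\<dots> = (\<integral>\<^sup>+x. ennreal ((cmod (f x))\<^sup>2) \<partial>lebesgue)"
      using fg by (intro nn_integral_cong_AE) (rule eventually_mono, auto)
    also have "\<dots> < \<infinity>"
      using f by (simp add: square_integrable_def integrable_iff_bounded)
    finally show ?thesis .
  qed
  define F where "F x = (\<integral>y. of_real (?k (x - y)) * g y \<partial>lborel)" for x
  have eq: "(\<integral>y. of_real (?k (x - y)) * f y \<partial>lebesgue) = F x" for x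
  proof -
    have "(\<lambda>y. complex_of_real (?k (x - y))) \<in> borel_measurable lborel"
      by measurable
    then have km: "(\<lambda>y. complex_of_real (?k (x - y))) \<in> borel_measurable lebesgue"
      by (rule measurable_completion)
    have "(\<integral>y. of_real (?k (x - y)) * f y \<partial>lebesgue)
        = (\<integral>y. of_real (?k (x - y)) * g y \<partial>lebesgue)"
    proof (rule integral_cong_AE)
      show "AE y in lebesgue. of_real (?k (x - y)) * f y = of_real (?k (x - y)) * g y"
        using fg by eventually_elim simp
    qed (use km fm gL in measurable)
    also have "\<dots> = F x"
      unfolding F_def by (intro integral_completion) measurable
    finally show ?thesis .
  qed
  have Fm [measurable]: "F \<in> borel_measurable lborel"
    unfolding F_def [abs_def] by measurable
  let ?K = "\<integral>\<^sup>+y. ennreal (?k y) \<partial>lborel"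
  have K: "?K < \<infinity>" using nn_integral_heat_kernel_finite[OF t] .
  have shift1: "(\<integral>\<^sup>+y. ennreal (?k (x - y)) \<partial>lborel) = ?K" for x
  proof -
    have "(\<integral>\<^sup>+y. ennreal (?k (x - y)) \<partial>lborel) = (\<integral>\<^sup>+y. ennreal (?k (y - x)) \<partial>lborel)"
      by (simp add: heat_kernel_def norm_minus_commute)
    also have "\<dots> = (\<integral>\<^sup>+y. ennreal (?k (y - x)) \<partial>(distr lborel borel ((+) x)))"
      by (simp add: lborel_distr_plus)
    also have "\<dots> = ?K"
      by (subst nn_integral_distr) auto
    finally show ?thesis .
  qed
  have shift2: "(\<integral>\<^sup>+x. ennreal (?k (x - y)) \<partial>lborel) = ?K" for y
    using shift1[of y] by (simp add: heat_kernel_def norm_minus_commute)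
  have bound: "ennreal ((cmod (F x))\<^sup>2)
      \<le> ?K * (\<integral>\<^sup>+y. ennreal (?k (x - y) * (cmod (g y))\<^sup>2) \<partial>lborel)" for x
  proof -
    let ?a = "\<lambda>y. ennreal (sqrt (?k (x - y)))"
    let ?b = "\<lambda>y. ennreal (sqrt (?k (x - y)) * cmod (g y))"
    have "ennreal (cmod (F x)) \<le> (\<integral>\<^sup>+y. ennreal (norm (of_real (?k (x - y)) * g y)) \<partial>lborel)"
    proof (cases "integrable lborel (\<lambda>y. of_real (?k (x - y)) * g y)")
      case True
      then show ?thesis unfolding F_def by (rule integral_norm_bound_ennreal)
    next
      case False
      then show ?thesis by (simp add: F_def not_integrable_integral_eq)
    qed
    also have "\<dots> = (\<integral>\<^sup>+y. ?a y * ?b y \<partial>lborel)"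
      by (intro nn_integral_cong)
         (simp add: norm_mult heat_kernel_nonneg ennreal_mult'[symmetric] mult.assoc[symmetric])
    finally have "ennreal (cmod (F x))^2 \<le> (\<integral>\<^sup>+y. ?a y * ?b y \<partial>lborel)^2"
      by (intro power_mono) auto
    also have "\<dots> \<le> (\<integral>\<^sup>+y. (?a y)^2 \<partial>lborel) * (\<integral>\<^sup>+y. (?b y)^2 \<partial>lborel)"
      by (intro Cauchy_Schwarz_nn_integral) measurable
    also have "\<dots> = (\<integral>\<^sup>+y. ennreal (?k (x - y)) \<partial>lborel)
        * (\<integral>\<^sup>+y. ennreal (?k (x - y) * (cmod (g y))\<^sup>2) \<partial>lborel)"
      by (simp add: ennreal_power heat_kernel_nonneg power_mult_distrib)
    finally show ?thesis
      by (simp add: ennreal_power shift1)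
  qed
  have "(\<integral>\<^sup>+x. ennreal ((cmod (F x))\<^sup>2) \<partial>lborel)
      \<le> (\<integral>\<^sup>+x. ?K * (\<integral>\<^sup>+y. ennreal (?k (x - y) * (cmod (g y))\<^sup>2) \<partial>lborel) \<partial>lborel)"
    by (intro nn_integral_mono bound)
  also have "\<dots> = ?K * (\<integral>\<^sup>+x. (\<integral>\<^sup>+y. ennreal (?k (x - y) * (cmod (g y))\<^sup>2) \<partial>lborel) \<partial>lborel)"
    by (intro nn_integral_cmult) measurable
  also have "(\<integral>\<^sup>+x. (\<integral>\<^sup>+y. ennreal (?k (x - y) * (cmod (g y))\<^sup>2) \<partial>lborel) \<partial>lborel)
      = (\<integral>\<^sup>+y. (\<integral>\<^sup>+x. ennreal (?k (x - y) * (cmod (g y))\<^sup>2) \<partial>lborel) \<partial>lborel)"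
    by (rule lborel_pair.Fubini') measurable
  also have "\<dots> = (\<integral>\<^sup>+y. ?K * ennreal ((cmod (g y))\<^sup>2) \<partial>lborel)"
    by (intro nn_integral_cong)
       (simp add: ennreal_mult heat_kernel_nonneg nn_integral_multc shift2)
  also have "\<dots> = ?K * (\<integral>\<^sup>+y. ennreal ((cmod (g y))\<^sup>2) \<partial>lborel)"
    by (intro nn_integral_cmult) measurable
  also have "?K * \<dots> < \<infinity>"
    using K g2 by (simp add: ennreal_mult_less_top)
  finally have "integrable lborel (\<lambda>x. (cmod (F x))\<^sup>2)"
    by (simp add: integrable_iff_bounded)
  then have "integrable lebesgue (\<lambda>x. (cmod (F x))\<^sup>2)"
    by (subst integrable_completion) auto
  then show ?thesis
    unfolding eq square_integrable_def using measurable_completion[OF Fm] by simp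
qed

lift_definition heat_semigroup :: "real \<Rightarrow> 'a::euclidean_space L2 \<Rightarrow> 'a L2"
  is "\<lambda>t f. if t > 0
      then (\<lambda>x. \<integral>y. of_real (heat_kernel t (x - y)) * f y \<partial>lebesgue) else f"
proof -
  fix t :: real and f g :: "'a \<Rightarrow> complex"
  assume *: "L2_rel f g"
  then have fm: "f \<in> borel_measurable lebesgue" "g \<in> borel_measurable lebesgue"
    by (auto simp: L2_rel_def square_integrable_def)
  have "(\<integral>y. of_real (heat_kernel t (x - y)) * f y \<partial>lebesgue)
      = (\<integral>y. of_real (heat_kernel t (x - y)) * g y \<partial>lebesgue)" for x
  proof -
    have "(\<lambda>y. complex_of_real (heat_kernel t (x - y))) \<in> borel_measurable lborel"
      by measurable
    then have km: "(\<lambda>y. complex_of_real (heat_kernel t (x - y))) \<in> borel_measurable lebesgue"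
      by (rule measurable_completion)
    show ?thesis
    proof (rule integral_cong_AE)
      show "AE y in lebesgue. of_real (heat_kernel t (x - y)) * f y
          = of_real (heat_kernel t (x - y)) * g y"
        using L2_relD(5)[OF *] by eventually_elim simp
    qed (use km fm in measurable)
  qed
  then show "L2_rel (if t > 0
      then (\<lambda>x. \<integral>y. of_real (heat_kernel t (x - y)) * f y \<partial>lebesgue) else f)
    (if t > 0
      then (\<lambda>x. \<integral>y. of_real (heat_kernel t (x - y)) * g y \<partial>lebesgue) else g)"
    using * square_integrable_heat[of t f] square_integrable_heat[of t g] by (auto simp: L2_rel_def)
qed


section \<open>Semigroups on a subspace and their generators\<close>

text \<open>Below, \<open>X\<close> is the underlying Hilbert space, a closed complex subspace of \<open>'a L2\<close>.
  Bounded operators on \<open>X\<close> are functions of which only the restriction to \<open>X\<close> matters, and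
  similarly semigroups are only considered for nonnegative times. Unbounded operators in \<open>X\<close> are
  represented by their graphs.\<close>

definition bounded_clinear_on :: "'a::euclidean_space L2 set \<Rightarrow> ('a L2 \<Rightarrow> 'a L2) \<Rightarrow> bool" where
  "bounded_clinear_on X A \<longleftrightarrow>
     (\<forall>f\<in>X. A f \<in> X) \<and>
     (\<forall>f\<in>X. \<forall>g\<in>X. A (f + g) = A f + A g) \<and>
     (\<forall>c. \<forall>f\<in>X. A (c *\<^sub>C f) = c *\<^sub>C A f) \<and>
     (\<exists>K. \<forall>f\<in>X. norm (A f) \<le> K * norm f)"

definition C0_semigroup ::
    "'a::euclidean_space L2 set \<Rightarrow> (real \<Rightarrow> 'a L2 \<Rightarrow> 'a L2) \<Rightarrow> bool" where
  "C0_semigroup X T \<longleftrightarrow>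
     (\<forall>t\<ge>0. bounded_clinear_on X (T t)) \<and>
     (\<forall>f\<in>X. T 0 f = f) \<and>
     (\<forall>s\<ge>0. \<forall>t\<ge>0. \<forall>f\<in>X. T (s + t) f = T s (T t f)) \<and>
     (\<forall>f\<in>X. ((\<lambda>t. T t f) \<longlongrightarrow> f) (at_right 0))"

definition selfadjoint_semigroup ::
    "'a::euclidean_space L2 set \<Rightarrow> (real \<Rightarrow> 'a L2 \<Rightarrow> 'a L2) \<Rightarrow> bool" where
  "selfadjoint_semigroup X T \<longleftrightarrow>
     (\<forall>t\<ge>0. \<forall>f\<in>X. \<forall>g\<in>X. cinner (T t f) g = cinner f (T t g))"

definition positivity_preserving ::
    "'a::euclidean_space L2 set \<Rightarrow> (real \<Rightarrow> 'a L2 \<Rightarrow> 'a L2) \<Rightarrow> bool" where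
  "positivity_preserving X T \<longleftrightarrow> (\<forall>t\<ge>0. \<forall>f\<in>X. 0 \<le> f \<longrightarrow> 0 \<le> T t f)"

definition dominated_by_heat ::
    "'a::euclidean_space L2 set \<Rightarrow> (real \<Rightarrow> 'a L2 \<Rightarrow> 'a L2) \<Rightarrow> bool" where
  "dominated_by_heat X T \<longleftrightarrow>
     (\<forall>t\<ge>0. \<forall>f\<in>X. 0 \<le> f \<longrightarrow> 0 \<le> T t f \<and> T t f \<le> heat_semigroup t f)"

definition generator ::
    "'a::euclidean_space L2 set \<Rightarrow> (real \<Rightarrow> 'a L2 \<Rightarrow> 'a L2) \<Rightarrow> ('a L2 \<times> 'a L2) set" where
  "generator X T =
     {(f, g). f \<in> X \<and> g \<in> X \<and> ((\<lambda>t. (T t f - f) /\<^sub>R t) \<longlongrightarrow> g) (at_right 0)}"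


section \<open>Spectrum and eigenvalue counting\<close>

text \<open>\<open>z\<close> is in the resolvent set if \<open>A - z\<close>, with graph \<open>{(f, g - z f) | (f, g) \<in> A}\<close>, is a
  bijection from the domain of \<open>A\<close> onto \<open>X\<close> whose inverse \<open>R\<close> is bounded.\<close>

definition resolvent_set ::
    "'a::euclidean_space L2 set \<Rightarrow> ('a L2 \<times> 'a L2) set \<Rightarrow> complex set" where
  "resolvent_set X A =
     {z. \<exists>R. bounded_clinear_on X R \<and> {(g - z *\<^sub>C f, f) | f g. (f, g) \<in> A} = {(h, R h) | h. h \<in> X}}"

definition op_spectrum ::
    "'a::euclidean_space L2 set \<Rightarrow> ('a L2 \<times> 'a L2) set \<Rightarrow> complex set" where
  "op_spectrum X A = - resolvent_set X A"

definition eigenspace ::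
    "('a::euclidean_space L2 \<times> 'a L2) set \<Rightarrow> complex \<Rightarrow> 'a L2 set" where
  "eigenspace A z = {f. (f, z *\<^sub>C f) \<in> A}"

definition eigenvalue :: "('a::euclidean_space L2 \<times> 'a L2) set \<Rightarrow> complex \<Rightarrow> bool" where
  "eigenvalue A z \<longleftrightarrow> (\<exists>f. f \<noteq> 0 \<and> f \<in> eigenspace A z)"

text \<open>The essential spectrum of a selfadjoint operator is the complement in the spectrum of the
  discrete spectrum, i.e. of the isolated eigenvalues of finite multiplicity.\<close>

definition discrete_spectrum ::
    "'a::euclidean_space L2 set \<Rightarrow> ('a L2 \<times> 'a L2) set \<Rightarrow> complex set" where
  "discrete_spectrum X A =
     {z. z isolated_in op_spectrum X A \<and> eigenvalue A z \<and>
         (\<exists>B. finite B \<and> eigenspace A z \<subseteq> cspan B)}"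

definition ess_spectrum ::
    "'a::euclidean_space L2 set \<Rightarrow> ('a L2 \<times> 'a L2) set \<Rightarrow> complex set" where
  "ess_spectrum X A = op_spectrum X A - discrete_spectrum X A"

text \<open>The infimum in \<open>[-\<infinity>, \<infinity>]\<close>; the spectrum of a selfadjoint operator is real.\<close>

definition inf_ess_spectrum ::
    "'a::euclidean_space L2 set \<Rightarrow> ('a L2 \<times> 'a L2) set \<Rightarrow> ereal" where
  "inf_ess_spectrum X A = Inf (ereal ` {x. complex_of_real x \<in> ess_spectrum X A})"

text \<open>The number of eigenvalues \<open>\<le> t\<close>, counted with multiplicity. If \<open>A\<close> is selfadjoint and bounded
  below and \<open>t < inf_ess_spectrum X A\<close>, then this is a finite sum of dimensions of
  finite-dimensional spaces. (In general, infinite sums and infinite dimensions count as \<open>0\<close>.)\<close>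

definition eigenvalue_count :: "('a::euclidean_space L2 \<times> 'a L2) set \<Rightarrow> real \<Rightarrow> nat" where
  "eigenvalue_count A t =
     (\<Sum>\<mu> | \<mu> \<le> t \<and> eigenvalue A (complex_of_real \<mu>). cdim (eigenspace A (complex_of_real \<mu>)))"

end

theory Submission
  imports Defs
begin

text \<open>
  Cover the space by overlapping cubic cells whose side length is of order \<open>sqrt (d / (t - \<lambda>))\<close>.
  Call a cell low if some function supported in it has energy below \<open>t\<close>. Domination by the heat
  semigroup makes the form of \<open>H\<close> local, so separated low cells yield orthogonal trial functions,
  and the min-max principle bounds the number of low cells by a dimensional constant times
  \<open>N\<^sub>t(H)\<close>. An IMS localisation combined with an Agmon-type exponential weight centred at the low
  cells shows that the integral of \<open>\<bar>\<phi>\<bar>\<^sup>2 / W\<close> is at most a constant times \<open>\<parallel>\<phi>\<parallel>\<^sub>2\<^sup>2\<close>, where \<open>W\<close> is the sum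
  over the low cells of products of hyperbolic secants. The Cauchy--Schwarz inequality then gives
  the \<open>L\<^sub>1\<close>-bound, even without the logarithm.

  The form of \<open>H\<close> enters only through the difference quotients \<open>\<langle>v - T\<^sub>s v, v\<rangle> / s\<close> with
  \<open>s = (1/2)^n\<close>, and the commutator of \<open>T\<^sub>s\<close> with a multiplication operator is dominated by that of
  the Gaussian kernel. No spectral theorem is needed: that \<open>T\<^sub>s \<le> exp (- t s)\<close> on the orthogonal
  complement of the eigenvectors with eigenvalues below \<open>t\<close> holds because the top of the numerical
  range of a bounded symmetric operator is an approximate eigenvalue, and an eigenvalue if it is
  isolated.
\<close>

section \<open>Positive symmetric operators with a spectral gap\<close>

text \<open>On cells that are not low the energy is at least \<open>t\<close> times the mass, while
  the energy of \<open>\<phi>\<close> is only \<open>lam\<close> times its mass. Cutting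
  \<open>\<phi> / sqrt W\<close> into pieces therefore leaves, on the high cells, a surplus of
  \<open>t - lam\<close> per unit of mass, which commutators must pay for. Their total is
  \<open>d * (b^2 + (pi / (2 * h))^2)\<close> times the integral of
  \<open>\<bar>\<phi>\<bar>^2 / W\<close>. With \<open>b\<close> of order
  \<open>sqrt ((t - lam) / d)\<close> and \<open>h = 1 / b\<close> this is a fraction below 1 of
  \<open>t - lam\<close> and can be absorbed; on the low cells \<open>1 / W\<close> is bounded.
  Products of \<open>sech\<close> are chosen as weights because their heat averages are under
  control: \<open>cosh\<close> is reproduced up to a factor, \<open>sech\<close> is dominated with
  the same factor, and the integral of W is explicit. Absorption requires a finite integral, but
  \<open>1 / W\<close> is unbounded. Hence W is raised by \<open>\<epsilon> > 0\<close>, which is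
  sent to 0 only after integration over a ball.\<close>

lemma positive_form_Cauchy_Schwarz:
  fixes D :: "'h::real_inner \<Rightarrow> 'h"
  assumes D: "bounded_linear D" and Y: "subspace Y"
    and sym: "\<And>f g. f \<in> Y \<Longrightarrow> g \<in> Y \<Longrightarrow> inner (D f) g = inner f (D g)"
    and pos: "\<And>f. f \<in> Y \<Longrightarrow> 0 \<le> inner (D f) f"
    and f: "f \<in> Y" and g: "g \<in> Y"
  shows "(inner (D f) g)\<^sup>2 \<le> inner (D f) f * inner (D g) g"
proof -
  interpret D: bounded_linear D by fact
  let ?a = "inner (D f) f" and ?b = "inner (D f) g" and ?c = "inner (D g) g"
  have q: "0 \<le> ?a + 2 * r * ?b + r\<^sup>2 * ?c" for r
  proof -
    have "f + r *\<^sub>R g \<in> Y"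
      using Y f g by (simp add: subspace_add subspace_scale)
    from pos[OF this] show ?thesis
      using sym[OF g f]
      by (simp add: D.add D.scaleR inner_add inner_commute power2_eq_square algebra_simps)
  qed
  show ?thesis
  proof (cases "?c = 0")
    case True
    have "?b = 0"
    proof (rule ccontr)
      assume "?b \<noteq> 0"
      \<comment> \<open>For \<open>?c = 0\<close> the quadratic in \<open>r\<close> is affine, and
        this \<open>r\<close> gives it the value -1.\<close>
      then show False
        using q[of "- (?a + 1) / (2 * ?b)"] True by (simp add: field_simps)
    qed
    then show ?thesis using True by simp
  next
    case False
    then have c: "?c > 0" using pos[OF g] by simp
    have "0 \<le> (?a + 2 * (- ?b / ?c) * ?b + (- ?b / ?c)\<^sup>2 * ?c) * ?c"
      using q[of "- ?b / ?c"] c by (intro mult_nonneg_nonneg) auto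
    also have "\<dots> = ?a * ?c - ?b\<^sup>2"
      using c by (simp add: field_simps power2_eq_square)
    finally show ?thesis by simp
  qed
qed

text \<open>Cauchy-Schwarz for the form of \<open>D\<close>, applied to \<open>f\<close> and
  \<open>D f\<close>, does the work of a square root of \<open>D\<close>.\<close>

lemma positive_form_norm_bound:
  fixes D :: "'h::real_inner \<Rightarrow> 'h"
  assumes D: "bounded_linear D" and Y: "subspace Y" and DY: "\<And>f. f \<in> Y \<Longrightarrow> D f \<in> Y"
    and sym: "\<And>f g. f \<in> Y \<Longrightarrow> g \<in> Y \<Longrightarrow> inner (D f) g = inner f (D g)"
    and pos: "\<And>f. f \<in> Y \<Longrightarrow> 0 \<le> inner (D f) f"
    and bound: "\<And>f. f \<in> Y \<Longrightarrow> inner (D f) f \<le> \<kappa> * (norm f)\<^sup>2"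
    and f: "f \<in> Y"
  shows "(norm (D f))\<^sup>2 \<le> \<kappa> * inner (D f) f"
proof (cases "D f = 0")
  case False
  have "((norm (D f))\<^sup>2)\<^sup>2 \<le> inner (D f) f * inner (D (D f)) (D f)"
    using positive_form_Cauchy_Schwarz[OF D Y sym pos f DY[OF f]]
    by (simp add: power2_norm_eq_inner)
  also have "\<dots> \<le> inner (D f) f * (\<kappa> * (norm (D f))\<^sup>2)"
    using pos[OF f] bound[OF DY[OF f]] by (intro mult_left_mono)
  finally have "(norm (D f))\<^sup>2 * (norm (D f))\<^sup>2 \<le> (norm (D f))\<^sup>2 * (\<kappa> * inner (D f) f)"
    by (simp add: power2_eq_square algebra_simps)
  moreover have "(norm (D f))\<^sup>2 > 0" using False by simp
  ultimately show ?thesis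
    by (rule mult_left_le_imp_le)
next
  case True
  then show ?thesis by simp
qed

text \<open>Plays the role of invertibility for symmetric operators. It asks only for the lower
  bound, so that it passes to smaller sets \<open>Y\<close>, in particular to invariant
  subspaces.\<close>

definition bounded_below_on :: "'h::real_normed_vector set \<Rightarrow> ('h \<Rightarrow> 'h) \<Rightarrow> bool" where
  "bounded_below_on Y A \<longleftrightarrow> (\<exists>c>0. \<forall>f\<in>Y. c * norm f \<le> norm (A f))"

text \<open>Let \<open>\<beta>\<close> be the infimum of \<open>norm (A f)\<close> over unit
  vectors, where \<open>A = C - m\<close>. Then \<open>A\<^sup>2 - \<beta>\<^sup>2\<close> is
  positive with arbitrarily small form on unit vectors, so it cannot be bounded below. If
  \<open>\<beta> < r\<close>, however, both factors \<open>A - \<beta>\<close> and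
  \<open>A + \<beta>\<close> are bounded below.\<close>

lemma gap_norm_bound:
  fixes C :: "'h::real_inner \<Rightarrow> 'h"
  assumes C: "bounded_linear C" and Y: "subspace Y" and CY: "\<And>f. f \<in> Y \<Longrightarrow> C f \<in> Y"
    and sym: "\<And>f g. f \<in> Y \<Longrightarrow> g \<in> Y \<Longrightarrow> inner (C f) g = inner f (C g)"
    and gap: "\<And>z. \<bar>z - m\<bar> < r \<Longrightarrow> bounded_below_on Y (\<lambda>f. C f - z *\<^sub>R f)"
    and f: "f \<in> Y" and r: "r > 0"
  shows "r * norm f \<le> norm (C f - m *\<^sub>R f)"
proof (rule ccontr)
  assume neg: "\<not> ?thesis"
  interpret C: bounded_linear C by fact
  define A where "A f = C f - m *\<^sub>R f" for f
  interpret A: bounded_linear A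
    unfolding A_def[abs_def] by (intro bounded_linear_sub C bounded_linear_scaleR_right)
  have AY: "A f \<in> Y" if "f \<in> Y" for f
    using that CY Y by (simp add: A_def subspace_diff subspace_scale)
  have symA: "inner (A f) g = inner f (A g)" if "f \<in> Y" "g \<in> Y" for f g
    using that sym by (simp add: A_def inner_diff)
  define U where "U = {norm (A f) | f. f \<in> Y \<and> norm f = 1}"
  define \<beta> where "\<beta> = Inf U"
  have bdd: "bdd_below U" unfolding U_def by (rule bdd_belowI[of _ 0]) auto
  have fnz: "f \<noteq> 0" using neg r by auto
  have fU: "norm (A f) / norm f \<in> U"
    unfolding U_def using f fnz Y
    by (auto intro!: exI[of _ "(1 / norm f) *\<^sub>R f"] simp: A.scaleR subspace_scale)
  have "\<beta> \<le> norm (A f) / norm f" unfolding \<beta>_def by (intro cInf_lower fU bdd)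
  also have "\<dots> < r" using neg fnz by (simp add: A_def field_simps)
  finally have \<beta>r: "\<beta> < r" .
  have \<beta>0: "\<beta> \<ge> 0" unfolding \<beta>_def using fU by (intro cInf_greatest) (auto simp: U_def)
  have low: "\<beta> * norm g \<le> norm (A g)" if g: "g \<in> Y" for g
  proof (cases "g = 0")
    case False
    have "norm (A g) / norm g \<in> U"
      unfolding U_def using g False Y
      by (auto intro!: exI[of _ "(1 / norm g) *\<^sub>R g"] simp: A.scaleR subspace_scale)
    then have "\<beta> \<le> norm (A g) / norm g" unfolding \<beta>_def by (intro cInf_lower bdd)
    then show ?thesis using False by (simp add: field_simps)
  qed simp
  define D where "D f = A (A f) - \<beta>\<^sup>2 *\<^sub>R f" for f
  have D: "bounded_linear D"
    unfolding D_def[abs_def]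
    by (intro bounded_linear_sub bounded_linear_scaleR_right bounded_linear_compose[of A A, unfolded o_def]
        A.bounded_linear_axioms)
  have DY: "D g \<in> Y" if "g \<in> Y" for g
    using that AY Y by (simp add: D_def subspace_diff subspace_scale)
  have symD: "inner (D f) g = inner f (D g)" if "f \<in> Y" "g \<in> Y" for f g
    using that symA AY by (simp add: D_def inner_diff)
  have formD: "inner (D g) g = (norm (A g))\<^sup>2 - \<beta>\<^sup>2 * (norm g)\<^sup>2" if "g \<in> Y" for g
    using that symA[OF AY[OF that] that] by (simp add: D_def inner_diff power2_norm_eq_inner)
  have posD: "0 \<le> inner (D g) g" if "g \<in> Y" for g
    using formD[OF that] power_mono[OF low[OF that], of 2] \<beta>0 by (simp add: power_mult_distrib)
  obtain K where K: "K > 0" "\<And>g. norm (A g) \<le> norm g * K"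
    using A.pos_bounded by blast
  have bD: "inner (D g) g \<le> K\<^sup>2 * (norm g)\<^sup>2" if "g \<in> Y" for g
    using formD[OF that] power_mono[OF K(2)[of g], of 2]
    by (simp add: power_mult_distrib mult.commute)
       (smt (verit) zero_le_mult_iff zero_le_power2)
  have "bounded_below_on Y (\<lambda>f. C f - (m + \<beta>) *\<^sub>R f)" "bounded_below_on Y (\<lambda>f. C f - (m - \<beta>) *\<^sub>R f)"
    using \<beta>r \<beta>0 by (auto intro!: gap)
  then obtain c1 c2 where c: "c1 > 0" "c2 > 0"
    "\<And>g. g \<in> Y \<Longrightarrow> c1 * norm g \<le> norm (A g - \<beta> *\<^sub>R g)"
    "\<And>g. g \<in> Y \<Longrightarrow> c2 * norm g \<le> norm (A g + \<beta> *\<^sub>R g)"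
    unfolding bounded_below_on_def A_def by (auto simp: algebra_simps)
  \<comment> \<open>Chosen so that \<open>K\<^sup>2 * e\<close> is half of
    \<open>(c1 * c2)\<^sup>2\<close>, which is what the norm bound for \<open>D\<close> contradicts
    at the end.\<close>
  define e where "e = (c1 * c2)\<^sup>2 / (2 * K\<^sup>2)"
  have e: "e > 0" using c K by (simp add: e_def)
  have "\<exists>g\<in>Y. norm g = 1 \<and> (norm (A g))\<^sup>2 < \<beta>\<^sup>2 + e"
  proof -
    have "\<beta> < sqrt (\<beta>\<^sup>2 + e)" using e \<beta>0 by (intro real_less_rsqrt) simp
    then obtain x where "x \<in> U" "x < sqrt (\<beta>\<^sup>2 + e)"
      unfolding \<beta>_def using fU cInf_lessD by blast
    then obtain g where "g \<in> Y" "norm g = 1" "norm (A g) < sqrt (\<beta>\<^sup>2 + e)"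
      unfolding U_def by auto
    moreover from this(3) have "(norm (A g))\<^sup>2 < (sqrt (\<beta>\<^sup>2 + e))\<^sup>2"
      by (intro power_strict_mono) auto
    ultimately show ?thesis using e by (auto intro!: bexI[of _ g])
  qed
  then obtain g where g: "g \<in> Y" "norm g = 1" "(norm (A g))\<^sup>2 < \<beta>\<^sup>2 + e" by auto
  have D2: "D g = A (A g + \<beta> *\<^sub>R g) - \<beta> *\<^sub>R (A g + \<beta> *\<^sub>R g)"
    by (simp add: D_def A.add A.scaleR scaleR_add_right power2_eq_square)
  have "A g + \<beta> *\<^sub>R g \<in> Y" using g AY Y by (simp add: subspace_add subspace_scale)
  then have "c1 * c2 \<le> norm (D g)"
    using order.trans[OF mult_left_mono[OF c(4)[OF g(1)], of c1] c(3)[of "A g + \<beta> *\<^sub>R g"]]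
      c(1) g(2) unfolding D2 by simp
  then have "(c1 * c2)\<^sup>2 \<le> (norm (D g))\<^sup>2" using c by (intro power_mono) auto
  also have "\<dots> \<le> K\<^sup>2 * inner (D g) g"
    by (rule positive_form_norm_bound[OF D Y DY symD posD bD g(1)])
  also have "\<dots> \<le> K\<^sup>2 * e" using formD[OF g(1)] g by (intro mult_left_mono) auto
  also have "\<dots> = (c1 * c2)\<^sup>2 / 2" using K by (simp add: e_def)
  finally show False using c by simp
qed

text \<open>The gap makes \<open>C\<close> at least \<open>\<delta>\<close> on the range of
  \<open>C\<close>, so \<open>u\<close> has to be approximated from the range. With
  \<open>D = 1 - C\<close>, the sums of \<open>(D ^^ k) (C u)\<close> lie in the range and converge
  because \<open>D\<close> contracts there. Their limit \<open>w\<close> satisfies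
  \<open>C (u - w) = 0\<close>, and injectivity gives \<open>w = u\<close>.\<close>

theorem positive_gap_coercive:
  fixes C :: "'h::{real_inner,banach} \<Rightarrow> 'h"
  assumes C: "bounded_linear C" and Y: "subspace Y" "closed Y" and CY: "\<And>f. f \<in> Y \<Longrightarrow> C f \<in> Y"
    and sym: "\<And>f g. f \<in> Y \<Longrightarrow> g \<in> Y \<Longrightarrow> inner (C f) g = inner f (C g)"
    and pos: "\<And>f. f \<in> Y \<Longrightarrow> 0 \<le> inner (C f) f"
    and le1: "\<And>f. f \<in> Y \<Longrightarrow> inner (C f) f \<le> (norm f)\<^sup>2"
    and gap: "\<And>z. 0 < z \<Longrightarrow> z < \<delta> \<Longrightarrow> bounded_below_on Y (\<lambda>f. C f - z *\<^sub>R f)"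
    and ker: "\<And>f. f \<in> Y \<Longrightarrow> C f = 0 \<Longrightarrow> f = 0"
    and u: "u \<in> Y" and \<delta>: "\<delta> > 0"
  shows "\<delta> * (norm u)\<^sup>2 \<le> inner (C u) u"
proof -
  interpret C: bounded_linear C by fact
  have n2: "\<delta> * inner (C f) f \<le> (norm (C f))\<^sup>2" if f: "f \<in> Y" for f
  proof -
    \<comment> \<open>The gap is a ball of radius \<open>\<delta> / 2\<close> about
      \<open>\<delta> / 2\<close>; squaring this bound says that \<open>C * (C - \<delta>)\<close>
      is nonnegative.\<close>
    have "\<delta> / 2 * norm f \<le> norm (C f - (\<delta> / 2) *\<^sub>R f)"
      by (rule gap_norm_bound[OF C Y(1) CY sym _ f]) (use \<delta> in \<open>auto intro!: gap simp: abs_if split: if_splits\<close>)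
    from power_mono[OF this, of 2] \<delta>
    have "(\<delta> / 2)\<^sup>2 * inner f f \<le> inner (C f - (\<delta> / 2) *\<^sub>R f) (C f - (\<delta> / 2) *\<^sub>R f)"
      by (simp add: power_mult_distrib power_divide flip: power2_norm_eq_inner)
    then have "\<delta> * inner (C f) f \<le> inner (C f) (C f)"
      by (simp add: inner_diff inner_commute power2_eq_square algebra_simps)
    then show ?thesis by (simp add: power2_norm_eq_inner)
  qed
  have ran: "\<delta> * (norm (C f))\<^sup>2 \<le> inner (C (C f)) (C f)" if f: "f \<in> Y" for f
  proof (cases "C f = 0")
    case False
    have "((norm (C f))\<^sup>2)\<^sup>2 \<le> inner (C f) f * inner (C (C f)) (C f)"
      using positive_form_Cauchy_Schwarz[OF C Y(1) sym pos f CY[OF f]]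
      by (simp add: power2_norm_eq_inner)
    then have "\<delta> * ((norm (C f))\<^sup>2)\<^sup>2 \<le> (\<delta> * inner (C f) f) * inner (C (C f)) (C f)"
      using \<delta> by (simp add: mult_left_mono mult.assoc)
    also have "\<dots> \<le> (norm (C f))\<^sup>2 * inner (C (C f)) (C f)"
      using n2[OF f] pos[OF CY[OF f]] by (intro mult_right_mono) auto
    finally have "(norm (C f))\<^sup>2 * (\<delta> * (norm (C f))\<^sup>2) \<le> (norm (C f))\<^sup>2 * inner (C (C f)) (C f)"
      by (simp add: power2_eq_square algebra_simps)
    moreover have "(norm (C f))\<^sup>2 > 0" using False by simp
    ultimately show ?thesis by (rule mult_left_le_imp_le)
  qed simp
  define D where "D f = f - C f" for f
  interpret D: bounded_linear D
    unfolding D_def[abs_def] by (intro bounded_linear_sub C bounded_linear_ident)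
  define Z where "Z = C ` Y"
  have Z: "subspace Z"
    unfolding Z_def by (rule linear_subspace_image[OF C.linear_axioms Y(1)])
  have ZY: "Z \<subseteq> Y" using CY by (auto simp: Z_def)
  have DY: "D f \<in> Y" if "f \<in> Y" for f
    using that CY Y(1) by (simp add: D_def subspace_diff)
  have CD: "C (D f) = D (C f)" for f by (simp add: D_def C.diff)
  have DZ: "D f \<in> Z" if "f \<in> Z" for f
    using that DY by (auto simp: Z_def CD[symmetric])
  \<comment> \<open>The maximum secures \<open>0 \<le> \<kappa>\<close>, since
    \<open>\<delta>\<close> may exceed 1.\<close>
  define \<kappa> where "\<kappa> = max 0 (1 - \<delta>)"
  have \<kappa>: "0 \<le> \<kappa>" "\<kappa> < 1" using \<delta> by (auto simp: \<kappa>_def)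
  have contr: "norm (D f) \<le> \<kappa> * norm f" if "f \<in> Z" for f
  proof -
    have b: "inner (D g) g \<le> \<kappa> * (norm g)\<^sup>2" if "g \<in> Z" for g
    proof -
      have "inner (D g) g \<le> (1 - \<delta>) * (norm g)\<^sup>2"
        using ran that by (auto simp: Z_def D_def inner_diff power2_norm_eq_inner algebra_simps)
      also have "\<dots> \<le> \<kappa> * (norm g)\<^sup>2" by (intro mult_right_mono) (auto simp: \<kappa>_def)
      finally show ?thesis .
    qed
    have "(norm (D f))\<^sup>2 \<le> \<kappa> * inner (D f) f"
    proof (rule positive_form_norm_bound[OF D.bounded_linear_axioms Z DZ _ _ b that])
      show "inner (D f) g = inner f (D g)" if "f \<in> Z" "g \<in> Z" for f g
        using that ZY sym by (auto simp: D_def inner_diff)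
      show "0 \<le> inner (D f) f" if "f \<in> Z" for f
        using le1[of f] that ZY by (auto simp: D_def inner_diff power2_norm_eq_inner)
    qed
    also have "\<dots> \<le> \<kappa> * (\<kappa> * (norm f)\<^sup>2)"
      using \<kappa> b[OF that] by (intro mult_left_mono)
    finally have "(norm (D f))\<^sup>2 \<le> (\<kappa> * norm f)\<^sup>2"
      by (simp add: power_mult_distrib power2_eq_square algebra_simps)
    then show ?thesis using \<kappa> by (simp add: power2_le_iff_abs_le)
  qed
  have DnY: "(D ^^ n) u \<in> Y" for n by (induction n) (auto simp: u DY)
  have DnC: "(D ^^ n) (C u) = C ((D ^^ n) u)" for n by (induction n) (auto simp: CD)
  have DnZ: "(D ^^ n) (C u) \<in> Z" for n using DnY[of n] by (simp add: DnC Z_def)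
  have Dn: "norm ((D ^^ n) (C u)) \<le> \<kappa> ^ n * norm (C u)" for n
  proof (induction n)
    case (Suc n)
    have "norm ((D ^^ Suc n) (C u)) \<le> \<kappa> * norm ((D ^^ n) (C u))"
      using contr[OF DnZ[of n]] by simp
    also have "\<dots> \<le> \<kappa> * (\<kappa> ^ n * norm (C u))" using Suc \<kappa> by (intro mult_left_mono)
    finally show ?case by simp
  qed simp
  define G where "G n = (\<Sum>k<n. (D ^^ k) (C u))" for n
  have tele: "u - G n = (D ^^ n) u" for n
  proof (induction n)
    case (Suc n)
    have "u - G (Suc n) = (u - G n) - C ((D ^^ n) u)" by (simp add: G_def DnC)
    also have "\<dots> = D ((D ^^ n) u)" unfolding Suc by (simp only: D_def)
    finally show ?case by simp
  qed (simp add: G_def)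
  have "summable (\<lambda>n. \<kappa> ^ n * norm (C u))" using \<kappa> by (intro summable_mult2 summable_geometric) auto
  then have "summable (\<lambda>n. (D ^^ n) (C u))"
    by (rule summable_comparison_test[rotated]) (use Dn in auto)
  then obtain w where w: "G \<longlonglongrightarrow> w" unfolding G_def by (auto simp: summable_def sums_def)
  have GZ: "G n \<in> Z" for n
    unfolding G_def by (intro subspace_sum Z DnZ)
  have wY: "w \<in> Y"
    using closed_sequentially[OF Y(2) _ w] GZ ZY by auto
  \<comment> \<open>The sequence \<open>(D ^^ n) u\<close> converges, but only its image under
    \<open>C\<close> is seen to tend to 0, because \<open>D\<close> contracts on the range of
    \<open>C\<close> only.\<close>
  have "(\<lambda>n. (D ^^ n) u) \<longlonglongrightarrow> u - w"
    unfolding tele[symmetric] by (intro tendsto_intros w)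
  then have "(\<lambda>n. C ((D ^^ n) u)) \<longlonglongrightarrow> C (u - w)" by (rule C.tendsto)
  moreover have "(\<lambda>n. C ((D ^^ n) u)) \<longlonglongrightarrow> 0"
  proof (rule Lim_null_comparison)
    show "\<forall>\<^sub>F n in sequentially. norm (C ((D ^^ n) u)) \<le> \<kappa> ^ n * norm (C u)"
      using Dn by (simp add: DnC)
    show "(\<lambda>n. \<kappa> ^ n * norm (C u)) \<longlonglongrightarrow> 0"
      using \<kappa> by (intro tendsto_mult_left_zero LIMSEQ_power_zero) auto
  qed
  ultimately have "C (u - w) = 0" using LIMSEQ_unique by blast
  then have "u = w" using ker[of "u - w"] u wY Y(1) by (simp add: subspace_diff)
  then have G: "G \<longlonglongrightarrow> u" using w by simp
  show ?thesis
  proof (rule LIMSEQ_le)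
    show "(\<lambda>n. \<delta> * (norm (G n))\<^sup>2) \<longlonglongrightarrow> \<delta> * (norm u)\<^sup>2" by (intro tendsto_intros G)
    show "(\<lambda>n. inner (C (G n)) (G n)) \<longlonglongrightarrow> inner (C u) u" by (intro tendsto_intros G C.tendsto)
    show "\<exists>N. \<forall>n\<ge>N. \<delta> * (norm (G n))\<^sup>2 \<le> inner (C (G n)) (G n)"
    proof (intro exI allI impI)
      fix n
      obtain v where "v \<in> Y" "G n = C v" using GZ[of n] by (auto simp: Z_def)
      then show "\<delta> * (norm (G n))\<^sup>2 \<le> inner (C (G n)) (G n)" using ran by simp
    qed
  qed
qed

section \<open>Symmetric contraction semigroups\<close>

text \<open>Since \<open>X\<close> is a set and not a type, \<open>S s\<close> is linear on the
  whole type, and the retraction \<open>P\<close> onto \<open>X\<close> keeps integrals of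
  \<open>X\<close>-valued functions inside \<open>X\<close>. Only the real inner product enters
  here.\<close>

locale contraction_semigroup =
  fixes X :: "'h::{real_inner,banach} set" and P :: "'h \<Rightarrow> 'h" and S :: "real \<Rightarrow> 'h \<Rightarrow> 'h"
  assumes X: "subspace X" "closed X"
    and P: "bounded_linear P" "\<And>f. P f \<in> X" "\<And>f. f \<in> X \<Longrightarrow> P f = f"
    and bl: "\<And>s. s \<ge> 0 \<Longrightarrow> bounded_linear (S s)"
    and SX: "\<And>s f. s \<ge> 0 \<Longrightarrow> f \<in> X \<Longrightarrow> S s f \<in> X"
    and S0: "\<And>f. f \<in> X \<Longrightarrow> S 0 f = f"
    and Sadd: "\<And>s r f. s \<ge> 0 \<Longrightarrow> r \<ge> 0 \<Longrightarrow> f \<in> X \<Longrightarrow> S (s + r) f = S s (S r f)"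
    and sym: "\<And>s f g. s \<ge> 0 \<Longrightarrow> f \<in> X \<Longrightarrow> g \<in> X \<Longrightarrow> inner (S s f) g = inner f (S s g)"
    and contr: "\<And>s f. s \<ge> 0 \<Longrightarrow> f \<in> X \<Longrightarrow> norm (S s f) \<le> norm f"
    and cont0: "\<And>f. f \<in> X \<Longrightarrow> ((\<lambda>s. S s f) \<longlongrightarrow> f) (at_right 0)"
begin

lemma half: "s \<ge> 0 \<Longrightarrow> f \<in> X \<Longrightarrow> inner (S s f) f = (norm (S (s / 2) f))\<^sup>2"
  using Sadd[of "s/2" "s/2" f] sym[of "s/2" "S (s/2) f" f] SX[of "s/2" f]
  by (simp add: power2_norm_eq_inner)

lemma form_nonneg: "s \<ge> 0 \<Longrightarrow> f \<in> X \<Longrightarrow> 0 \<le> inner (S s f) f"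
  by (simp add: half)

lemma form_decreasing:
  assumes "0 \<le> r" "r \<le> s" "f \<in> X"
  shows "inner (S s f) f \<le> inner (S r f) f"
proof -
  have "S (s / 2) f = S ((s - r) / 2) (S (r / 2) f)"
    using Sadd[of "(s - r) / 2" "r / 2" f] assms by (simp add: diff_divide_distrib)
  then have "norm (S (s / 2) f) \<le> norm (S (r / 2) f)"
    using contr[of "(s - r) / 2" "S (r / 2) f"] SX[of "r / 2" f] assms by simp
  then show ?thesis using assms by (simp add: half power_mono)
qed

lemma diff_bound:
  assumes "0 \<le> r" "r \<le> s" "f \<in> X"
  shows "norm (S s f - S r f) \<le> norm (S (s - r) f - f)"
proof -
  interpret b: bounded_linear "S r" using bl assms by simp
  have "S s f - S r f = S r (S (s - r) f - f)"
    using Sadd[of r "s - r" f] assms by (simp add: b.diff)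
  then show ?thesis
    using contr[of r "S (s - r) f - f"] SX[of "s - r" f] X(1) assms by (simp add: subspace_diff)
qed

text \<open>By contractivity the modulus of continuity at any time is no worse than the one-sided
  modulus at 0.\<close>

lemma continuous: 
  assumes f: "f \<in> X"
  shows "continuous_on {0..} (\<lambda>s. S s f)"
  unfolding continuous_on_iff
proof (intro ballI allI impI)
  fix s e :: real assume s: "s \<in> {0..}" and e: "e > 0"
  have "eventually (\<lambda>h. dist (S h f) f < e) (at_right 0)"
    using cont0[OF f] e by (rule tendstoD)
  then obtain b where b: "b > 0" "\<And>h. 0 < h \<Longrightarrow> h < b \<Longrightarrow> dist (S h f) f < e"
    by (auto simp: eventually_at_right_field)
  show "\<exists>d>0. \<forall>x'\<in>{0..}. dist x' s < d \<longrightarrow> dist (S x' f) (S s f) < e"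
  proof (intro exI[of _ b] conjI b ballI impI)
    fix r assume r: "r \<in> {0..}" "dist r s < b"
    consider "r = s" | "r < s" | "s < r" by linarith
    then show "dist (S r f) (S s f) < e"
    proof cases
      case 2
      then show ?thesis using diff_bound[of r s f] b(2)[of "s - r"] r s f
        by (simp add: dist_norm norm_minus_commute)
    next
      case 3
      then show ?thesis using diff_bound[of s r f] b(2)[of "r - s"] r s f
        by (simp add: dist_norm)
    qed (use e in simp)
  qed
qed

text \<open>The graph of \<open>H\<close>, where \<open>- H\<close> is the generator.\<close>

definition gen :: "('h \<times> 'h) set" where
  "gen = {(f, g). f \<in> X \<and> g \<in> X \<and> ((\<lambda>h. (S h f - f) /\<^sub>R h) \<longlongrightarrow> - g) (at_right 0)}"

text \<open>\<open>gen\<close> provides a one-sided derivative at 0 and nothing more. If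
  \<open>s\<close> is cut into \<open>n\<close> equal steps, each step misses the exponential by
  \<open>o(1/n)\<close>, and contractivity lets these errors add up instead of being
  amplified.\<close>

lemma eigenvector_semigroup:
  assumes "(\<phi>, lam *\<^sub>R \<phi>) \<in> gen" and s: "s \<ge> 0"
  shows "S s \<phi> = exp (- lam * s) *\<^sub>R \<phi>"
proof (cases "s = 0")
  case True
  then show ?thesis using assms S0 by (simp add: gen_def)
next
  case False
  with s have s: "s > 0" by simp
  have \<phi>: "\<phi> \<in> X" and lim: "((\<lambda>h. (S h \<phi> - \<phi>) /\<^sub>R h) \<longlongrightarrow> - (lam *\<^sub>R \<phi>)) (at_right 0)"
    using assms by (auto simp: gen_def)
  define D where "D h = S h \<phi> - exp (- lam * h) *\<^sub>R \<phi>" for h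
  have "((\<lambda>h. (S h \<phi> - \<phi>) /\<^sub>R h - ((exp (- lam * h) - 1) / h) *\<^sub>R \<phi>) \<longlongrightarrow> - (lam *\<^sub>R \<phi>) - (- lam) *\<^sub>R \<phi>) (at_right 0)"
  proof (intro tendsto_intros lim)
    have "((\<lambda>h. exp (- lam * h)) has_real_derivative - lam) (at 0)"
      by (auto intro!: derivative_eq_intros)
    then show "((\<lambda>h. (exp (- lam * h) - 1) / h) \<longlongrightarrow> - lam) (at_right 0)"
      by (auto simp: has_field_derivative_iff intro: tendsto_mono[OF at_le])
  qed
  then have D0: "((\<lambda>h. D h /\<^sub>R h) \<longlongrightarrow> 0) (at_right 0)"
    by (simp add: D_def scaleR_diff_right scaleR_diff_left divide_inverse mult.commute algebra_simps)
  define M where "M = exp (\<bar>lam\<bar> * s)"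
  \<comment> \<open>Each new step contributes one defect \<open>D h\<close>, carried along by a
    contraction, while the old error is multiplied by at most
    \<open>exp (\<bar>lam\<bar> * h)\<close>.\<close>
  have tele: "norm (S (real n * h) \<phi> - exp (- lam * (real n * h)) *\<^sub>R \<phi>)
      \<le> real n * norm (D h) * exp (\<bar>lam\<bar> * (real n * h))"
    if h: "h \<ge> 0" for n h
  proof (induction n)
    case 0
    then show ?case using S0[OF \<phi>] by simp
  next
    case (Suc n)
    let ?a = "norm (S (real n * h) \<phi> - exp (- lam * (real n * h)) *\<^sub>R \<phi>)"
    interpret b: bounded_linear "S (real n * h)" using bl h by simp
    have e: "exp (- (lam * h)) * exp (- (lam * (real n * h))) = exp (- (lam * (real (Suc n) * h)))"
      by (simp add: exp_add[symmetric] algebra_simps)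
    have "S (real (Suc n) * h) \<phi> = S (real n * h) (S h \<phi>)"
      using Sadd[of "real n * h" h \<phi>] h \<phi> by (simp add: algebra_simps)
    also have "S h \<phi> = D h + exp (- lam * h) *\<^sub>R \<phi>" by (simp add: D_def)
    finally have "S (real (Suc n) * h) \<phi> - exp (- lam * (real (Suc n) * h)) *\<^sub>R \<phi>
        = S (real n * h) (D h) + exp (- lam * h) *\<^sub>R (S (real n * h) \<phi> - exp (- lam * (real n * h)) *\<^sub>R \<phi>)"
      by (simp add: b.add b.scaleR scaleR_diff_right e del: of_nat_Suc)
    also have "norm \<dots> \<le> norm (S (real n * h) (D h)) + exp (- lam * h) * ?a"
      by (rule order.trans[OF norm_triangle_ineq]) simp
    also have "norm (S (real n * h) (D h)) \<le> norm (D h)"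
      using h \<phi> SX X(1) by (intro contr) (auto simp: D_def subspace_diff subspace_scale)
    also have "\<dots> \<le> norm (D h) * exp (\<bar>lam\<bar> * (real (Suc n) * h))"
      using h mult_left_mono[of 1 "exp (\<bar>lam\<bar> * (real (Suc n) * h))" "norm (D h)"] by simp
    also have "exp (- lam * h) * ?a \<le> exp (\<bar>lam\<bar> * h) * (real n * norm (D h) * exp (\<bar>lam\<bar> * (real n * h)))"
    proof (rule mult_mono[OF _ Suc])
      have "- lam * h \<le> \<bar>lam\<bar> * h" using h by (intro mult_right_mono) auto
      then show "exp (- lam * h) \<le> exp (\<bar>lam\<bar> * h)" by (simp only: exp_le_cancel_iff)
    qed auto
    also have "\<dots> = real n * norm (D h) * exp (\<bar>lam\<bar> * (real (Suc n) * h))"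
      by (simp add: exp_add algebra_simps)
    finally show ?case by (simp add: algebra_simps)
  qed
  have lim0: "(\<lambda>n. s / real (Suc n)) \<longlonglongrightarrow> 0"
    by (rule LIMSEQ_Suc[OF lim_const_over_n])
  then have "filterlim (\<lambda>n. s / real (Suc n)) (at_right 0) sequentially"
    using s by (auto simp: filterlim_at intro!: always_eventually)
  from filterlim_compose[OF D0 this]
  have "(\<lambda>n. D (s / real (Suc n)) /\<^sub>R (s / real (Suc n))) \<longlonglongrightarrow> 0" .
  then have "(\<lambda>n. s * exp (\<bar>lam\<bar> * s) * norm (D (s / real (Suc n)) /\<^sub>R (s / real (Suc n)))) \<longlonglongrightarrow> 0"
    by (intro tendsto_mult_right_zero tendsto_norm_zero)
  moreover have "norm (S s \<phi> - exp (- lam * s) *\<^sub>R \<phi>)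
      \<le> s * exp (\<bar>lam\<bar> * s) * norm (D (s / real (Suc n)) /\<^sub>R (s / real (Suc n)))" for n
    using tele[of "s / real (Suc n)" "Suc n"] s by (simp add: field_simps del: of_nat_Suc)
  ultimately have "norm (S s \<phi> - exp (- lam * s) *\<^sub>R \<phi>) \<le> 0"
    by (intro LIMSEQ_le_const) auto
  then show ?thesis by simp
qed

text \<open>The witness is the integral of \<open>exp (\<nu> r) S\<^sub>r f\<close> over \<open>0 \<le> r \<le> s\<close>.\<close>

lemma resolvent_integral:
  assumes f: "f \<in> X" and s: "s > 0"
  obtains g where "(g, \<nu> *\<^sub>R g + f - exp (\<nu> * s) *\<^sub>R S s f) \<in> gen"
    and "\<nu> \<ge> 0 \<Longrightarrow> s * inner (S s f) f \<le> inner g f"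
proof -
  define w where "w r = exp (\<nu> * r) *\<^sub>R S r f" for r
  have wc: "continuous_on {0..} w"
    unfolding w_def by (intro continuous_intros continuous f)
  have wi: "w integrable_on {a..b}" if "a \<ge> 0" for a b
    using that by (intro integrable_continuous_interval continuous_on_subset[OF wc]) auto
  define F where "F x = integral {0..x} w" for x
  have FX: "F x \<in> X" if "x \<ge> 0" for x
  proof -
    \<comment> \<open>\<open>P\<close> fixes the values of \<open>w\<close> and commutes with the
      integral, so the integral is fixed by \<open>P\<close> as well.\<close>
    have "P (F x) = integral {0..x} (P \<circ> w)"
      unfolding F_def by (rule integral_linear[symmetric, OF wi P(1)]) simp
    also have "\<dots> = F x"
      unfolding F_def w_def
      by (intro integral_cong) (simp add: P(3) SX f X(1) subspace_scale)
    finally show ?thesis using P(2)[of "F x"] by simp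
  qed
  have Fd: "((\<lambda>h. (F (x + h) - F x) /\<^sub>R h) \<longlongrightarrow> w x) (at_right 0)" if "x \<ge> 0" for x
  proof -
    have "(F has_vector_derivative w x) (at x within {0..x + 1})"
      unfolding F_def
      by (rule integral_has_vector_derivative) (use that in \<open>auto intro: continuous_on_subset[OF wc]\<close>)
    then have "((\<lambda>y. (1 / norm (y - x)) *\<^sub>R (F y - (F x + (y - x) *\<^sub>R w x))) \<longlongrightarrow> 0) (at x within {0..x + 1})"
      unfolding has_vector_derivative_def has_derivative_within by blast
    moreover have "filterlim (\<lambda>h. x + h) (at x within {0..x + 1}) (at_right 0)"
      unfolding filterlim_at using that
      by (auto intro!: tendsto_eq_intros eventually_at_rightI[of 0 1])
    ultimately have "((\<lambda>h. (1 / norm (x + h - x)) *\<^sub>R (F (x + h) - (F x + (x + h - x) *\<^sub>R w x))) \<longlongrightarrow> 0) (at_right 0)"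
      by (rule filterlim_compose)
    then have "((\<lambda>h. (F (x + h) - F x) /\<^sub>R h - w x) \<longlongrightarrow> 0) (at_right 0)"
      by (rule Lim_transform_eventually)
         (auto simp: scaleR_diff_right scaleR_add_right divide_inverse algebra_simps intro!: eventually_at_rightI[of 0 1])
    then show ?thesis by (simp add: Lim_null[symmetric])
  qed
  \<comment> \<open>The semigroup law moves the interval of integration by \<open>h\<close>, so
    \<open>S h (F s)\<close> is expressed through increments of \<open>F\<close>.\<close>
  have shift: "exp (\<nu> * h) *\<^sub>R S h (F s) = F (s + h) - F h" if h: "h \<ge> 0" for h
  proof -
    have "exp (\<nu> * h) *\<^sub>R S h (F s) = integral {0..s} ((\<lambda>x. exp (\<nu> * h) *\<^sub>R S h x) \<circ> w)"
      unfolding F_def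
      by (rule integral_linear[symmetric, OF wi]) (use bl h in \<open>auto intro!: bounded_linear_compose[OF bounded_linear_scaleR_right]\<close>)
    also have "\<dots> = integral {0..s} (w \<circ> (+) h)"
    proof (rule integral_cong)
      fix r assume r: "r \<in> {0..s}"
      interpret b: bounded_linear "S h" using bl h by simp
      show "((\<lambda>x. exp (\<nu> * h) *\<^sub>R S h x) \<circ> w) r = (w \<circ> (+) h) r"
        using Sadd[of h r f] h r f by (simp add: w_def b.scaleR exp_add distrib_left)
    qed
    also have "\<dots> = integral {0 + h..s + h} w"
    proof (rule integral_unique)
      show "((w \<circ> (+) h) has_integral integral {0 + h..s + h} w) {0..s}"
        unfolding has_integral_shift_Icc_real by (rule integrable_integral) (use h in \<open>auto intro: wi\<close>)
    qed
    also have "\<dots> = F (s + h) - F h"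
      using Henstock_Kurzweil_Integration.integral_combine[where a=0 and c=h and b="s + h" and f=w] h s wi[of 0 "s + h"] by (simp add: F_def algebra_simps)
    finally show ?thesis .
  qed
  show ?thesis
  proof
    \<comment> \<open>The difference quotient of the orbit of \<open>F s\<close> is assembled from
      those of \<open>F\<close> at \<open>s\<close> and at 0 and from that of
      \<open>exp (- \<nu> * h)\<close>. The limit is minus the second component of the pair.\<close>
    have "((\<lambda>h. exp (- \<nu> * h) *\<^sub>R ((F (s + h) - F s) /\<^sub>R h - (F (0 + h) - F 0) /\<^sub>R h) + ((exp (- \<nu> * h) - 1) / h) *\<^sub>R F s)
        \<longlongrightarrow> exp (- \<nu> * 0) *\<^sub>R (w s - w 0) + (- \<nu>) *\<^sub>R F s) (at_right 0)"
    proof (intro tendsto_intros Fd)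
      have "((\<lambda>h. exp (- \<nu> * h)) has_real_derivative - \<nu>) (at 0)"
        by (auto intro!: derivative_eq_intros)
      then show "((\<lambda>h. (exp (- \<nu> * h) - 1) / h) \<longlongrightarrow> - \<nu>) (at_right 0)"
        by (auto simp: has_field_derivative_iff intro: tendsto_mono[OF at_le])
    qed (use s in auto)
    moreover have "\<forall>\<^sub>F h in at_right 0. exp (- \<nu> * h) *\<^sub>R ((F (s + h) - F s) /\<^sub>R h - (F (0 + h) - F 0) /\<^sub>R h)
        + ((exp (- \<nu> * h) - 1) / h) *\<^sub>R F s = (S h (F s) - F s) /\<^sub>R h"
    proof (rule eventually_at_rightI[of 0 1])
      fix h :: real assume "h \<in> {0<..<1}"
      then have h: "h > 0" by simp
      have "S h (F s) = exp (- \<nu> * h) *\<^sub>R (exp (\<nu> * h) *\<^sub>R S h (F s))"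
        by (simp add: exp_minus)
      then have e: "S h (F s) = exp (- \<nu> * h) *\<^sub>R (F (s + h) - F h)"
        using shift[of h] h by simp
      show "exp (- \<nu> * h) *\<^sub>R ((F (s + h) - F s) /\<^sub>R h - (F (0 + h) - F 0) /\<^sub>R h)
        + ((exp (- \<nu> * h) - 1) / h) *\<^sub>R F s = (S h (F s) - F s) /\<^sub>R h"
        unfolding e by (simp add: F_def algebra_simps divide_inverse)
    qed simp
    ultimately have "((\<lambda>h. (S h (F s) - F s) /\<^sub>R h) \<longlongrightarrow> exp (- \<nu> * 0) *\<^sub>R (w s - w 0) + (- \<nu>) *\<^sub>R F s) (at_right 0)"
      by (rule Lim_transform_eventually)
    moreover have "exp (- \<nu> * 0) *\<^sub>R (w s - w 0) + (- \<nu>) *\<^sub>R F s = - (\<nu> *\<^sub>R F s + f - exp (\<nu> * s) *\<^sub>R S s f)"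
      using S0[OF f] by (simp add: w_def)
    ultimately have lim: "((\<lambda>h. (S h (F s) - F s) /\<^sub>R h) \<longlongrightarrow> - (\<nu> *\<^sub>R F s + f - exp (\<nu> * s) *\<^sub>R S s f)) (at_right 0)"
      by (simp only:)
    have "\<nu> *\<^sub>R F s + f - exp (\<nu> * s) *\<^sub>R S s f \<in> X"
      using FX[of s] s f X(1) SX by (intro subspace_add subspace_diff subspace_scale) auto
    then show "(F s, \<nu> *\<^sub>R F s + f - exp (\<nu> * s) *\<^sub>R S s f) \<in> gen"
      unfolding gen_def using FX[OF less_imp_le[OF s]] lim by blast
    have Fin: "inner (F s) u = integral {0..s} (\<lambda>r. inner (w r) u)" for u
      unfolding F_def using integral_linear[OF wi[of 0 s] bounded_linear_inner_left[of u]] by (simp add: o_def)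
    \<comment> \<open>The exponential is at least 1 and the form decreases in time, so the integrand
      never falls below its counterpart at time \<open>s\<close>.\<close>
    show "s * inner (S s f) f \<le> inner (F s) f" if \<nu>: "\<nu> \<ge> 0"
    proof -
      have "s * inner (S s f) f = integral {0..s} (\<lambda>r. inner (S s f) f)" using s by simp
      also have "\<dots> \<le> integral {0..s} (\<lambda>r. inner (w r) f)"
      proof (rule integral_le)
        show "(\<lambda>r. inner (w r) f) integrable_on {0..s}"
          by (intro integrable_continuous_interval continuous_intros continuous_on_subset[OF wc]) auto
        fix r assume r: "r \<in> {0..s}"
        have "inner (S s f) f \<le> 1 * inner (S r f) f" using form_decreasing[of r s f] r f by simp
        also have "\<dots> \<le> exp (\<nu> * r) * inner (S r f) f"
          using r \<nu> f by (intro mult_right_mono form_nonneg) auto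
        finally show "inner (S s f) f \<le> inner (w r) f" by (simp add: w_def)
      qed auto
      finally show ?thesis by (simp add: Fin)
    qed
  qed
qed

text \<open>The operator of \<open>gen\<close>, shifted by \<open>\<nu>\<close>, is bounded below on
  its domain. This is the half of membership in the resolvent set that the norm estimates below
  consume.\<close>

definition regular :: "real \<Rightarrow> bool" where
  "regular \<nu> \<longleftrightarrow> (\<exists>K. \<forall>f g. (f, g) \<in> gen \<longrightarrow> norm f \<le> K * norm (g - \<nu> *\<^sub>R f))"

text \<open>Half of a spectral mapping theorem. If \<open>S s f\<close> is close to
  \<open>exp (- \<nu> * s) *\<^sub>R f\<close>, then the shifted operator maps the integral
  \<open>g\<close> of \<open>resolvent_integral\<close> to a small vector, so \<open>g\<close> is
  small. But \<open>inner g f\<close> is at least about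
  \<open>s * exp (- \<nu> * s) * (norm f)\<^sup>2\<close>.\<close>

lemma regular_bounded_below:
  assumes "regular \<nu>" "\<nu> \<ge> 0" and s: "s > 0"
  shows "bounded_below_on X (\<lambda>f. S s f - exp (- \<nu> * s) *\<^sub>R f)"
proof -
  obtain K where K: "\<And>f g. (f, g) \<in> gen \<Longrightarrow> norm f \<le> K * norm (g - \<nu> *\<^sub>R f)"
    using assms by (auto simp: regular_def)
  define k where "k = s + \<bar>K\<bar> * exp (\<nu> * s)"
  have k: "k > 0" unfolding k_def using s by (simp add: add_pos_nonneg)
  have "s * exp (- \<nu> * s) * norm f \<le> k * norm (S s f - exp (- \<nu> * s) *\<^sub>R f)" if f: "f \<in> X" for f
  proof (cases "f = 0")
    case False
    define \<epsilon> where "\<epsilon> = norm (S s f - exp (- \<nu> * s) *\<^sub>R f)"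
    obtain g where g: "(g, \<nu> *\<^sub>R g + f - exp (\<nu> * s) *\<^sub>R S s f) \<in> gen" "s * inner (S s f) f \<le> inner g f"
      using resolvent_integral[OF f s] assms(2) by metis
    have "f - exp (\<nu> * s) *\<^sub>R S s f = - (exp (\<nu> * s) *\<^sub>R (S s f - exp (- \<nu> * s) *\<^sub>R f))"
      by (simp add: scaleR_diff_right exp_minus)
    then have n: "norm (f - exp (\<nu> * s) *\<^sub>R S s f) = exp (\<nu> * s) * \<epsilon>"
      by (simp add: \<epsilon>_def)
    have "norm g \<le> K * norm (f - exp (\<nu> * s) *\<^sub>R S s f)" using K[OF g(1)] by simp
    also have "\<dots> \<le> \<bar>K\<bar> * exp (\<nu> * s) * \<epsilon>" unfolding n by (simp add: \<epsilon>_def mult_right_mono)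
    finally have ng: "norm g \<le> \<bar>K\<bar> * exp (\<nu> * s) * \<epsilon>" .
    have "exp (- \<nu> * s) * (norm f)\<^sup>2 - inner (S s f) f = inner (exp (- \<nu> * s) *\<^sub>R f - S s f) f"
      by (simp add: inner_diff power2_norm_eq_inner)
    also have "\<dots> \<le> \<epsilon> * norm f"
      using norm_cauchy_schwarz[of "exp (- \<nu> * s) *\<^sub>R f - S s f" f] by (simp add: \<epsilon>_def norm_minus_commute)
    finally have "s * (exp (- \<nu> * s) * (norm f)\<^sup>2 - \<epsilon> * norm f) \<le> s * inner (S s f) f"
      using s by (intro mult_left_mono) auto
    also have "\<dots> \<le> norm g * norm f" using g(2) norm_cauchy_schwarz[of g f] by simp
    also have "\<dots> \<le> \<bar>K\<bar> * exp (\<nu> * s) * \<epsilon> * norm f" using ng by (intro mult_right_mono) auto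
    finally have "norm f * (s * exp (- \<nu> * s) * norm f) \<le> norm f * (k * \<epsilon>)"
      by (simp add: k_def power2_eq_square algebra_simps)
    then show ?thesis using False by (simp add: \<epsilon>_def)
  qed (use k in simp)
  then show ?thesis
    unfolding bounded_below_on_def using s k
    by (intro exI[of _ "s * exp (- \<nu> * s) / k"]) (simp add: field_simps)
qed

text \<open>Suppose the supremum \<open>m\<close> of the form over unit vectors of \<open>Y\<close>
  exceeds \<open>exp (- t * s)\<close>, and write \<open>m = exp (- \<mu> * s)\<close> with
  \<open>\<mu> < t\<close>. Then \<open>\<mu>\<close> is not regular, so by \<open>gap\<close> all
  points just above it are, and \<open>C = m - S s\<close> has a gap above 0. A kernel vector of
  \<open>C\<close> would yield an eigenvector of low eigenvalue that is not orthogonal to it. So the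
  kernel is trivial, \<open>C\<close> is coercive, and \<open>m\<close> is not the supremum.\<close>

theorem form_bound_orthogonal_to_low_eigenvectors:
  assumes gap: "\<And>\<mu>. 0 \<le> \<mu> \<Longrightarrow> \<mu> < t \<Longrightarrow> \<not> regular \<mu> \<Longrightarrow> \<exists>\<delta>>0. \<forall>\<nu>. \<mu> < \<nu> \<and> \<nu> < \<mu> + \<delta> \<longrightarrow> regular \<nu>"
    and u: "u \<in> X" and ortho: "\<And>\<mu> e. \<mu> < t \<Longrightarrow> (e, \<mu> *\<^sub>R e) \<in> gen \<Longrightarrow> inner u e = 0"
    and s: "s > 0"
  shows "inner (S s u) u \<le> exp (- t * s) * (norm u)\<^sup>2"
proof (rule ccontr)
  assume neg: "\<not> ?thesis"
  define Y where "Y = {v \<in> X. \<forall>\<mu> e. \<mu> < t \<longrightarrow> (e, \<mu> *\<^sub>R e) \<in> gen \<longrightarrow> inner v e = 0}"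
  have YX: "Y \<subseteq> X" by (auto simp: Y_def)
  have uY: "u \<in> Y" using u ortho by (auto simp: Y_def)
  have subY: "subspace Y"
    using X(1) unfolding subspace_def Y_def by (auto simp: inner_add_left)
  have "Y = X \<inter> (\<Inter>\<mu>\<in>{..<t}. \<Inter>e\<in>{e. (e, \<mu> *\<^sub>R e) \<in> gen}. {v. inner v e = 0})"
    by (auto simp: Y_def)
  then have clY: "closed Y"
    using X(2) by (auto intro!: closed_Int closed_INT closed_Collect_eq continuous_intros)
  interpret b: bounded_linear "S s" using bl s by simp
  have SY: "S s v \<in> Y" if "v \<in> Y" for v
  proof -
    have "inner (S s v) e = 0" if "\<mu> < t" "(e, \<mu> *\<^sub>R e) \<in> gen" for \<mu> e
    proof -
      have "inner (S s v) e = inner v (S s e)"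
        using sym[of s v e] s \<open>v \<in> Y\<close> that by (auto simp: Y_def gen_def)
      then show ?thesis
        using eigenvector_semigroup[OF that(2), of s] s \<open>v \<in> Y\<close> that by (auto simp: Y_def)
    qed
    then show ?thesis using that SX s by (auto simp: Y_def)
  qed
  have unz: "u \<noteq> 0" using neg by auto
  define U where "U = {inner (S s v) v | v. v \<in> Y \<and> norm v = 1}"
  have U1: "x \<le> 1" if xU: "x \<in> U" for x
  proof -
    obtain v where v: "x = inner (S s v) v" "v \<in> X" "norm v = 1" using xU YX by (auto simp: U_def)
    then show ?thesis using form_decreasing[of 0 s v] S0[of v] s by (simp add: power2_norm_eq_inner[symmetric])
  qed
  then have bdd: "bdd_above U" by (rule bdd_aboveI)
  have fU: "inner (S s v) v / (norm v)\<^sup>2 \<in> U" if "v \<in> Y" "v \<noteq> 0" for v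
    unfolding U_def using that subY
    by (intro CollectI exI[of _ "(1 / norm v) *\<^sub>R v"])
       (simp add: b.scaleR subspace_scale power2_eq_square)
  define m where "m = Sup U"
  have um: "inner (S s v) v \<le> m * (norm v)\<^sup>2" if v: "v \<in> Y" for v
  proof (cases "v = 0")
    case False
    have "inner (S s v) v / (norm v)\<^sup>2 \<le> m" unfolding m_def by (intro cSup_upper fU v False bdd)
    then show ?thesis using False by (simp add: field_simps)
  qed simp
  have "exp (- t * s) < inner (S s u) u / (norm u)\<^sup>2" using neg unz by (simp add: field_simps)
  also have "\<dots> \<le> m" unfolding m_def by (intro cSup_upper fU uY unz bdd)
  finally have mt: "exp (- t * s) < m" .
  have m0: "m > 0" using mt exp_gt_zero[of "- t * s"] by linarith
  have m1: "m \<le> 1" unfolding m_def using fU[OF uY unz] U1 by (intro cSup_least) auto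
  have msup: "\<exists>v\<in>Y. norm v = 1 \<and> m - e < inner (S s v) v" if "e > 0" for e
  proof -
    have "\<exists>x\<in>U. m - e < x" unfolding m_def using fU[OF uY unz] that bdd
      by (intro less_cSupD) auto
    then show ?thesis by (auto simp: U_def)
  qed
  define C where "C v = m *\<^sub>R v - S s v" for v
  have C: "bounded_linear C" unfolding C_def[abs_def]
    by (intro bounded_linear_sub bounded_linear_scaleR_right b.bounded_linear_axioms)
  have CY: "C v \<in> Y" if "v \<in> Y" for v using that SY subY by (simp add: C_def subspace_diff subspace_scale)
  have symC: "inner (C f) g = inner f (C g)" if "f \<in> Y" "g \<in> Y" for f g
    using that sym[of s f g] s YX by (auto simp: C_def inner_diff)
  have formC: "inner (C f) f = m * (norm f)\<^sup>2 - inner (S s f) f" for f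
    by (simp add: C_def inner_diff power2_norm_eq_inner)
  have posC: "0 \<le> inner (C f) f" if "f \<in> Y" for f using um[OF that] by (simp add: formC)
  have C1: "inner (C f) f \<le> (norm f)\<^sup>2" if "f \<in> Y" for f
    using form_nonneg[of s f] s that YX mult_right_mono[OF m1, of "(norm f)\<^sup>2"] by (force simp: formC)
  define \<mu> where "\<mu> = - ln m / s"
  have m\<mu>: "m = exp (- \<mu> * s)" using s m0 by (simp add: \<mu>_def)
  have \<mu>0: "0 \<le> \<mu>" using m1 m0 s by (simp add: \<mu>_def divide_nonpos_pos)
  have \<mu>t: "\<mu> < t" using mt s by (simp add: m\<mu>)
  \<comment> \<open>\<open>C - z\<close> is the negative of \<open>S s - exp (- \<nu> * s)\<close>.
    Values \<open>z > 0\<close> correspond to \<open>\<nu> > \<mu>\<close>, which is why a gap on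
    the right of \<open>\<mu>\<close> is enough.\<close>
  have bbY: "bounded_below_on Y (\<lambda>v. C v - z *\<^sub>R v)" if "regular \<nu>" "\<nu> \<ge> 0" "m - z = exp (- \<nu> * s)" for z \<nu>
  proof -
    have e: "norm (C v - z *\<^sub>R v) = norm (S s v - exp (- \<nu> * s) *\<^sub>R v)" for v
      unfolding that(3)[symmetric] C_def by (subst norm_minus_cancel[symmetric]) (simp add: algebra_simps)
    show ?thesis using regular_bounded_below[OF that(1,2) s] YX
      unfolding bounded_below_on_def e by blast
  qed
  have "\<not> regular \<mu>"
  proof
    assume "regular \<mu>"
    then have "bounded_below_on Y C" using bbY[of \<mu> 0] \<mu>0 m\<mu> by simp
    then obtain c where c: "c > 0" "\<And>v. v \<in> Y \<Longrightarrow> c * norm v \<le> norm (C v)"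
      by (auto simp: bounded_below_on_def)
    obtain v where v: "v \<in> Y" "norm v = 1" "m - c\<^sup>2 < inner (S s v) v" using msup[of "c\<^sup>2"] c by auto
    have "c\<^sup>2 \<le> (norm (C v))\<^sup>2" using c(2)[OF v(1)] v(2) c(1) by (simp add: power_mono)
    also have "\<dots> \<le> 1 * inner (C v) v"
      by (rule positive_form_norm_bound[OF C subY CY symC posC _ v(1)]) (use C1 in auto)
    finally show False using v by (simp add: formC)
  qed
  then obtain \<delta> where \<delta>: "\<delta> > 0" "\<And>\<nu>. \<mu> < \<nu> \<Longrightarrow> \<nu> < \<mu> + \<delta> \<Longrightarrow> regular \<nu>"
    using gap[OF \<mu>0 \<mu>t] by auto
  define \<delta>' where "\<delta>' = m - exp (- (\<mu> + \<delta>) * s)"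
  have \<delta>': "\<delta>' > 0"
  proof -
    have "- (\<mu> + \<delta>) * s < - \<mu> * s" using \<delta>(1) s by (intro mult_strict_right_mono) auto
    then have "exp (- (\<mu> + \<delta>) * s) < m" by (subst m\<mu>) (simp only: exp_less_cancel_iff)
    then show ?thesis by (simp add: \<delta>'_def)
  qed
  have coer: "\<delta>' * (norm v)\<^sup>2 \<le> inner (C v) v" if v: "v \<in> Y" for v
  proof (rule positive_gap_coercive[OF C subY clY CY symC posC C1 _ _ v \<delta>'])
    fix z assume z: "0 < z" "z < \<delta>'"
    define \<nu> where "\<nu> = - ln (m - z) / s"
    have mz: "exp (- (\<mu> + \<delta>) * s) < m - z" using z by (simp add: \<delta>'_def)
    then have mz0: "0 < m - z" using exp_gt_zero[of "- (\<mu> + \<delta>) * s"] by linarith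
    have \<nu>: "m - z = exp (- \<nu> * s)" using mz0 s by (simp add: \<nu>_def)
    have "exp (- \<nu> * s) < exp (- \<mu> * s)" unfolding \<nu>[symmetric] m\<mu>[symmetric] using z by linarith
    then have 1: "\<mu> < \<nu>" using s by simp
    have "- (\<mu> + \<delta>) * s < - \<nu> * s" using mz unfolding \<nu> by (simp only: exp_less_cancel_iff)
    then have "\<nu> < \<mu> + \<delta>" using mult_right_less_imp_less[of "- (\<mu> + \<delta>)" s "- \<nu>"] s by simp
    then show "bounded_below_on Y (\<lambda>f. C f - z *\<^sub>R f)" using 1 \<mu>0 \<nu> \<delta>(2) by (intro bbY[of \<nu>]) auto
  next
    fix v assume v: "v \<in> Y" "C v = 0"
    then have vX: "v \<in> X" and Sv: "S s v = m *\<^sub>R v" using YX by (auto simp: C_def)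
    \<comment> \<open>As \<open>S s v = m v\<close>, the integral of
      \<open>exp (\<mu> * r) *\<^sub>R S r v\<close> is an exact eigenvector. By definition of
      \<open>Y\<close> it is orthogonal to \<open>v\<close>, yet the inner product of the two is at
      least \<open>s * m * (norm v)\<^sup>2\<close>.\<close>
    obtain g where g: "(g, \<mu> *\<^sub>R g + v - exp (\<mu> * s) *\<^sub>R S s v) \<in> gen" "s * inner (S s v) v \<le> inner g v"
      using resolvent_integral[OF vX s] \<mu>0 by metis
    have "exp (\<mu> * s) *\<^sub>R S s v = v" by (simp add: Sv m\<mu> exp_minus)
    with g have "(g, \<mu> *\<^sub>R g) \<in> gen" by simp
    then have "inner v g = 0" using v(1) \<mu>t by (auto simp: Y_def)
    with g(2) have "s * m * (norm v)\<^sup>2 \<le> 0"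
      by (simp add: Sv inner_commute power2_norm_eq_inner)
    then show "v = 0" using s m0 by (simp add: mult_le_0_iff)
  qed
  obtain v where v: "v \<in> Y" "norm v = 1" "m - \<delta>' < inner (S s v) v" using msup[OF \<delta>'] by auto
  show False using coer[OF v(1)] v(2,3) by (simp add: formC)
qed

end

section \<open>The space of square integrable functions\<close>

lemma L2_cases:
  obtains f where "square_integrable f" "x = abs_L2 f"
  using that[of "rep_L2 x"] Quotient3_abs_rep[OF Quotient3_L2, of x] Quotient3_rep_reflp[OF Quotient3_L2, of x]
  by (auto simp: L2_rel_def)

lemma L2_rel_refl: "square_integrable f \<Longrightarrow> L2_rel f f"
  by (simp add: L2_rel_def)

lemma abs_L2_eqI:
  assumes "square_integrable f" "square_integrable g" "AE x in lebesgue. f x = g x"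
  shows "abs_L2 f = abs_L2 g"
  using assms by (intro Quotient3_rel_abs[OF Quotient3_L2]) (simp add: L2_rel_def)

lemma square_integrable_iff_nn:
  "square_integrable f \<longleftrightarrow> f \<in> borel_measurable lebesgue \<and> (\<integral>\<^sup>+x. ennreal ((cmod (f x))\<^sup>2) \<partial>lebesgue) < \<infinity>"
  by (auto simp: square_integrable_def integrable_iff_bounded)

lemma norm_abs_L2:
  assumes "square_integrable f"
  shows "ennreal ((norm (abs_L2 f))\<^sup>2) = (\<integral>\<^sup>+x. ennreal ((cmod (f x))\<^sup>2) \<partial>lebesgue)"
proof -
  have "norm (abs_L2 f) = sqrt (\<integral>x. (cmod (f x))\<^sup>2 \<partial>lebesgue)"
    using norm_L2.abs_eq[OF L2_rel_refl[OF assms]] .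
  then have "(norm (abs_L2 f))\<^sup>2 = (\<integral>x. (cmod (f x))\<^sup>2 \<partial>lebesgue)" by simp
  then show ?thesis using assms
    by (simp add: nn_integral_eq_integral square_integrable_def)
qed

lemma abs_L2_diff:
  assumes "square_integrable f" "square_integrable g"
  shows "abs_L2 f - abs_L2 g = abs_L2 (\<lambda>x. f x - g x)"
  using minus_L2.abs_eq[OF L2_rel_refl[OF assms(1)] L2_rel_refl[OF assms(2)]] .

text \<open>Riesz-Fischer. Along a fast subsequence the squared distances are at most
  \<open>(1/4) ^ k\<close>. Summed with weights \<open>2 ^ k\<close> they are finite almost
  everywhere, so the increments are eventually at most \<open>sqrt (1/2) ^ k\<close> and the
  subsequence converges pointwise; Fatou then gives convergence in norm.\<close>

lemma L2_complete:
  fixes X :: "nat \<Rightarrow> 'a::euclidean_space L2"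
  assumes "Cauchy X"
  shows "convergent X"
proof -
  have "\<exists>N. \<forall>m\<ge>N. \<forall>n\<ge>N. norm (X m - X n) < (1/2) ^ k" for k :: nat
    using CauchyD[OF assms, of "(1/2)^k"] by auto
  then obtain N where N: "\<And>k m n. m \<ge> N k \<Longrightarrow> n \<ge> N k \<Longrightarrow> norm (X m - X n) < (1/2) ^ (k::nat)"
    by metis
  define r where "r k = (\<Sum>i\<le>k. N i) + k" for k
  have rN: "r k \<ge> N k" for k unfolding r_def using member_le_sum[of k "{..k}" N] by simp
  have sm: "strict_mono r" by (intro strict_monoI_Suc) (simp add: r_def)
  have rr: "norm (X (r j) - X (r k)) < (1/2) ^ k" if "j \<ge> k" for j k
    using that rN[of k] strict_mono_mono[OF sm] by (intro N) (auto simp: monoD dest: monoD[of r k j])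
  have "\<forall>k. \<exists>f. square_integrable f \<and> X (r k) = abs_L2 f" by (meson L2_cases)
  then obtain f where f: "\<And>k. square_integrable (f k)" "\<And>k. X (r k) = abs_L2 (f k)" by metis
  have quarter: "((1/2::real) ^ k)\<^sup>2 = (1/4) ^ k" for k
    by (simp add: power2_eq_square flip: power_mult_distrib)
  have fm[measurable]: "f k \<in> borel_measurable lebesgue" for k using f by (simp add: square_integrable_def)
  have d: "(\<integral>\<^sup>+x. ennreal ((cmod (f j x - f k x))\<^sup>2) \<partial>lebesgue) \<le> ennreal ((1/4) ^ k)" if "j \<ge> k" for j k
  proof -
    have "(\<integral>\<^sup>+x. ennreal ((cmod (f j x - f k x))\<^sup>2) \<partial>lebesgue) = ennreal ((norm (X (r j) - X (r k)))\<^sup>2)"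
      unfolding f(2) abs_L2_diff[OF f(1) f(1)] by (subst norm_abs_L2) (auto intro!: square_integrable_diff f)
    also have "\<dots> \<le> ennreal (((1/2) ^ k)\<^sup>2)"
      using rr[OF that] by (intro ennreal_leI power_mono) auto
    finally show ?thesis unfolding quarter .
  qed
  have "(\<integral>\<^sup>+x. (\<Sum>k. ennreal (2 ^ k * (cmod (f (Suc k) x - f k x))\<^sup>2)) \<partial>lebesgue)
      = (\<Sum>k. (\<integral>\<^sup>+x. ennreal (2 ^ k * (cmod (f (Suc k) x - f k x))\<^sup>2) \<partial>lebesgue))"
    by (rule nn_integral_suminf) measurable
  also have "\<dots> \<le> (\<Sum>k. ennreal ((1/2) ^ k))"
  proof (intro suminf_le allI)
    fix k :: nat
    have "(\<integral>\<^sup>+x. ennreal (2 ^ k * (cmod (f (Suc k) x - f k x))\<^sup>2) \<partial>lebesgue)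
        = ennreal (2 ^ k) * (\<integral>\<^sup>+x. ennreal ((cmod (f (Suc k) x - f k x))\<^sup>2) \<partial>lebesgue)"
      by (subst nn_integral_cmult[symmetric]) (auto simp: ennreal_mult)
    also have "\<dots> \<le> ennreal (2 ^ k) * ennreal ((1/4) ^ k)"
      by (intro mult_left_mono d) auto
    also have "\<dots> = ennreal ((1/2) ^ k)"
      by (simp add: ennreal_mult[symmetric] power_mult_distrib[symmetric])
    finally show "(\<integral>\<^sup>+x. ennreal (2 ^ k * (cmod (f (Suc k) x - f k x))\<^sup>2) \<partial>lebesgue) \<le> ennreal ((1/2) ^ k)" .
  qed auto
  also have "\<dots> = ennreal (\<Sum>k. (1/2) ^ k)"
    by (intro suminf_ennreal2) (auto intro: summable_geometric)
  finally have "(\<integral>\<^sup>+x. (\<Sum>k. ennreal (2 ^ k * (cmod (f (Suc k) x - f k x))\<^sup>2)) \<partial>lebesgue) \<noteq> \<infinity>"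
    by (auto simp: top_unique)
  then have "AE x in lebesgue. (\<Sum>k. ennreal (2 ^ k * (cmod (f (Suc k) x - f k x))\<^sup>2)) \<noteq> \<infinity>"
    by (intro nn_integral_PInf_AE) measurable
  then have AEc: "AE x in lebesgue. convergent (\<lambda>k. f k x)"
  proof eventually_elim
    case (elim x)
    have s: "summable (\<lambda>k. 2 ^ k * (cmod (f (Suc k) x - f k x))\<^sup>2)"
      using elim by (intro summable_suminf_not_top) auto
    have "(\<lambda>k. 2 ^ k * (cmod (f (Suc k) x - f k x))\<^sup>2) \<longlonglongrightarrow> 0" by (rule summable_LIMSEQ_zero[OF s])
    then have "eventually (\<lambda>k. 2 ^ k * (cmod (f (Suc k) x - f k x))\<^sup>2 < 1) sequentially"
      by (rule order_tendstoD) simp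
    then have "eventually (\<lambda>k. cmod (f (Suc k) x - f k x) \<le> sqrt (1/2) ^ k) sequentially"
    proof eventually_elim
      case (elim k)
      have "(cmod (f (Suc k) x - f k x))\<^sup>2 \<le> (1/2) ^ k" using elim by (simp add: field_simps power_divide)
      then have "cmod (f (Suc k) x - f k x) \<le> sqrt ((1/2) ^ k)" by (rule real_le_rsqrt)
      then show ?case by (simp add: real_sqrt_power)
    qed
    then have "summable (\<lambda>k. f (Suc k) x - f k x)"
    proof (rule summable_comparison_test_ev)
      show "summable (\<lambda>k. sqrt (1/2) ^ k)" by (intro summable_geometric) (simp add: real_sqrt_divide)
    qed
    then have "convergent (\<lambda>n. \<Sum>k<n. f (Suc k) x - f k x)" by (simp add: summable_iff_convergent)
    then have "convergent (\<lambda>n. f n x - f 0 x)" by (simp add: sum_lessThan_telescope[of "\<lambda>n. f n x"])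
    then have "convergent (\<lambda>n. (f n x - f 0 x) + f 0 x)" by (intro convergent_add convergent_const)
    then show ?case by simp
  qed
  define g where "g x = lim (\<lambda>k. f k x)" for x
  have gm[measurable]: "g \<in> borel_measurable lebesgue" unfolding g_def by (rule borel_measurable_lim_metric) simp
  have AEl: "AE x in lebesgue. (\<lambda>k. f k x) \<longlonglongrightarrow> g x"
    using AEc by eventually_elim (simp add: g_def convergent_LIMSEQ_iff)
  have gd: "(\<integral>\<^sup>+x. ennreal ((cmod (g x - f k x))\<^sup>2) \<partial>lebesgue) \<le> ennreal ((1/4) ^ k)" for k
  proof -
    have "(\<integral>\<^sup>+x. ennreal ((cmod (g x - f k x))\<^sup>2) \<partial>lebesgue) = (\<integral>\<^sup>+x. liminf (\<lambda>j. ennreal ((cmod (f j x - f k x))\<^sup>2)) \<partial>lebesgue)"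
    proof (rule nn_integral_cong_AE)
      show "AE x in lebesgue. ennreal ((cmod (g x - f k x))\<^sup>2) = liminf (\<lambda>j. ennreal ((cmod (f j x - f k x))\<^sup>2))"
        using AEl
      proof eventually_elim
        case (elim x)
        have "(\<lambda>j. ennreal ((cmod (f j x - f k x))\<^sup>2)) \<longlonglongrightarrow> ennreal ((cmod (g x - f k x))\<^sup>2)"
          by (intro tendsto_intros tendsto_ennrealI elim)
        then show ?case by (intro lim_imp_Liminf[symmetric]) simp_all
      qed
    qed
    also have "\<dots> \<le> liminf (\<lambda>j. (\<integral>\<^sup>+x. ennreal ((cmod (f j x - f k x))\<^sup>2) \<partial>lebesgue))"
      by (rule nn_integral_liminf) measurable
    also have "\<dots> \<le> liminf (\<lambda>j. ennreal ((1/4) ^ k))"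
      by (intro Liminf_mono eventually_sequentiallyI[of k] d)
    finally show ?thesis by (simp add: Liminf_const)
  qed
  have "square_integrable (\<lambda>x. g x - f 0 x)"
    unfolding square_integrable_iff_nn using gd[of 0] by (auto simp: less_top[symmetric] top_unique)
  then have gs: "square_integrable g" using square_integrable_add[of "\<lambda>x. g x - f 0 x" "f 0"] f by simp
  have "norm (X (r k) - abs_L2 g) \<le> (1/2) ^ k" for k
  proof -
    have "ennreal ((norm (abs_L2 g - X (r k)))\<^sup>2) \<le> ennreal (((1/2) ^ k)\<^sup>2)"
      unfolding f(2) abs_L2_diff[OF gs f(1)] quarter norm_abs_L2[OF square_integrable_diff[OF gs f(1)]]
      by (rule gd)
    then have "(norm (abs_L2 g - X (r k)))\<^sup>2 \<le> ((1/2) ^ k)\<^sup>2"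
      by (subst (asm) ennreal_le_iff) (rule zero_le_power2)
    then have "norm (abs_L2 g - X (r k)) \<le> (1/2) ^ k" by (rule power2_le_imp_le) simp
    then show ?thesis by (simp only: norm_minus_commute)
  qed
  then have "(\<lambda>k. X (r k) - abs_L2 g) \<longlonglongrightarrow> 0"
    by (rule Lim_null_comparison[OF always_eventually[OF allI]]) (simp add: LIMSEQ_power_zero)
  then have "(X \<circ> r) \<longlonglongrightarrow> abs_L2 g" by (simp add: Lim_null[symmetric] o_def)
  then have "X \<longlonglongrightarrow> abs_L2 g" using Cauchy_converges_subseq[OF assms sm] by simp
  then show ?thesis by (rule convergentI)
qed

instance L2 :: (euclidean_space) banach
  by standard (rule L2_complete)

text \<open>Representatives are real-valued and Borel, rather than Lebesgue measurable, so that they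
  can be used in double integrals over \<open>lborel\<close>.\<close>

definition sq_integrable :: "('a::euclidean_space \<Rightarrow> real) \<Rightarrow> bool" where
  "sq_integrable a \<longleftrightarrow> a \<in> borel_measurable borel \<and> integrable lborel (\<lambda>x. (a x)\<^sup>2)"

definition rfun :: "('a::euclidean_space \<Rightarrow> real) \<Rightarrow> 'a L2" where
  "rfun a = abs_L2 (\<lambda>x. complex_of_real (a x))"

lemma sq_integrable_measurable [measurable_dest]: "sq_integrable a \<Longrightarrow> a \<in> borel_measurable borel"
  by (simp add: sq_integrable_def)

lemma of_real_lebesgue:
  "a \<in> borel_measurable borel \<Longrightarrow> (\<lambda>x::'a::euclidean_space. complex_of_real (a x)) \<in> borel_measurable lebesgue"
  by (rule measurable_completion) simp

lemma sq_integrable_bound: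
  assumes "sq_integrable a" "b \<in> borel_measurable borel" "\<And>x. \<bar>b x\<bar> \<le> M * \<bar>a x\<bar>"
  shows "sq_integrable b"
proof -
  have i: "integrable lborel (\<lambda>x. M\<^sup>2 * (a x)\<^sup>2)" using assms by (simp add: sq_integrable_def)
  have n: "norm ((b x)\<^sup>2) \<le> norm (M\<^sup>2 * (a x)\<^sup>2)" for x
  proof -
    have "\<bar>b x\<bar>\<^sup>2 \<le> (M * \<bar>a x\<bar>)\<^sup>2" by (intro power_mono assms(3)) simp
    then show ?thesis by (simp add: power_mult_distrib abs_mult)
  qed
  have "integrable lborel (\<lambda>x. (b x)\<^sup>2)"
    by (rule Bochner_Integration.integrable_bound[OF i _ AE_I2[OF n]]) (use assms(2) in simp)
  then show ?thesis using assms by (simp add: sq_integrable_def)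
qed

lemma square_integrable_of_real:
  assumes "sq_integrable a" shows "square_integrable (\<lambda>x. complex_of_real (a x))"
proof -
  have [measurable]: "a \<in> borel_measurable borel" using assms by (simp add: sq_integrable_def)
  have "integrable lebesgue (\<lambda>x. (a x)\<^sup>2)"
    using assms by (subst integrable_completion) (auto simp: sq_integrable_def)
  then show ?thesis using assms of_real_lebesgue[of a] by (simp add: square_integrable_def sq_integrable_def)
qed

lemma sq_integrable_add: assumes "sq_integrable a" "sq_integrable b" shows "sq_integrable (\<lambda>x. a x + b x)"
proof -
  have [measurable]: "a \<in> borel_measurable borel" "b \<in> borel_measurable borel"
    using assms by (auto simp: sq_integrable_def)
  have i: "integrable lborel (\<lambda>x. 2 * (a x)\<^sup>2 + 2 * (b x)\<^sup>2)" using assms by (auto simp: sq_integrable_def)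
  have n: "norm ((a x + b x)\<^sup>2) \<le> norm (2 * (a x)\<^sup>2 + 2 * (b x)\<^sup>2)" for x
  proof -
    have "(a x + b x)\<^sup>2 \<le> 2 * (a x)\<^sup>2 + 2 * (b x)\<^sup>2"
      using sum_squares_bound[of "a x" "b x"] unfolding power2_sum by linarith
    then show ?thesis by simp
  qed
  have "integrable lborel (\<lambda>x. (a x + b x)\<^sup>2)"
    by (rule Bochner_Integration.integrable_bound[OF i _ AE_I2[OF n]]) simp
  then show ?thesis by (simp add: sq_integrable_def)
qed

lemma sq_integrable_scale: "sq_integrable a \<Longrightarrow> sq_integrable (\<lambda>x. c * a x)"
  by (rule sq_integrable_bound[of a _ "\<bar>c\<bar>"]) (auto simp: abs_mult dest: sq_integrable_measurable)

lemma sq_integrable_zero [simp]: "sq_integrable (\<lambda>x. 0)" by (simp add: sq_integrable_def)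

lemma sq_integrable_diff: "sq_integrable a \<Longrightarrow> sq_integrable b \<Longrightarrow> sq_integrable (\<lambda>x. a x - b x)"
  using sq_integrable_add[of a "\<lambda>x. - 1 * b x"] sq_integrable_scale[of b "- 1"] by simp

lemma sq_integrable_abs: "sq_integrable a \<Longrightarrow> sq_integrable (\<lambda>x. \<bar>a x\<bar>)"
  by (rule sq_integrable_bound[of a _ 1]) (auto dest: sq_integrable_measurable)

lemma sq_integrable_mult_bounded:
  "sq_integrable a \<Longrightarrow> \<theta> \<in> borel_measurable borel \<Longrightarrow> (\<And>x. \<bar>\<theta> x\<bar> \<le> M) \<Longrightarrow> sq_integrable (\<lambda>x. \<theta> x * a x)"
  by (rule sq_integrable_bound[of a _ M]) (auto intro!: mult_right_mono simp: abs_mult dest: sq_integrable_measurable)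

lemma sq_integrable_sum: "(\<And>i. i \<in> I \<Longrightarrow> sq_integrable (a i)) \<Longrightarrow> sq_integrable (\<lambda>x. \<Sum>i\<in>I. a i x)"
  by (induction I rule: infinite_finite_induct) (auto intro: sq_integrable_add)

lemma rfun_add: "sq_integrable a \<Longrightarrow> sq_integrable b \<Longrightarrow> rfun a + rfun b = rfun (\<lambda>x. a x + b x)"
  unfolding rfun_def
  by (subst plus_L2.abs_eq[OF L2_rel_refl L2_rel_refl]) (simp_all add: square_integrable_of_real)

lemma rfun_diff: "sq_integrable a \<Longrightarrow> sq_integrable b \<Longrightarrow> rfun a - rfun b = rfun (\<lambda>x. a x - b x)"
  unfolding rfun_def
  by (subst minus_L2.abs_eq[OF L2_rel_refl L2_rel_refl]) (simp_all add: square_integrable_of_real)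

lemma rfun_scale: "sq_integrable a \<Longrightarrow> c *\<^sub>R rfun a = rfun (\<lambda>x. c * a x)"
  unfolding rfun_def scaleR_L2_def
  by (subst scaleC.abs_eq[OF L2_rel_refl]) (simp_all add: square_integrable_of_real)

lemma rfun_zero: "rfun (\<lambda>x. 0) = 0"
  by (simp add: rfun_def zero_L2.abs_eq zero_L2_def)

lemma rfun_sum: "(\<And>i. i \<in> I \<Longrightarrow> sq_integrable (a i)) \<Longrightarrow> (\<Sum>i\<in>I. rfun (a i)) = rfun (\<lambda>x. \<Sum>i\<in>I. a i x)"
  by (induction I rule: infinite_finite_induct) (auto simp: rfun_zero rfun_add sq_integrable_sum)

lemma inner_abs_L2:
  assumes "square_integrable f" "square_integrable g"
  shows "inner (abs_L2 f) (abs_L2 g) = Re (\<integral>x. f x * cnj (g x) \<partial>lebesgue)"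
  unfolding inner_L2_def using cinner.abs_eq[OF L2_rel_refl[OF assms(1)] L2_rel_refl[OF assms(2)]] by simp

lemma inner_rfun:
  assumes "sq_integrable a" "sq_integrable b" shows "inner (rfun a) (rfun b) = (\<integral>x. a x * b x \<partial>lborel)"
proof -
  have [measurable]: "a \<in> borel_measurable borel" "b \<in> borel_measurable borel"
    using assms by (auto simp: sq_integrable_def)
  have "inner (rfun a) (rfun b) = Re (\<integral>x. complex_of_real (a x * b x) \<partial>lebesgue)"
    unfolding rfun_def using assms by (simp add: inner_abs_L2 square_integrable_of_real)
  also have "\<dots> = (\<integral>x. a x * b x \<partial>lebesgue)" by (subst integral_complex_of_real) simp
  also have "\<dots> = (\<integral>x. a x * b x \<partial>lborel)" by (rule integral_completion) simp
  finally show ?thesis .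
qed

lemma norm_rfun:
  assumes "sq_integrable a" shows "(norm (rfun a))\<^sup>2 = (\<integral>x. (a x)\<^sup>2 \<partial>lborel)"
  unfolding power2_norm_eq_inner inner_rfun[OF assms assms] by (simp add: power2_eq_square)

lemma nn_norm_rfun:
  assumes "sq_integrable a" shows "ennreal ((norm (rfun a))\<^sup>2) = (\<integral>\<^sup>+x. ennreal ((a x)\<^sup>2) \<partial>lborel)"
  unfolding norm_rfun[OF assms] using assms
  by (subst nn_integral_eq_integral) (auto simp: sq_integrable_def)

lemma ex_borel_real_imag:
  assumes "square_integrable f"
  obtains a b where "sq_integrable a" "sq_integrable b" "AE x in lebesgue. f x = complex_of_real (a x) + \<i> * complex_of_real (b x)"
proof -
  obtain g where g: "g \<in> borel_measurable borel" "AE x in lebesgue. f x = g x"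
    using lebesgue_ex_borel[of f] assms by (auto simp: square_integrable_def)
  have gL: "g \<in> borel_measurable lebesgue" using g(1) by (simp add: measurable_completion)
  have "AE x in lebesgue. (cmod (f x))\<^sup>2 = (cmod (g x))\<^sup>2" using g(2) by eventually_elim simp
  then have "integrable lebesgue (\<lambda>x. (cmod (g x))\<^sup>2)"
    using assms gL
    by (subst integrable_cong_AE[symmetric, of "\<lambda>x. (cmod (f x))\<^sup>2"]) (auto simp: square_integrable_def)
  then have gi: "integrable lborel (\<lambda>x. (cmod (g x))\<^sup>2)"
    using g(1) by (subst (asm) integrable_completion) auto
  have "sq_integrable (\<lambda>x. cmod (g x))" using gi g(1) by (simp add: sq_integrable_def)
  then have "sq_integrable (\<lambda>x. Re (g x))" "sq_integrable (\<lambda>x. Im (g x))"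
    using g(1) by (auto intro!: sq_integrable_bound[of "\<lambda>x. cmod (g x)" _ 1] abs_Re_le_cmod abs_Im_le_cmod)
  moreover have "AE x in lebesgue. f x = complex_of_real (Re (g x)) + \<i> * complex_of_real (Im (g x))"
    using g(2) by eventually_elim (simp add: complex_eq)
  ultimately show ?thesis using that by blast
qed

lemma scaleC_rfun: "sq_integrable a \<Longrightarrow> c *\<^sub>C rfun a = abs_L2 (\<lambda>x. c * complex_of_real (a x))"
  unfolding rfun_def by (subst scaleC.abs_eq[OF L2_rel_refl]) (simp_all add: square_integrable_of_real)

lemma rfun_add_scaleC:
  assumes "sq_integrable a" "sq_integrable b"
  shows "rfun a + \<i> *\<^sub>C rfun b = abs_L2 (\<lambda>x. complex_of_real (a x) + \<i> * complex_of_real (b x))"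
  unfolding scaleC_rfun[OF assms(2)] unfolding rfun_def
  by (subst plus_L2.abs_eq[OF L2_rel_refl L2_rel_refl])
     (simp_all add: assms square_integrable_of_real square_integrable_scale)

text \<open>The semigroup will turn out to map real functions to real functions, so estimates are
  proved for \<open>rfun a\<close> and then added over the two parts.\<close>

lemma L2_real_imag:
  fixes f :: "'a::euclidean_space L2"
  obtains a b where "sq_integrable a" "sq_integrable b" "f = rfun a + \<i> *\<^sub>C rfun b"
proof -
  obtain f0 where f0: "square_integrable f0" "f = abs_L2 f0" by (rule L2_cases)
  obtain a b where ab: "sq_integrable a" "sq_integrable b" "AE x in lebesgue. f0 x = complex_of_real (a x) + \<i> * complex_of_real (b x)"
    using ex_borel_real_imag[OF f0(1)] .
  have "f = rfun a + \<i> *\<^sub>C rfun b"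
    unfolding f0(2) rfun_add_scaleC[OF ab(1,2)]
    by (rule abs_L2_eqI[OF f0(1) _ ab(3)]) (intro square_integrable_add square_integrable_scale square_integrable_of_real ab)
  then show ?thesis using that ab by blast
qed

lemma in_L2_on_abs: "square_integrable f \<Longrightarrow> abs_L2 f \<in> L2_on \<Omega> \<longleftrightarrow> (AE x in lebesgue. x \<notin> \<Omega> \<longrightarrow> f x = 0)"
  unfolding L2_on_def using in_L2_on.abs_eq[OF L2_rel_refl] by simp

lemma rfun_in_L2_on: "sq_integrable a \<Longrightarrow> rfun a \<in> L2_on \<Omega> \<longleftrightarrow> (AE x in lebesgue. x \<notin> \<Omega> \<longrightarrow> a x = 0)"
  unfolding rfun_def by (simp add: in_L2_on_abs square_integrable_of_real)

lemma rfun_in_L2_on_mono: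
  assumes "rfun a \<in> L2_on \<Omega>" "sq_integrable a" "sq_integrable b" "\<And>x. a x = 0 \<Longrightarrow> b x = 0"
  shows "rfun b \<in> L2_on \<Omega>"
proof -
  have "AE x in lebesgue. x \<notin> \<Omega> \<longrightarrow> a x = 0" using assms by (simp add: rfun_in_L2_on)
  then have "AE x in lebesgue. x \<notin> \<Omega> \<longrightarrow> b x = 0" by eventually_elim (use assms(4) in auto)
  then show ?thesis using assms by (simp add: rfun_in_L2_on)
qed

lemma real_imag_in_L2_on:
  assumes "rfun a + \<i> *\<^sub>C rfun b \<in> L2_on \<Omega>" "sq_integrable a" "sq_integrable b"
  shows "rfun a \<in> L2_on \<Omega>" "rfun b \<in> L2_on \<Omega>"
proof -
  have "square_integrable (\<lambda>x. complex_of_real (a x) + \<i> * complex_of_real (b x))"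
    by (intro square_integrable_add square_integrable_scale square_integrable_of_real assms)
  then have *: "AE x in lebesgue. x \<notin> \<Omega> \<longrightarrow> complex_of_real (a x) + \<i> * complex_of_real (b x) = 0"
    using assms by (simp add: rfun_add_scaleC in_L2_on_abs)
  have "AE x in lebesgue. x \<notin> \<Omega> \<longrightarrow> a x = 0" "AE x in lebesgue. x \<notin> \<Omega> \<longrightarrow> b x = 0"
    using * by (eventually_elim, simp add: complex_eq_iff)+
  then show "rfun a \<in> L2_on \<Omega>" "rfun b \<in> L2_on \<Omega>" using assms by (auto simp: rfun_in_L2_on)
qed

lemma cinner_scaleC: "cinner (c *\<^sub>C f) g = c * cinner f g" "cinner f (c *\<^sub>C g) = cnj c * cinner f g"
proof (transfer, simp add: mult.assoc)
  show "cinner f (c *\<^sub>C g) = cnj c * cinner f g"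
  proof transfer
    fix c and f g :: "'a \<Rightarrow> complex"
    have "(\<integral>x. f x * cnj (c * g x) \<partial>lebesgue) = (\<integral>x. cnj c * (f x * cnj (g x)) \<partial>lebesgue)"
      by (simp only: complex_cnj_mult mult.left_commute)
    then show "(\<integral>x. f x * cnj (c * g x) \<partial>lebesgue) = cnj c * (\<integral>x. f x * cnj (g x) \<partial>lebesgue)" by simp
  qed
qed

lemma inner_scaleC_i: "inner (\<i> *\<^sub>C f) (\<i> *\<^sub>C g) = inner f g" "inner (\<i> *\<^sub>C f) g = - inner f (\<i> *\<^sub>C g)"
  by (simp_all add: inner_L2_def cinner_scaleC)

lemma inner_rfun_i: assumes "sq_integrable a" "sq_integrable b" shows "inner (rfun a) (\<i> *\<^sub>C rfun b) = 0"
proof -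
  have "inner (rfun a) (\<i> *\<^sub>C rfun b) = Re (\<integral>x. complex_of_real (a x) * cnj (\<i> * complex_of_real (b x)) \<partial>lebesgue)"
    unfolding scaleC_rfun[OF assms(2)] using assms
    by (subst rfun_def, subst inner_abs_L2) (auto intro: square_integrable_of_real square_integrable_scale)
  also have "\<dots> = Re (\<integral>x. - \<i> * complex_of_real (a x * b x) \<partial>lebesgue)" by (simp add: mult_ac)
  also have "\<dots> = Re (- \<i> * (\<integral>x. complex_of_real (a x * b x) \<partial>lebesgue))"
    by (subst integral_mult_right_zero) simp
  also have "\<dots> = 0" unfolding integral_complex_of_real by simp
  finally show ?thesis .
qed

lemma rfun_nonneg: "sq_integrable a \<Longrightarrow> (\<And>x. 0 \<le> a x) \<Longrightarrow> 0 \<le> rfun a"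
  unfolding rfun_def zero_L2_def
  by (subst less_eq_L2.abs_eq[OF L2_rel_refl L2_rel_refl])
     (simp_all add: less_eq_complex_def square_integrable_of_real square_integrable_zero)

text \<open>Passing to the modulus gives a representative that is nonnegative at every point, not
  just almost everywhere.\<close>

lemma nonneg_L2E:
  assumes "0 \<le> f" obtains a where "sq_integrable a" "f = rfun a" "\<And>x. 0 \<le> a x"
proof -
  obtain f0 where f0: "square_integrable f0" "f = abs_L2 f0" by (rule L2_cases)
  obtain a b where ab: "sq_integrable a" "sq_integrable b" "AE x in lebesgue. f0 x = complex_of_real (a x) + \<i> * complex_of_real (b x)"
    using ex_borel_real_imag[OF f0(1)] .
  have "AE x in lebesgue. 0 \<le> f0 x"
    using assms less_eq_L2.abs_eq[OF L2_rel_refl[OF square_integrable_zero] L2_rel_refl[OF f0(1)]] f0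
    by (simp add: zero_L2_def)
  then have *: "AE x in lebesgue. f0 x = complex_of_real \<bar>a x\<bar>" using ab(3)
    by eventually_elim (auto simp: less_eq_complex_def)
  have "f = rfun (\<lambda>x. \<bar>a x\<bar>)"
    unfolding f0(2) rfun_def
    by (rule abs_L2_eqI[OF f0(1) square_integrable_of_real[OF sq_integrable_abs[OF ab(1)]] *])
  then show ?thesis using that[of "\<lambda>x. \<bar>a x\<bar>"] sq_integrable_abs[OF ab(1)] by simp
qed

lemma inner_nonneg_L2:
  fixes f g :: "'a::euclidean_space L2"
  assumes "0 \<le> f" "0 \<le> g" shows "0 \<le> inner f g"
proof -
  obtain a where a: "sq_integrable a" "f = rfun a" "\<And>x. 0 \<le> a x" using nonneg_L2E[OF assms(1)] by metis
  obtain b where b: "sq_integrable b" "g = rfun b" "\<And>x. 0 \<le> b x" using nonneg_L2E[OF assms(2)] by metis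
  show ?thesis using a b by (simp add: inner_rfun)
qed

lemma le_L2_diff: "f \<le> g \<longleftrightarrow> 0 \<le> g - f" for f g :: "'a::euclidean_space L2"
proof transfer
  fix f g :: "'a \<Rightarrow> complex"
  show "(AE x in lebesgue. f x \<le> g x) = (AE x in lebesgue. 0 \<le> g x - f x)"
    by (auto simp: less_eq_complex_def)
qed

lemma L1_norm_real_imag:
  assumes "sq_integrable a" "sq_integrable b"
  shows "L1_norm (rfun a + \<i> *\<^sub>C rfun b) = (\<integral>\<^sup>+x. ennreal (sqrt ((a x)\<^sup>2 + (b x)\<^sup>2)) \<partial>lborel)"
proof -
  have [measurable]: "a \<in> borel_measurable borel" "b \<in> borel_measurable borel"
    using assms by (auto simp: sq_integrable_def)
  have "L1_norm (rfun a + \<i> *\<^sub>C rfun b) = (\<integral>\<^sup>+x. ennreal (sqrt ((a x)\<^sup>2 + (b x)\<^sup>2)) \<partial>lebesgue)"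
    unfolding rfun_add_scaleC[OF assms]
    by (subst L1_norm.abs_eq[OF L2_rel_refl])
       (auto intro!: square_integrable_add square_integrable_scale square_integrable_of_real assms simp: cmod_def)
  then show ?thesis by (simp add: nn_integral_completion)
qed

section \<open>Gaussian integrals\<close>

text \<open>The Gaussian of variance \<open>2 * s\<close> is the heat kernel on the line.\<close>

abbreviation heat1 :: "real \<Rightarrow> real \<Rightarrow> real" where
  "heat1 s \<equiv> normal_density 0 (sqrt (2 * s))"

lemma heat_kernel_prod:
  assumes s: "s > 0"
  shows "heat_kernel s (x::'a::euclidean_space) = (\<Prod>e\<in>Basis. heat1 s (x \<bullet> e))"
proof -
  have "(\<Prod>e\<in>(Basis::'a set). heat1 s (x \<bullet> e)) = (\<Prod>e\<in>(Basis::'a set). (4 * pi * s) powr (- (1/2)) * exp (- ((x \<bullet> e)\<^sup>2 / (4 * s))))"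
  proof (rule prod.cong)
    fix e
    have "(4 * pi * s) powr (- (1/2)) = 1 / sqrt (4 * pi * s)"
      using s by (subst powr_minus, subst powr_half_sqrt) (auto simp: divide_inverse)
    moreover have "(sqrt (2 * s))\<^sup>2 = 2 * s" using s by simp
    moreover have "2 * pi * (2 * s) = 4 * pi * s" "2 * (2 * s) = 4 * s" by simp_all
    ultimately show "heat1 s (x \<bullet> e) = (4 * pi * s) powr (- (1/2)) * exp (- ((x \<bullet> e)\<^sup>2 / (4 * s)))"
      unfolding normal_density_def by (simp only: diff_0_right minus_divide_left)
  qed simp
  also have "\<dots> = ((4 * pi * s) powr (- (1/2))) ^ DIM('a) * exp (\<Sum>e\<in>Basis. - ((x \<bullet> e)\<^sup>2 / (4 * s)))"
    by (simp add: prod.distrib exp_sum)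
  also have "((4 * pi * s) powr (- (1/2))) ^ DIM('a) = (4 * pi * s) powr (- (real DIM('a) / 2))"
    using s by (simp add: powr_realpow[symmetric] powr_powr)
  also have "(\<Sum>e\<in>Basis. - ((x \<bullet> e)\<^sup>2 / (4 * s))) = - ((norm x)\<^sup>2 / (4 * s))"
    by (simp add: sum_negf sum_divide_distrib[symmetric] norm_eq_sqrt_inner euclidean_inner[of x x]
         power2_eq_square[symmetric] sum_nonneg)
  finally show ?thesis by (simp add: heat_kernel_def)
qed

lemma nn_integral_heat_kernel_prod:
  assumes s: "s > 0" and g[measurable]: "\<And>e. g e \<in> borel_measurable borel" and g0: "\<And>e z. 0 \<le> g e z"
  shows "(\<integral>\<^sup>+y. ennreal (heat_kernel s (x - y) * (\<Prod>e\<in>Basis. g e (y \<bullet> e))) \<partial>lborel)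
    = (\<Prod>e\<in>(Basis::'a::euclidean_space set). (\<integral>\<^sup>+z. ennreal (heat1 s (x \<bullet> e - z) * g e z) \<partial>lborel))"
proof -
  have "(\<integral>\<^sup>+y. ennreal (heat_kernel s (x - y) * (\<Prod>e\<in>Basis. g e (y \<bullet> e))) \<partial>lborel)
     = (\<integral>\<^sup>+y. (\<Prod>e\<in>Basis. ennreal (heat1 s (x \<bullet> e - y \<bullet> e) * g e (y \<bullet> e))) \<partial>lborel)"
    by (intro nn_integral_cong)
       (simp add: heat_kernel_prod[OF s] prod.distrib[symmetric] inner_diff_left prod_ennreal g0)
  also have "\<dots> = (\<Prod>e\<in>(Basis::'a set). (\<integral>\<^sup>+z. ennreal (heat1 s (x \<bullet> e - z) * g e z) \<partial>lborel))"
    by (rule nn_integral_lborel_prod) auto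
  finally show ?thesis .
qed

text \<open>Completing the square moves the mean to \<open>x + 2 * s * b\<close> and leaves the
  stated factor.\<close>

lemma nn_integral_heat1_exp:
  assumes s: "s > 0"
  shows "(\<integral>\<^sup>+z. ennreal (heat1 s (x - z) * exp (b * z)) \<partial>lborel) = ennreal (exp (b * x + s * b\<^sup>2))"
proof -
  have "heat1 s (x - z) * exp (b * z) = exp (b * x + s * b\<^sup>2) * normal_density (x + 2 * s * b) (sqrt (2 * s)) z" for z
  proof -
    have "- (x - z - 0)\<^sup>2 / (2 * (sqrt (2 * s))\<^sup>2) + b * z = (b * x + s * b\<^sup>2) + (- (z - (x + 2 * s * b))\<^sup>2 / (2 * (sqrt (2 * s))\<^sup>2))"
      using s by (simp add: field_simps power2_eq_square)
    then show ?thesis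
      unfolding normal_density_def by (simp only: mult.assoc mult.left_commute[of "exp _"] exp_add[symmetric])
  qed
  then have "(\<integral>\<^sup>+z. ennreal (heat1 s (x - z) * exp (b * z)) \<partial>lborel)
      = (\<integral>\<^sup>+z. ennreal (exp (b * x + s * b\<^sup>2)) * ennreal (normal_density (x + 2 * s * b) (sqrt (2 * s)) z) \<partial>lborel)"
    by (simp add: ennreal_mult)
  also have "\<dots> = ennreal (exp (b * x + s * b\<^sup>2)) * (\<integral>\<^sup>+z. ennreal (normal_density (x + 2 * s * b) (sqrt (2 * s)) z) \<partial>lborel)"
    by (rule nn_integral_cmult) simp
  also have "(\<integral>\<^sup>+z. ennreal (normal_density (x + 2 * s * b) (sqrt (2 * s)) z) \<partial>lborel) = 1"
    using s by (subst nn_integral_eq_integral) (auto simp: integral_normal_density integrable_normal_density)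
  finally show ?thesis by simp
qed

lemma cosh_borel_measurable [measurable]: "(cosh :: real \<Rightarrow> real) \<in> borel_measurable borel"
  by (intro borel_measurable_continuous_onI continuous_on_cosh continuous_on_id)

text \<open>\<open>cosh\<close> of slope \<open>b\<close> is an eigenfunction of the second
  derivative with eigenvalue \<open>b\<^sup>2\<close>, hence the factor.\<close>

lemma nn_integral_heat1_cosh:
  assumes s: "s > 0"
  shows "(\<integral>\<^sup>+z. ennreal (heat1 s (x - z) * cosh (b * (z - c))) \<partial>lborel) = ennreal (exp (s * b\<^sup>2) * cosh (b * (x - c)))"
proof -
  have e: "ennreal (heat1 s (x - z) * cosh (b * (z - c))) =
      ennreal (exp (- b * c) / 2) * ennreal (heat1 s (x - z) * exp (b * z)) + ennreal (exp (b * c) / 2) * ennreal (heat1 s (x - z) * exp (- b * z))" for z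
  proof -
    have "cosh (b * (z - c)) = exp (- b * c) / 2 * exp (b * z) + exp (b * c) / 2 * exp (- b * z)"
      by (simp add: cosh_field_def exp_add[symmetric] exp_diff algebra_simps add_divide_distrib)
    then have "heat1 s (x - z) * cosh (b * (z - c)) = exp (- b * c) / 2 * (heat1 s (x - z) * exp (b * z))
        + exp (b * c) / 2 * (heat1 s (x - z) * exp (- b * z))" by (simp only: algebra_simps)
    then show ?thesis by (simp add: ennreal_mult[symmetric] ennreal_plus[symmetric] del: ennreal_plus)
  qed
  have "(\<integral>\<^sup>+z. ennreal (heat1 s (x - z) * cosh (b * (z - c))) \<partial>lborel)
     = ennreal (exp (- b * c) / 2) * ennreal (exp (b * x + s * b\<^sup>2)) + ennreal (exp (b * c) / 2) * ennreal (exp (- b * x + s * (- b)\<^sup>2))"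
    unfolding e
    by (subst nn_integral_add, simp, simp, subst nn_integral_cmult, simp, subst nn_integral_cmult, simp)
       (simp only: nn_integral_heat1_exp[OF s])
  also have "\<dots> = ennreal (exp (- b * c) / 2 * exp (b * x + s * b\<^sup>2) + exp (b * c) / 2 * exp (- b * x + s * (- b)\<^sup>2))"
    by (simp add: ennreal_mult[symmetric] ennreal_plus[symmetric] del: ennreal_plus)
  also have "exp (- b * c) / 2 * exp (b * x + s * b\<^sup>2) + exp (b * c) / 2 * exp (- b * x + s * (- b)\<^sup>2) = exp (s * b\<^sup>2) * cosh (b * (x - c))"
  proof -
    have "exp (- b * c) * exp (b * x + s * b\<^sup>2) = exp (s * b\<^sup>2) * exp (b * (x - c))"
         "exp (b * c) * exp (- b * x + s * (- b)\<^sup>2) = exp (s * b\<^sup>2) * exp (- (b * (x - c)))"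
      unfolding exp_add[symmetric] by (simp_all add: algebra_simps)
    then show ?thesis by (simp add: cosh_field_def distrib_left)
  qed
  finally show ?thesis .
qed

text \<open>The product of the two denominators equals
  \<open>(cosh X)\<^sup>2 + (sinh W)\<^sup>2\<close>, which is at least
  \<open>(cosh X)\<^sup>2\<close>.\<close>

lemma sech_symmetrised: "1 / cosh (X + W) + 1 / cosh (X - W) \<le> 2 * (cosh W / cosh (X::real))"
proof -
  have "cosh (X + W) * cosh (X - W) = (cosh X)\<^sup>2 * (cosh W)\<^sup>2 - (sinh X)\<^sup>2 * (sinh W)\<^sup>2"
    unfolding cosh_add cosh_diff by (simp add: algebra_simps power2_eq_square)
  also have "\<dots> = (cosh X)\<^sup>2 + (sinh W)\<^sup>2"
    unfolding cosh_square_eq by (simp add: algebra_simps)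
  finally have p: "cosh (X + W) * cosh (X - W) = (cosh X)\<^sup>2 + (sinh W)\<^sup>2" .
  have "1 / cosh (X + W) + 1 / cosh (X - W) = (cosh (X + W) + cosh (X - W)) / (cosh (X + W) * cosh (X - W))"
    using cosh_real_pos[of "X + W"] cosh_real_pos[of "X - W"] by (simp add: field_simps)
  also have "\<dots> = 2 * cosh X * cosh W / ((cosh X)\<^sup>2 + (sinh W)\<^sup>2)"
    unfolding p by (simp add: cosh_add cosh_diff)
  also have "\<dots> \<le> 2 * cosh X * cosh W / (cosh X)\<^sup>2"
    using cosh_real_pos[of X] cosh_real_pos[of W]
    by (intro divide_left_mono mult_pos_pos) (auto simp: add_pos_nonneg)
  also have "\<dots> = 2 * (cosh W / cosh X)" by (simp add: power2_eq_square)
  finally show ?thesis .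
qed

lemma ennreal_double_le: "a + a \<le> b + b \<Longrightarrow> a \<le> (b::ennreal)"
  by (simp add: mult_2[symmetric] ennreal_mult_le_mult_iff)

text \<open>The Gaussian is invariant under the reflection of \<open>z\<close> at \<open>x\<close>.
  Adding the reflected integrand, \<open>sech_symmetrised\<close> replaces the two
  \<open>sech\<close> terms by a \<open>cosh\<close> centred at \<open>x\<close>, so the growth
  factor is the one of \<open>cosh\<close>.\<close>

lemma nn_integral_heat1_sech:
  assumes s: "s > 0"
  shows "(\<integral>\<^sup>+z. ennreal (heat1 s (x - z) * (1 / cosh (b * (z - c)))) \<partial>lborel) \<le> ennreal (exp (s * b\<^sup>2) * (1 / cosh (b * (x - c))))"
    (is "?I \<le> ennreal ?r")
proof -
  let ?f = "\<lambda>z. ennreal (heat1 s (x - z) * (1 / cosh (b * (z - c))))"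
  have "?I = (\<integral>\<^sup>+z. ?f (2 * x + (- 1) * z) \<partial>lborel)"
    using nn_integral_real_affine[of ?f "- 1" "2 * x"] by simp
  then have "?I + ?I = (\<integral>\<^sup>+z. ?f z \<partial>lborel) + (\<integral>\<^sup>+z. ?f (2 * x + (- 1) * z) \<partial>lborel)" by simp
  also have "\<dots> = (\<integral>\<^sup>+z. ?f z + ?f (2 * x + (- 1) * z) \<partial>lborel)" by (rule nn_integral_add[symmetric]) auto
  also have "\<dots> \<le> (\<integral>\<^sup>+z. ennreal (2 / cosh (b * (x - c))) * ennreal (heat1 s (x - z) * cosh (b * (z - x))) \<partial>lborel)"
  proof (rule nn_integral_mono)
    fix z
    have "1 / cosh (b * (z - c)) + 1 / cosh (b * (2 * x - z - c)) \<le> 2 * (cosh (b * (z - x)) / cosh (b * (x - c)))"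
      using sech_symmetrised[of "b * (x - c)" "b * (z - x)"] by (simp add: algebra_simps)
    from mult_left_mono[OF this normal_density_nonneg[of 0 "sqrt (2 * s)" "x - z"]]
    have "heat1 s (x - z) * (1 / cosh (b * (z - c))) + heat1 s (x - z) * (1 / cosh (b * (2 * x + (- 1) * z - c)))
       \<le> 2 / cosh (b * (x - c)) * (heat1 s (x - z) * cosh (b * (z - x)))"
      by (simp add: distrib_left mult.commute)
    moreover have "heat1 s (x - (2 * x + (- 1) * z)) = heat1 s (x - z)"
      by (simp add: normal_density_def power2_commute[of x z])
    ultimately have "heat1 s (x - z) * (1 / cosh (b * (z - c))) + heat1 s (x - (2 * x + (- 1) * z)) * (1 / cosh (b * (2 * x + (- 1) * z - c)))
       \<le> 2 / cosh (b * (x - c)) * (heat1 s (x - z) * cosh (b * (z - x)))" by (simp only:)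
    then show "?f z + ?f (2 * x + (- 1) * z) \<le> ennreal (2 / cosh (b * (x - c))) * ennreal (heat1 s (x - z) * cosh (b * (z - x)))"
      by (simp add: ennreal_mult[symmetric] ennreal_plus[symmetric] del: ennreal_plus)
  qed
  also have "\<dots> = ennreal (2 / cosh (b * (x - c))) * ennreal (exp (s * b\<^sup>2) * cosh (b * (x - x)))"
    by (subst nn_integral_cmult) (simp_all only: nn_integral_heat1_cosh[OF s], simp)
  also have "\<dots> = ennreal (2 / cosh (b * (x - c)) * (exp (s * b\<^sup>2) * cosh (b * (x - x))))"
    by (rule ennreal_mult[symmetric]) auto
  also have "2 / cosh (b * (x - c)) * (exp (s * b\<^sup>2) * cosh (b * (x - x))) = ?r + ?r" by simp
  also have "ennreal (?r + ?r) = ennreal ?r + ennreal ?r" by (rule ennreal_plus) auto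
  finally show ?thesis by (rule ennreal_double_le)
qed

lemma nn_integral_heat_kernel_cosh:
  fixes x p :: "'a::euclidean_space"
  assumes s: "s > 0"
  shows "(\<integral>\<^sup>+y. ennreal (heat_kernel s (x - y) * (\<Prod>e\<in>Basis. cosh (b * ((y - p) \<bullet> e)))) \<partial>lborel)
    = ennreal (exp (real DIM('a) * s * b\<^sup>2) * (\<Prod>e\<in>Basis. cosh (b * ((x - p) \<bullet> e))))"
  using nn_integral_heat_kernel_prod[OF s, of "\<lambda>e z. cosh (b * (z - p \<bullet> e))" x]
  by (simp add: inner_diff_left nn_integral_heat1_cosh[OF s] prod_ennreal prod.distrib exp_of_nat_mult[symmetric] mult.assoc)

lemma nn_integral_heat_kernel:
  fixes x :: "'a::euclidean_space"
  assumes s: "s > 0"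
  shows "(\<integral>\<^sup>+y. ennreal (heat_kernel s (x - y)) \<partial>lborel) = 1"
  using nn_integral_heat_kernel_cosh[OF s, of x 0 0] by simp

lemma nn_integral_heat_kernel_sech:
  fixes x p :: "'a::euclidean_space"
  assumes s: "s > 0"
  shows "(\<integral>\<^sup>+y. ennreal (heat_kernel s (x - y) * (1 / (\<Prod>e\<in>Basis. cosh (b * ((y - p) \<bullet> e))))) \<partial>lborel)
    \<le> ennreal (exp (real DIM('a) * s * b\<^sup>2) * (1 / (\<Prod>e\<in>Basis. cosh (b * ((x - p) \<bullet> e)))))"
proof -
  have "(\<integral>\<^sup>+y. ennreal (heat_kernel s (x - y) * (1 / (\<Prod>e\<in>Basis. cosh (b * ((y - p) \<bullet> e))))) \<partial>lborel)
     = (\<Prod>e\<in>Basis. (\<integral>\<^sup>+z. ennreal (heat1 s (x \<bullet> e - z) * (1 / cosh (b * (z - p \<bullet> e)))) \<partial>lborel))"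
    using nn_integral_heat_kernel_prod[OF s, of "\<lambda>e z. 1 / cosh (b * (z - p \<bullet> e))" x]
    by (simp add: inner_diff_left prod_dividef)
  also have "\<dots> \<le> (\<Prod>e\<in>Basis. ennreal (exp (s * b\<^sup>2) * (1 / cosh (b * (x \<bullet> e - p \<bullet> e)))))"
    by (intro prod_mono_ennreal nn_integral_heat1_sech s)
  also have "\<dots> = ennreal (exp (real DIM('a) * s * b\<^sup>2) * (1 / (\<Prod>e\<in>Basis. cosh (b * ((x - p) \<bullet> e)))))"
    by (simp add: inner_diff_left prod_ennreal prod_dividef exp_of_nat_mult[symmetric] mult.assoc)
  finally show ?thesis .
qed

text \<open>The antiderivative \<open>2 * arctan (exp x)\<close> settles the half line; reflection
  and scaling do the rest.\<close>

lemma nn_integral_sech: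
  assumes b: "b > 0"
  shows "(\<integral>\<^sup>+x. ennreal (1 / cosh (b * (x - c))) \<partial>lborel) = ennreal (pi / b)"
proof -
  have F: "((\<lambda>x. 2 * arctan (exp x)) has_real_derivative 1 / cosh x) (at x)" for x
  proof -
    have "inverse (1 + (exp x)\<^sup>2) * exp x * 2 = 1 / cosh x"
      by (simp add: cosh_field_def exp_minus power2_eq_square field_simps)
    then show ?thesis by (auto intro!: derivative_eq_intros simp: mult_ac)
  qed
  have "(\<integral>\<^sup>+x. ennreal (1 / cosh x) * indicator {0..} x \<partial>lborel) = ennreal (pi - 2 * arctan (exp 0))"
  proof (rule nn_integral_FTC_atLeast)
    have "filterlim exp at_top (at_top :: real filter)" by (rule exp_at_top)
    then have "((\<lambda>x::real. arctan (exp x)) \<longlongrightarrow> pi / 2) at_top" by (rule filterlim_compose[OF tendsto_arctan_at_top])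
    then show "((\<lambda>x. 2 * arctan (exp x)) \<longlongrightarrow> pi) at_top"
      using tendsto_mult_left[of "\<lambda>x::real. arctan (exp x)" "pi / 2" at_top 2] by simp
  qed (auto intro!: F)
  then have h: "(\<integral>\<^sup>+x. ennreal (1 / cosh x) * indicator {0..} x \<partial>lborel) = ennreal (pi / 2)" by (simp add: arctan_one)
  have "(\<integral>\<^sup>+x. ennreal (1 / cosh x) * indicator {..0::real} x \<partial>lborel)
      = (\<integral>\<^sup>+x. ennreal (1 / cosh (0 + (-1) * x)) * indicator {..0} (0 + (-1) * x) \<partial>lborel)"
    using nn_integral_real_affine[of "\<lambda>x. ennreal (1 / cosh x) * indicator {..0} x" "- 1" 0] by simp
  also have "\<dots> = (\<integral>\<^sup>+x. ennreal (1 / cosh x) * indicator {0..} x \<partial>lborel)"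
    by (intro nn_integral_cong) (simp add: indicator_def)
  finally have h': "(\<integral>\<^sup>+x. ennreal (1 / cosh x) * indicator {..0::real} x \<partial>lborel) = ennreal (pi / 2)" using h by simp
  have "(\<integral>\<^sup>+x. ennreal (1 / cosh x) \<partial>lborel)
      = (\<integral>\<^sup>+x. ennreal (1 / cosh x) * indicator {0..} x + ennreal (1 / cosh x) * indicator {..0::real} x \<partial>lborel)"
  proof (rule nn_integral_cong_AE)
    have "AE x in lborel. x \<noteq> (0::real)" by (rule AE_lborel_singleton)
    then show "AE x in lborel. ennreal (1 / cosh x) = ennreal (1 / cosh x) * indicator {0..} x + ennreal (1 / cosh x) * indicator {..0::real} x"
      by eventually_elim (auto simp: indicator_def)
  qed
  also have "\<dots> = ennreal (pi / 2) + ennreal (pi / 2)" by (subst nn_integral_add) (auto simp: h h')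
  also have "\<dots> = ennreal pi" by (simp add: ennreal_plus[symmetric] del: ennreal_plus)
  finally have "(\<integral>\<^sup>+x. ennreal (1 / cosh (x::real)) \<partial>lborel) = ennreal pi" .
  moreover have "(\<integral>\<^sup>+x. ennreal (1 / cosh (x::real)) \<partial>lborel) = ennreal b * (\<integral>\<^sup>+x. ennreal (1 / cosh (- b * c + b * x)) \<partial>lborel)"
    using nn_integral_real_affine[of "\<lambda>x. ennreal (1 / cosh x)" b "- b * c"] b by simp
  ultimately have "ennreal b * (\<integral>\<^sup>+x. ennreal (1 / cosh (b * (x - c))) \<partial>lborel) = ennreal b * ennreal (pi / b)"
    using b by (simp add: algebra_simps ennreal_mult[symmetric])
  then show ?thesis using b by (simp add: ennreal_mult_cancel_left)
qed

lemma nn_integral_prod_sech: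
  fixes p :: "'a::euclidean_space"
  assumes b: "b > 0"
  shows "(\<integral>\<^sup>+x. ennreal (1 / (\<Prod>e\<in>Basis. cosh (b * ((x - p) \<bullet> e)))) \<partial>lborel) = ennreal ((pi / b) ^ DIM('a))"
proof -
  have "(\<integral>\<^sup>+x. ennreal (1 / (\<Prod>e\<in>Basis. cosh (b * ((x - p) \<bullet> e)))) \<partial>lborel)
     = (\<integral>\<^sup>+x. (\<Prod>e\<in>Basis. ennreal (1 / cosh (b * (x \<bullet> e - p \<bullet> e)))) \<partial>lborel)"
    by (simp add: prod_ennreal prod_dividef inner_diff_left)
  also have "\<dots> = (\<Prod>e\<in>(Basis::'a set). (\<integral>\<^sup>+z. ennreal (1 / cosh (b * (z - p \<bullet> e))) \<partial>lborel))"
    by (rule nn_integral_lborel_prod) auto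
  also have "\<dots> = ennreal ((pi / b) ^ DIM('a))" using b by (simp add: nn_integral_sech ennreal_power)
  finally show ?thesis .
qed

section \<open>Semigroups dominated by the heat semigroup\<close>

lemma square_integrable_restrict:
  assumes "\<Omega> \<in> sets lebesgue" "square_integrable f"
  shows "square_integrable (\<lambda>x. if x \<in> \<Omega> then f x else 0)"
proof -
  have m: "(\<lambda>x. if x \<in> \<Omega> then f x else 0) \<in> borel_measurable lebesgue"
    using assms by (intro measurable_If_set) (auto simp: square_integrable_def)
  have i: "integrable lebesgue (\<lambda>x. (cmod (f x))\<^sup>2)" using assms by (simp add: square_integrable_def)
  have "(\<lambda>x. (cmod (if x \<in> \<Omega> then f x else 0))\<^sup>2) \<in> borel_measurable lebesgue"
    by (rule borel_measurable_power[OF measurable_compose[OF m borel_measurable_norm]])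
  then have "integrable lebesgue (\<lambda>x. (cmod (if x \<in> \<Omega> then f x else 0))\<^sup>2)"
    by (rule Bochner_Integration.integrable_bound[OF i]) auto
  then show ?thesis using m by (simp add: square_integrable_def)
qed

text \<open>Measurability is tested in the body because lifting demands a square integrable result
  for every set; for a nonmeasurable set the value is 0.\<close>

lift_definition restrict_L2 :: "'a::euclidean_space set \<Rightarrow> 'a L2 \<Rightarrow> 'a L2"
  is "\<lambda>\<Omega> f x. if \<Omega> \<in> sets lebesgue \<and> x \<in> \<Omega> then f x else 0"
proof -
  fix \<Omega> :: "'a set" and f g :: "'a \<Rightarrow> complex"
  assume *: "L2_rel f g"
  have "square_integrable (\<lambda>x. if \<Omega> \<in> sets lebesgue \<and> x \<in> \<Omega> then h x else 0)" if h: "square_integrable h" for h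
    using square_integrable_restrict[OF _ h, of \<Omega>] by (cases "\<Omega> \<in> sets lebesgue") (simp_all add: square_integrable_zero)
  moreover have "AE x in lebesgue. (if \<Omega> \<in> sets lebesgue \<and> x \<in> \<Omega> then f x else 0) = (if \<Omega> \<in> sets lebesgue \<and> x \<in> \<Omega> then g x else 0)"
    using L2_relD(5)[OF *] by eventually_elim simp
  ultimately show "L2_rel (\<lambda>x. if \<Omega> \<in> sets lebesgue \<and> x \<in> \<Omega> then f x else 0) (\<lambda>x. if \<Omega> \<in> sets lebesgue \<and> x \<in> \<Omega> then g x else 0)"
    using L2_relD(1,2)[OF *] by (simp add: L2_rel_def)
qed

lemma restrict_L2_abs:
  assumes "\<Omega> \<in> sets lebesgue" "square_integrable f"
  shows "restrict_L2 \<Omega> (abs_L2 f) = abs_L2 (\<lambda>x. if x \<in> \<Omega> then f x else 0)"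
  using restrict_L2.abs_eq[OF L2_rel_refl[OF assms(2)], of \<Omega>] assms(1) by simp

lemma restrict_L2_in:
  assumes "\<Omega> \<in> sets lebesgue" shows "restrict_L2 \<Omega> f \<in> L2_on \<Omega>"
proof -
  obtain f0 where f0: "square_integrable f0" "f = abs_L2 f0" by (rule L2_cases)
  show ?thesis unfolding f0(2) restrict_L2_abs[OF assms f0(1)]
    by (subst in_L2_on_abs[OF square_integrable_restrict[OF assms f0(1)]]) auto
qed

lemma restrict_L2_id:
  assumes "\<Omega> \<in> sets lebesgue" "f \<in> L2_on \<Omega>" shows "restrict_L2 \<Omega> f = f"
proof -
  obtain f0 where f0: "square_integrable f0" "f = abs_L2 f0" by (rule L2_cases)
  have *: "AE x in lebesgue. x \<notin> \<Omega> \<longrightarrow> f0 x = 0" using assms(2) f0 by (simp add: in_L2_on_abs)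
  show ?thesis unfolding f0(2) restrict_L2_abs[OF assms(1) f0(1)]
  proof (rule abs_L2_eqI[OF square_integrable_restrict[OF assms(1) f0(1)] f0(1)])
    show "AE x in lebesgue. (if x \<in> \<Omega> then f0 x else 0) = f0 x" using * by eventually_elim auto
  qed
qed

lemma abs_L2_plus:
  assumes "square_integrable f" "square_integrable g"
  shows "abs_L2 f + abs_L2 g = abs_L2 (\<lambda>x. f x + g x)"
  using plus_L2.abs_eq[OF L2_rel_refl[OF assms(1)] L2_rel_refl[OF assms(2)]] .

lemma abs_L2_scaleC:
  assumes "square_integrable f" shows "c *\<^sub>C abs_L2 f = abs_L2 (\<lambda>x. c * f x)"
  using scaleC.abs_eq[OF L2_rel_refl[OF assms(1)]] .

lemma restrict_L2_add: 
  assumes "\<Omega> \<in> sets lebesgue" shows "restrict_L2 \<Omega> (f + g) = restrict_L2 \<Omega> f + restrict_L2 \<Omega> g"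
proof -
  obtain f0 where f0: "square_integrable f0" "f = abs_L2 f0" by (rule L2_cases)
  obtain g0 where g0: "square_integrable g0" "g = abs_L2 g0" by (rule L2_cases)
  show ?thesis unfolding f0(2) g0(2)
    by (subst abs_L2_plus restrict_L2_abs | intro f0 g0 assms square_integrable_add square_integrable_restrict)+
       (rule arg_cong[of _ _ abs_L2], auto)
qed

lemma restrict_L2_scaleC: 
  assumes "\<Omega> \<in> sets lebesgue" shows "restrict_L2 \<Omega> (c *\<^sub>C f) = c *\<^sub>C restrict_L2 \<Omega> f"
proof -
  obtain f0 where f0: "square_integrable f0" "f = abs_L2 f0" by (rule L2_cases)
  show ?thesis unfolding f0(2)
    by (subst abs_L2_scaleC restrict_L2_abs | intro f0 assms square_integrable_scale square_integrable_restrict)+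
       (rule arg_cong[of _ _ abs_L2], auto)
qed

lemma norm_restrict_L2_le:
  fixes f :: "'a::euclidean_space L2"
  assumes "\<Omega> \<in> sets lebesgue" shows "norm (restrict_L2 \<Omega> f) \<le> norm f"
proof -
  obtain f0 where f0: "square_integrable f0" "f = abs_L2 f0" by (rule L2_cases)
  have "ennreal ((norm (restrict_L2 \<Omega> f))\<^sup>2) \<le> ennreal ((norm f)\<^sup>2)"
    unfolding f0(2) restrict_L2_abs[OF assms f0(1)] norm_abs_L2[OF square_integrable_restrict[OF assms f0(1)]] norm_abs_L2[OF f0(1)]
    by (intro nn_integral_mono) auto
  then have "(norm (restrict_L2 \<Omega> f))\<^sup>2 \<le> (norm f)\<^sup>2" by (subst (asm) ennreal_le_iff) (rule zero_le_power2)
  then show ?thesis by (rule power2_le_imp_le) simp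
qed

lemma bounded_linear_restrict_L2:
  assumes "\<Omega> \<in> sets lebesgue" shows "bounded_linear (restrict_L2 \<Omega> :: 'a::euclidean_space L2 \<Rightarrow> _)"
  by (rule bounded_linear_intro[of _ 1])
     (auto simp: restrict_L2_add[OF assms] scaleR_L2_def restrict_L2_scaleC[OF assms] norm_restrict_L2_le[OF assms])

lemma L2_on_closed:
  assumes "\<Omega> \<in> sets lebesgue" shows "closed (L2_on \<Omega> :: 'a::euclidean_space L2 set)"
proof -
  have "L2_on \<Omega> = {f. restrict_L2 \<Omega> f = f}" by (auto simp: restrict_L2_id[OF assms]) (metis restrict_L2_in[OF assms])
  moreover have "continuous_on UNIV (restrict_L2 \<Omega> :: 'a L2 \<Rightarrow> _)"
    by (rule linear_continuous_on[OF bounded_linear_restrict_L2[OF assms]])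
  ultimately show ?thesis by (auto intro: closed_Collect_eq continuous_intros)
qed

lemma L2_on_add: 
  assumes "\<Omega> \<in> sets lebesgue" "f \<in> L2_on \<Omega>" "g \<in> L2_on \<Omega>" shows "f + g \<in> L2_on \<Omega>"
  using restrict_L2_in[OF assms(1), of "f + g"] restrict_L2_add[OF assms(1), of f g] restrict_L2_id[OF assms(1)] assms by simp

lemma L2_on_scaleC: 
  assumes "\<Omega> \<in> sets lebesgue" "f \<in> L2_on \<Omega>" shows "c *\<^sub>C f \<in> L2_on \<Omega>"
  using restrict_L2_in[OF assms(1), of "c *\<^sub>C f"] restrict_L2_scaleC[OF assms(1), of c f] restrict_L2_id[OF assms(1)] assms by simp

lemma L2_on_subspace:
  assumes "\<Omega> \<in> sets lebesgue" shows "subspace (L2_on \<Omega> :: 'a::euclidean_space L2 set)"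
  unfolding subspace_def
proof (intro conjI ballI allI)
  show "0 \<in> L2_on \<Omega>"
    using rfun_in_L2_on[of "\<lambda>x. 0" \<Omega>] by (simp add: rfun_zero)
qed (auto simp: scaleR_L2_def intro: L2_on_add[OF assms] L2_on_scaleC[OF assms])

text \<open>Values in \<open>ennreal\<close> make sums, limits and Fubini available before
  integrability is known; negative values of the integrand count as 0.\<close>

definition heat_form :: "real \<Rightarrow> ('a::euclidean_space \<Rightarrow> 'a \<Rightarrow> real) \<Rightarrow> ennreal" where
  "heat_form s F = (\<integral>\<^sup>+x. \<integral>\<^sup>+y. ennreal (heat_kernel s (x - y) * F x y) \<partial>lborel \<partial>lborel)"

lemma heat_form_mono: "(\<And>x y. F x y \<le> G x y) \<Longrightarrow> heat_form s F \<le> heat_form s G"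
  unfolding heat_form_def by (intro nn_integral_mono ennreal_leI mult_left_mono) (auto simp: heat_kernel_nonneg)

lemma heat_form_add:
  assumes [measurable]: "(\<lambda>(x, y). F x y) \<in> borel_measurable (borel \<Otimes>\<^sub>M borel)" "(\<lambda>(x, y). G x y) \<in> borel_measurable (borel \<Otimes>\<^sub>M borel)"
    and "\<And>x y. 0 \<le> F x y" "\<And>x y. 0 \<le> G x y"
  shows "heat_form s (\<lambda>x y. F x y + G x y) = heat_form s F + heat_form s G"
proof -
  have "heat_form s (\<lambda>x y. F x y + G x y) = (\<integral>\<^sup>+x. (\<integral>\<^sup>+y. ennreal (heat_kernel s (x - y) * F x y) + ennreal (heat_kernel s (x - y) * G x y) \<partial>lborel) \<partial>lborel)"
    unfolding heat_form_def using assms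
    by (intro nn_integral_cong) (simp add: distrib_left ennreal_plus heat_kernel_nonneg)
  also have "\<dots> = (\<integral>\<^sup>+x. (\<integral>\<^sup>+y. ennreal (heat_kernel s (x - y) * F x y) \<partial>lborel) + (\<integral>\<^sup>+y. ennreal (heat_kernel s (x - y) * G x y) \<partial>lborel) \<partial>lborel)"
    by (intro nn_integral_cong nn_integral_add) measurable
  also have "\<dots> = heat_form s F + heat_form s G" unfolding heat_form_def
    by (intro nn_integral_add) measurable
  finally show ?thesis .
qed

lemma heat_form_cmult:
  assumes [measurable]: "(\<lambda>(x, y). F x y) \<in> borel_measurable (borel \<Otimes>\<^sub>M borel)"
    and "\<And>x y. 0 \<le> F x y" and c: "0 \<le> c"
  shows "heat_form s (\<lambda>x y. c * F x y) = ennreal c * heat_form s F"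
proof -
  have "heat_form s (\<lambda>x y. c * F x y) = (\<integral>\<^sup>+x. (\<integral>\<^sup>+y. ennreal c * ennreal (heat_kernel s (x - y) * F x y) \<partial>lborel) \<partial>lborel)"
    unfolding heat_form_def using assms
    by (intro nn_integral_cong) (simp add: mult.left_commute ennreal_mult[symmetric] heat_kernel_nonneg)
  also have "\<dots> = (\<integral>\<^sup>+x. ennreal c * (\<integral>\<^sup>+y. ennreal (heat_kernel s (x - y) * F x y) \<partial>lborel) \<partial>lborel)"
    by (intro nn_integral_cong nn_integral_cmult) measurable
  also have "\<dots> = ennreal c * heat_form s F" unfolding heat_form_def
    by (intro nn_integral_cmult) measurable
  finally show ?thesis .
qed

lemma heat_form_sum:
  assumes "\<And>i. i \<in> I \<Longrightarrow> (\<lambda>(x, y). F i x y) \<in> borel_measurable (borel \<Otimes>\<^sub>M borel)"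
    and "\<And>i x y. i \<in> I \<Longrightarrow> 0 \<le> F i x y"
  shows "heat_form s (\<lambda>x y. \<Sum>i\<in>I. F i x y) = (\<Sum>i\<in>I. heat_form s (F i))"
  using assms
proof (induction I rule: infinite_finite_induct)
  case (insert i I)
  have [measurable]: "(\<lambda>(x, y). \<Sum>i\<in>I. F i x y) \<in> borel_measurable (borel \<Otimes>\<^sub>M borel)"
    unfolding case_prod_beta by (intro borel_measurable_sum) (use insert.prems in \<open>auto simp: case_prod_beta\<close>)
  show ?case using insert heat_form_add[of "F i" "\<lambda>x y. \<Sum>i\<in>I. F i x y" s] by (simp add: sum_nonneg)
qed (auto simp: heat_form_def)

lemma heat_form_swap:
  assumes [measurable]: "(\<lambda>(x, y). F x y) \<in> borel_measurable (borel \<Otimes>\<^sub>M borel)"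
  shows "heat_form s F = heat_form s (\<lambda>x y. F y x)"
  unfolding heat_form_def
  by (subst lborel_pair.Fubini') (auto simp: heat_kernel_def norm_minus_commute)

lemma ennreal_half_double: "ennreal (1/2) * (X + X) = X"
proof -
  have "ennreal (1/2) * (X + X) = ennreal (1/2) * (ennreal 2 * X)" by (simp add: mult_2)
  also have "\<dots> = ennreal (1/2 * 2) * X" by (simp only: mult.assoc[symmetric] ennreal_mult[symmetric, of "1/2" 2])
  finally show ?thesis by simp
qed

text \<open>The Schur test: \<open>a x * a y\<close> is at most the mean of the two squares, and by
  symmetry of \<open>M\<close> both squares contribute the same.\<close>

lemma heat_form_Schur:
  assumes M[measurable]: "(\<lambda>(x, y). M x y) \<in> borel_measurable (borel \<Otimes>\<^sub>M borel)" and [measurable]: "a \<in> borel_measurable borel"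
    and M0: "\<And>x y. 0 \<le> M x y" and sym: "\<And>x y. M x y = M y x"
  shows "heat_form s (\<lambda>x y. M x y * (a x * a y))
    \<le> (\<integral>\<^sup>+x. (\<integral>\<^sup>+y. ennreal (heat_kernel s (x - y) * M x y) \<partial>lborel) * ennreal ((a x)\<^sup>2) \<partial>lborel)"
proof -
  let ?F = "\<lambda>x y. M x y * (a x)\<^sup>2"
  have "heat_form s (\<lambda>x y. M x y * (a x * a y)) \<le> heat_form s (\<lambda>x y. 1/2 * (?F x y + ?F y x))"
  proof (rule heat_form_mono)
    fix x y
    have "a x * a y \<le> 1/2 * ((a x)\<^sup>2 + (a y)\<^sup>2)" using sum_squares_bound[of "a x" "a y"] by simp
    from mult_left_mono[OF this M0[of x y]] show "M x y * (a x * a y) \<le> 1/2 * (?F x y + ?F y x)"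
      using sym[of x y] by (simp add: distrib_left)
  qed
  also have "\<dots> = ennreal (1/2) * (heat_form s ?F + heat_form s (\<lambda>x y. ?F y x))"
    by (subst heat_form_cmult; (subst heat_form_add)?) (auto simp: M0)
  also have "heat_form s (\<lambda>x y. ?F y x) = heat_form s ?F" by (rule heat_form_swap[symmetric]) simp
  also have "ennreal (1/2) * (heat_form s ?F + heat_form s ?F) = heat_form s ?F"
    by (rule ennreal_half_double)
  also have "heat_form s ?F = (\<integral>\<^sup>+x. (\<integral>\<^sup>+y. ennreal (heat_kernel s (x - y) * M x y) * ennreal ((a x)\<^sup>2) \<partial>lborel) \<partial>lborel)"
    unfolding heat_form_def by (intro nn_integral_cong) (simp add: ennreal_mult[symmetric] heat_kernel_nonneg M0 mult.assoc)
  also have "\<dots> = (\<integral>\<^sup>+x. (\<integral>\<^sup>+y. ennreal (heat_kernel s (x - y) * M x y) \<partial>lborel) * ennreal ((a x)\<^sup>2) \<partial>lborel)"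
    by (intro nn_integral_cong nn_integral_multc) measurable
  finally show ?thesis .
qed

lemma ennreal_integral_le:
  assumes "\<And>x. 0 \<le> h x" shows "ennreal (\<integral>x. h x \<partial>M) \<le> (\<integral>\<^sup>+x. ennreal (h x) \<partial>M)"
proof (cases "integrable M h")
  case True
  then show ?thesis using assms by (subst nn_integral_eq_integral) auto
qed (simp add: not_integrable_integral_eq)

text \<open>Stated as an inequality because a Bochner integral that does not exist is 0: each of the
  two nested integrals is then still bounded by its extended counterpart.\<close>

lemma inner_heat_le_heat_form:
  fixes a b :: "'a::euclidean_space \<Rightarrow> real"
  assumes a: "sq_integrable a" "\<And>x. 0 \<le> a x" and b: "sq_integrable b" "\<And>x. 0 \<le> b x" and s: "s > 0"
  shows "ennreal (inner (heat_semigroup s (rfun a)) (rfun b)) \<le> heat_form s (\<lambda>x y. b x * a y)"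
proof -
  have [measurable]: "a \<in> borel_measurable borel" "b \<in> borel_measurable borel"
    using a b by (auto simp: sq_integrable_def)
  define G where "G x = (\<integral>y. heat_kernel s (x - y) * a y \<partial>lborel)" for x
  have [measurable]: "G \<in> borel_measurable borel" unfolding G_def[abs_def] by measurable
  have G: "(\<integral>y. complex_of_real (heat_kernel s (x - y)) * complex_of_real (a y) \<partial>lebesgue) = complex_of_real (G x)" for x
  proof -
    have "(\<integral>y. complex_of_real (heat_kernel s (x - y)) * complex_of_real (a y) \<partial>lebesgue)
        = complex_of_real (\<integral>y. heat_kernel s (x - y) * a y \<partial>lebesgue)"
      unfolding of_real_mult[symmetric] by (rule integral_complex_of_real)
    also have "(\<integral>y. heat_kernel s (x - y) * a y \<partial>lebesgue) = G x"
      unfolding G_def by (rule integral_completion) measurable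
    finally show ?thesis .
  qed
  have si: "square_integrable (\<lambda>x. complex_of_real (G x))"
    using square_integrable_heat[OF s square_integrable_of_real[OF a(1)]] unfolding G .
  have "heat_semigroup s (rfun a) = abs_L2 (\<lambda>x. complex_of_real (G x))"
    unfolding rfun_def using heat_semigroup.abs_eq[OF L2_rel_refl[OF square_integrable_of_real[OF a(1)]], of s] s
    by (simp add: G)
  then have "inner (heat_semigroup s (rfun a)) (rfun b) = Re (\<integral>x. complex_of_real (G x * b x) \<partial>lebesgue)"
    unfolding rfun_def using inner_abs_L2[OF si square_integrable_of_real[OF b(1)]] by simp
  also have "\<dots> = (\<integral>x. G x * b x \<partial>lebesgue)" by (subst integral_complex_of_real) simp
  also have "\<dots> = (\<integral>x. G x * b x \<partial>lborel)" by (rule integral_completion) measurable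
  finally have e: "inner (heat_semigroup s (rfun a)) (rfun b) = (\<integral>x. G x * b x \<partial>lborel)" .
  have G0: "0 \<le> G x" for x unfolding G_def using a by (intro integral_nonneg_AE) (auto simp: heat_kernel_nonneg)
  have "ennreal (\<integral>x. G x * b x \<partial>lborel) \<le> (\<integral>\<^sup>+x. ennreal (G x * b x) \<partial>lborel)"
    by (rule ennreal_integral_le) (simp add: G0 b)
  also have "\<dots> \<le> heat_form s (\<lambda>x y. b x * a y)"
    unfolding heat_form_def
  proof (rule nn_integral_mono)
    fix x
    have "ennreal (G x * b x) = ennreal (\<integral>y. heat_kernel s (x - y) * a y * b x \<partial>lborel)"
      by (simp add: G_def)
    also have "\<dots> \<le> (\<integral>\<^sup>+y. ennreal (heat_kernel s (x - y) * a y * b x) \<partial>lborel)"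
      by (rule ennreal_integral_le) (simp add: heat_kernel_nonneg a b)
    also have "\<dots> = (\<integral>\<^sup>+y. ennreal (heat_kernel s (x - y) * (b x * a y)) \<partial>lborel)" by (simp add: mult_ac)
    finally show "ennreal (G x * b x) \<le> (\<integral>\<^sup>+y. ennreal (heat_kernel s (x - y) * (b x * a y)) \<partial>lborel)" .
  qed
  finally show ?thesis unfolding e .
qed

lemma heat_form_le_norm:
  assumes "sq_integrable a" and s: "s > 0"
  shows "heat_form s (\<lambda>x y. \<bar>a x\<bar> * \<bar>a y\<bar>) \<le> ennreal ((norm (rfun a))\<^sup>2)"
proof -
  have [measurable]: "a \<in> borel_measurable borel" using assms by (auto simp: sq_integrable_def)
  have "heat_form s (\<lambda>x y. 1 * (\<bar>a x\<bar> * \<bar>a y\<bar>))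
      \<le> (\<integral>\<^sup>+x. (\<integral>\<^sup>+y. ennreal (heat_kernel s (x - y) * 1) \<partial>lborel) * ennreal (\<bar>a x\<bar>\<^sup>2) \<partial>lborel)"
    by (rule heat_form_Schur) auto
  also have "\<dots> = ennreal ((norm (rfun a))\<^sup>2)"
    using nn_norm_rfun[OF assms(1)] by (simp add: nn_integral_heat_kernel[OF s])
  finally show ?thesis by simp
qed

lemma norm_real_imag:
  assumes "sq_integrable a" "sq_integrable b"
  shows "(norm (rfun a + \<i> *\<^sub>C rfun b))\<^sup>2 = (norm (rfun a))\<^sup>2 + (norm (rfun b))\<^sup>2"
  using inner_rfun_i[OF assms] inner_rfun_i[OF assms(2,1)]
  by (simp add: power2_norm_eq_inner inner_add inner_scaleC_i inner_commute)

locale dominated_semigroup =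
  fixes \<Omega> :: "'a::euclidean_space set" and T :: "real \<Rightarrow> 'a L2 \<Rightarrow> 'a L2"
  assumes \<Omega>: "\<Omega> \<in> sets lebesgue"
    and C0: "C0_semigroup (L2_on \<Omega>) T"
    and SA: "selfadjoint_semigroup (L2_on \<Omega>) T"
    and dom: "dominated_by_heat (L2_on \<Omega>) T"
begin

abbreviation "X \<equiv> L2_on \<Omega>"

text \<open>\<open>T s\<close> is specified on \<open>X\<close> alone. Composed with the projection
  it becomes bounded linear on the whole type, as \<open>contraction_semigroup\<close>
  demands.\<close>

definition S :: "real \<Rightarrow> 'a L2 \<Rightarrow> 'a L2" where
  "S s f = T s (restrict_L2 \<Omega> f)"

lemma S_on: "f \<in> X \<Longrightarrow> S s f = T s f"
  by (simp add: S_def restrict_L2_id[OF \<Omega>])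

lemma T_bcl: "s \<ge> 0 \<Longrightarrow> bounded_clinear_on X (T s)"
  using C0 by (simp add: C0_semigroup_def)

lemma S_bl: assumes s: "s \<ge> 0" shows "bounded_linear (S s)"
proof -
  note b = T_bcl[OF s, unfolded bounded_clinear_on_def]
  obtain K where K: "\<And>f. f \<in> X \<Longrightarrow> norm (T s f) \<le> K * norm f" using b by blast
  show ?thesis
  proof (rule bounded_linear_intro)
    show "S s (f + g) = S s f + S s g" for f g
      using b restrict_L2_in[OF \<Omega>] by (simp add: S_def restrict_L2_add[OF \<Omega>])
    show "S s (r *\<^sub>R f) = r *\<^sub>R S s f" for r f
      using b restrict_L2_in[OF \<Omega>] by (simp add: S_def scaleR_L2_def restrict_L2_scaleC[OF \<Omega>])
    show "norm (S s f) \<le> norm f * \<bar>K\<bar>" for f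
    proof -
      have "norm (S s f) \<le> K * norm (restrict_L2 \<Omega> f)" unfolding S_def by (rule K[OF restrict_L2_in[OF \<Omega>]])
      also have "\<dots> \<le> \<bar>K\<bar> * norm f" by (intro mult_mono norm_restrict_L2_le[OF \<Omega>]) auto
      finally show ?thesis by (simp add: mult.commute)
    qed
  qed
qed

lemma S_in: "s \<ge> 0 \<Longrightarrow> f \<in> X \<Longrightarrow> S s f \<in> X"
  using T_bcl by (simp add: S_on bounded_clinear_on_def)

lemma S_scaleC: "s \<ge> 0 \<Longrightarrow> f \<in> X \<Longrightarrow> S s (c *\<^sub>C f) = c *\<^sub>C S s f"
  using T_bcl by (simp add: S_on bounded_clinear_on_def L2_on_scaleC[OF \<Omega>])

lemma S_0: "f \<in> X \<Longrightarrow> S 0 f = f" using C0 by (simp add: S_on C0_semigroup_def)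

lemma S_plus: "s \<ge> 0 \<Longrightarrow> r \<ge> 0 \<Longrightarrow> f \<in> X \<Longrightarrow> S (s + r) f = S s (S r f)"
  using C0 S_in[of r f] by (simp add: S_on C0_semigroup_def)

lemma S_sym: "s \<ge> 0 \<Longrightarrow> f \<in> X \<Longrightarrow> g \<in> X \<Longrightarrow> inner (S s f) g = inner f (S s g)"
  using SA by (simp add: S_on selfadjoint_semigroup_def inner_L2_def)

lemma S_cont0: "f \<in> X \<Longrightarrow> ((\<lambda>s. S s f) \<longlongrightarrow> f) (at_right 0)"
  using C0 by (simp add: S_on C0_semigroup_def)

lemma S_pos: "s \<ge> 0 \<Longrightarrow> f \<in> X \<Longrightarrow> 0 \<le> f \<Longrightarrow> 0 \<le> S s f \<and> S s f \<le> heat_semigroup s f"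
  using dom by (simp add: S_on dominated_by_heat_def)

lemma pos_part:
  assumes "sq_integrable a" "rfun a \<in> X"
  shows "sq_integrable (\<lambda>x. max (a x) 0)" "sq_integrable (\<lambda>x. max (- a x) 0)" "rfun (\<lambda>x. max (a x) 0) \<in> X" "rfun (\<lambda>x. max (- a x) 0) \<in> X"
    "rfun a = rfun (\<lambda>x. max (a x) 0) - rfun (\<lambda>x. max (- a x) 0)"
proof -
  have [measurable]: "a \<in> borel_measurable borel" using assms by (auto simp: sq_integrable_def)
  show 1: "sq_integrable (\<lambda>x. max (a x) 0)" "sq_integrable (\<lambda>x. max (- a x) 0)"
    by (auto intro!: sq_integrable_bound[OF assms(1), where M = 1])
  show "rfun (\<lambda>x. max (a x) 0) \<in> X" by (rule rfun_in_L2_on_mono[OF assms(2,1) 1(1)]) simp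
  show "rfun (\<lambda>x. max (- a x) 0) \<in> X" by (rule rfun_in_L2_on_mono[OF assms(2,1) 1(2)]) simp
  show "rfun a = rfun (\<lambda>x. max (a x) 0) - rfun (\<lambda>x. max (- a x) 0)"
    unfolding rfun_diff[OF 1] by (rule arg_cong[of _ _ rfun]) (auto simp: fun_eq_iff)
qed

lemma S_real:
  assumes "sq_integrable a" "rfun a \<in> X" "s \<ge> 0"
  obtains b where "sq_integrable b" "S s (rfun a) = rfun b"
proof -
  note p = pos_part[OF assms(1,2)]
  interpret b: bounded_linear "S s" by (rule S_bl[OF assms(3)])
  obtain u where u: "sq_integrable u" "S s (rfun (\<lambda>x. max (a x) 0)) = rfun u"
    using nonneg_L2E S_pos[OF assms(3) p(3) rfun_nonneg[OF p(1)]] by (metis max.cobounded2)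
  obtain v where v: "sq_integrable v" "S s (rfun (\<lambda>x. max (- a x) 0)) = rfun v"
    using nonneg_L2E S_pos[OF assms(3) p(4) rfun_nonneg[OF p(2)]] by (metis max.cobounded2)
  have "S s (rfun a) = rfun (\<lambda>x. u x - v x)"
    by (subst p(5)) (simp add: b.diff u v rfun_diff)
  then show ?thesis using that sq_integrable_diff[OF u(1) v(1)] by blast
qed

lemma form_nonneg_le:
  assumes a: "sq_integrable a" "rfun a \<in> X" "\<And>x. 0 \<le> a x" and b: "sq_integrable b" "rfun b \<in> X" "\<And>x. 0 \<le> b x" and s: "s > 0"
  shows "0 \<le> inner (S s (rfun a)) (rfun b)" "ennreal (inner (S s (rfun a)) (rfun b)) \<le> heat_form s (\<lambda>x y. b x * a y)"
proof -
  have p: "0 \<le> S s (rfun a)" "S s (rfun a) \<le> heat_semigroup s (rfun a)"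
    using S_pos[OF less_imp_le[OF s] a(2) rfun_nonneg[OF a(1,3)]] by auto
  have q: "0 \<le> rfun b" by (rule rfun_nonneg[OF b(1,3)])
  show "0 \<le> inner (S s (rfun a)) (rfun b)" by (rule inner_nonneg_L2[OF p(1) q])
  have "0 \<le> inner (heat_semigroup s (rfun a) - S s (rfun a)) (rfun b)"
    using p(2) q by (intro inner_nonneg_L2) (auto simp: le_L2_diff[of "S s (rfun a)"])
  then have "ennreal (inner (S s (rfun a)) (rfun b)) \<le> ennreal (inner (heat_semigroup s (rfun a)) (rfun b))"
    by (intro ennreal_leI) (simp add: inner_diff_left)
  also have "\<dots> \<le> heat_form s (\<lambda>x y. b x * a y)" by (rule inner_heat_le_heat_form[OF a(1,3) b(1,3) s])
  finally show "ennreal (inner (S s (rfun a)) (rfun b)) \<le> heat_form s (\<lambda>x y. b x * a y)" .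
qed

text \<open>Takes the place of an integral kernel between 0 and the heat kernel. Splitting both
  functions into positive and negative parts leaves four nonnegative pairings, each of which is
  dominated separately.\<close>

lemma form_abs_le:
  assumes a: "sq_integrable a" "rfun a \<in> X" and b: "sq_integrable b" "rfun b \<in> X" and s: "s > 0"
  shows "ennreal \<bar>inner (S s (rfun a)) (rfun b)\<bar> \<le> heat_form s (\<lambda>x y. \<bar>b x\<bar> * \<bar>a y\<bar>)"
proof -
  have [measurable]: "a \<in> borel_measurable borel" "b \<in> borel_measurable borel" using assms by (auto simp: sq_integrable_def)
  note pa = pos_part[OF a] and pb = pos_part[OF b]
  let ?a = "\<lambda>x. max (a x) 0" and ?a' = "\<lambda>x. max (- a x) 0" and ?b = "\<lambda>x. max (b x) 0" and ?b' = "\<lambda>x. max (- b x) 0"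
  interpret l: bounded_linear "S s" using S_bl s by simp
  let ?I = "\<lambda>f g. inner (S s (rfun f)) (rfun g)" and ?K = "\<lambda>f g. heat_form s (\<lambda>x y. g x * f y)"
  note le = form_nonneg_le[OF _ _ _ _ _ _ s]
  have 0: "0 \<le> ?I ?a ?b" "0 \<le> ?I ?a ?b'" "0 \<le> ?I ?a' ?b" "0 \<le> ?I ?a' ?b'"
    by (rule le(1); (simp add: pa pb)?)+
  have 1: "ennreal (?I ?a ?b) \<le> ?K ?a ?b" "ennreal (?I ?a ?b') \<le> ?K ?a ?b'" "ennreal (?I ?a' ?b) \<le> ?K ?a' ?b" "ennreal (?I ?a' ?b') \<le> ?K ?a' ?b'"
    by (rule le(2); (simp add: pa pb)?)+
  have "?I a b = ?I ?a ?b - ?I ?a ?b' - ?I ?a' ?b + ?I ?a' ?b'"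
    by (subst pa(5), subst pb(5)) (simp add: l.diff inner_diff)
  then have "\<bar>?I a b\<bar> \<le> (?I ?a ?b + ?I ?a ?b') + (?I ?a' ?b + ?I ?a' ?b')" using 0 by linarith
  then have "ennreal \<bar>?I a b\<bar> \<le> ennreal ((?I ?a ?b + ?I ?a ?b') + (?I ?a' ?b + ?I ?a' ?b'))" by (rule ennreal_leI)
  also have "\<dots> = (ennreal (?I ?a ?b) + ennreal (?I ?a ?b')) + (ennreal (?I ?a' ?b) + ennreal (?I ?a' ?b'))"
    using 0 by (simp add: ennreal_plus)
  also have "\<dots> \<le> (?K ?a ?b + ?K ?a ?b') + (?K ?a' ?b + ?K ?a' ?b')" by (intro add_mono 1)
  also have "\<dots> = heat_form s (\<lambda>x y. (?b x * ?a y + ?b' x * ?a y) + (?b x * ?a' y + ?b' x * ?a' y))"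
    by (simp add: heat_form_add)
  also have "\<dots> \<le> heat_form s (\<lambda>x y. \<bar>b x\<bar> * \<bar>a y\<bar>)"
    by (rule heat_form_mono) (auto simp: max_def abs_if algebra_simps)
  finally show ?thesis .
qed

lemma form_le_norm: assumes s: "s \<ge> 0" and f: "f \<in> X" shows "inner (S s f) f \<le> (norm f)\<^sup>2"
proof (cases "s = 0")
  case True
  then show ?thesis using f by (simp add: S_0 power2_norm_eq_inner)
next
  case False
  then have s: "s > 0" "s \<ge> 0" using s by auto
  interpret l: bounded_linear "S s" using S_bl s by simp
  obtain p q where pq: "sq_integrable p" "sq_integrable q" "f = rfun p + \<i> *\<^sub>C rfun q" by (rule L2_real_imag)
  have pX: "rfun p \<in> X" "rfun q \<in> X" using real_imag_in_L2_on[of p q \<Omega>] pq f by auto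
  have r: "inner (S s (rfun a)) (rfun a) \<le> (norm (rfun a))\<^sup>2" if "sq_integrable a" "rfun a \<in> X" for a
  proof -
    have "ennreal \<bar>inner (S s (rfun a)) (rfun a)\<bar> \<le> ennreal ((norm (rfun a))\<^sup>2)"
      using form_abs_le[OF that that s(1)] heat_form_le_norm[OF that(1) s(1)] by (rule order.trans)
    then show ?thesis by (subst (asm) ennreal_le_iff) auto
  qed
  obtain u where u: "sq_integrable u" "S s (rfun p) = rfun u" by (rule S_real[OF pq(1) pX(1) s(2)])
  obtain v where v: "sq_integrable v" "S s (rfun q) = rfun v" by (rule S_real[OF pq(2) pX(2) s(2)])
  have "inner (S s f) f = inner (S s (rfun p)) (rfun p) + inner (S s (rfun q)) (rfun q)"
    unfolding pq(3) l.add S_scaleC[OF s(2) pX(2)] u v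
    using inner_rfun_i[OF u(1) pq(2)] inner_rfun_i[OF pq(1) v(1)]
    by (simp add: inner_add inner_scaleC_i inner_commute)
  also have "\<dots> \<le> (norm f)\<^sup>2" unfolding pq(3) norm_real_imag[OF pq(1,2)]
    by (intro add_mono r pq pX)
  finally show ?thesis .
qed

text \<open>Contractivity comes from domination: the squared norm is the form at time
  \<open>2 * s\<close>, and the form is bounded by the Schur test because the heat kernel has mass
  1.\<close>

lemma S_contr: assumes s: "s \<ge> 0" and f: "f \<in> X" shows "norm (S s f) \<le> norm f"
proof -
  have "(norm (S s f))\<^sup>2 = inner (S (s + s) f) f"
    using S_sym[OF s S_in[OF s f] f] by (simp only: S_plus[OF s s f] power2_norm_eq_inner)
  also have "\<dots> \<le> (norm f)\<^sup>2" using s f by (intro form_le_norm) auto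
  finally show ?thesis by (rule power2_le_imp_le) simp
qed

sublocale sg: contraction_semigroup X "restrict_L2 \<Omega>" S
  by (intro contraction_semigroup.intro)
     (rule L2_on_subspace[OF \<Omega>] L2_on_closed[OF \<Omega>] bounded_linear_restrict_L2[OF \<Omega>] restrict_L2_in[OF \<Omega>]
        restrict_L2_id[OF \<Omega>] S_bl S_in S_0 S_plus S_sym S_contr S_cont0; assumption)+

end

section \<open>The low part of the spectrum\<close>

text \<open>Gaussian elimination: an equation with a nonzero coefficient at \<open>k\<close> removes
  the unknown \<open>k\<close>. It will supply a combination of trial functions orthogonal to the
  low eigenvectors.\<close>

lemma underdetermined_system:
  fixes a :: "'i \<Rightarrow> 'j \<Rightarrow> real"
  assumes "finite J" "finite I" "card J < card I"
  shows "\<exists>c. (\<exists>i\<in>I. c i \<noteq> 0) \<and> (\<forall>j\<in>J. (\<Sum>i\<in>I. c i * a i j) = 0)"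
  using assms
proof (induction J arbitrary: I a rule: finite_induct)
  case empty
  then obtain i where "i \<in> I" by fastforce
  then show ?case by (intro exI[of _ "\<lambda>_. 1"]) auto
next
  case (insert j J)
  show ?case
  proof (cases "\<forall>i\<in>I. a i j = 0")
    case True
    obtain c where "\<exists>i\<in>I. c i \<noteq> 0" "\<forall>j\<in>J. (\<Sum>i\<in>I. c i * a i j) = 0"
      using insert.IH[of I a] insert.prems insert.hyps by auto
    then show ?thesis using True by (intro exI[of _ c]) auto
  next
    case False
    then obtain k where k: "k \<in> I" "a k j \<noteq> 0" by auto
    define a' where "a' i l = a i l - a i j / a k j * a k l" for i l
    have "card J < card (I - {k})" using insert.prems insert.hyps k by auto
    then obtain c where c: "\<exists>i\<in>I - {k}. c i \<noteq> 0" "\<And>l. l \<in> J \<Longrightarrow> (\<Sum>i\<in>I - {k}. c i * a' i l) = 0"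
      using insert.IH[of "I - {k}" a'] insert.prems by auto
    define c' where "c' = c(k := - (\<Sum>i\<in>I - {k}. c i * a i j) / a k j)"
    have sum: "(\<Sum>i\<in>I. c' i * a i l) = c' k * a k l + (\<Sum>i\<in>I - {k}. c i * a i l)" for l
      using insert.prems k by (subst sum.remove[of _ k]) (auto simp: c'_def intro!: sum.cong)
    have "(\<Sum>i\<in>I. c' i * a i l) = 0" if "l \<in> insert j J" for l
    proof (cases "l = j")
      case True
      then show ?thesis using sum[of j] k by (simp add: c'_def)
    next
      case False
      then have "0 = (\<Sum>i\<in>I - {k}. c i * a' i l)" using c that by simp
      also have "\<dots> = (\<Sum>i\<in>I - {k}. c i * a i l) - (\<Sum>i\<in>I - {k}. c i * a i j) / a k j * a k l"
        by (simp add: a'_def right_diff_distrib sum_subtractf sum_distrib_right sum_divide_distrib mult.assoc)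
      also have "\<dots> = (\<Sum>i\<in>I. c' i * a i l)" unfolding sum by (simp add: c'_def)
      finally show ?thesis by simp
    qed
    moreover have "\<exists>i\<in>I. c' i \<noteq> 0" using c(1) by (auto simp: c'_def)
    ultimately show ?thesis by blast
  qed
qed

lemma inner_scaleC_right: "inner u (c *\<^sub>C v) = Re c * inner u v + Im c * inner u (\<i> *\<^sub>C v)"
  by (simp add: inner_L2_def cinner_scaleC)

text \<open>Real orthogonality to both \<open>e\<close> and \<open>\<i> *\<^sub>C e\<close> amounts
  to complex orthogonality to \<open>e\<close>, and that is inherited by the complex span.\<close>

lemma inner_cspan_eq_0:
  assumes "\<And>e. e \<in> B \<Longrightarrow> inner u e = 0 \<and> inner u (\<i> *\<^sub>C e) = 0" and "v \<in> cspan B"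
  shows "inner u v = 0"
proof -
  have "cvec.subspace {v. inner u v = 0 \<and> inner u (\<i> *\<^sub>C v) = 0}"
    unfolding cvec.subspace_def
  proof (intro conjI ballI allI)
    fix c v assume "v \<in> {v. inner u v = 0 \<and> inner u (\<i> *\<^sub>C v) = 0}"
    then show "c *\<^sub>C v \<in> {v. inner u v = 0 \<and> inner u (\<i> *\<^sub>C v) = 0}"
      using inner_scaleC_right[of u c v] inner_scaleC_right[of u "\<i> * c" v] by simp
  qed (auto simp: inner_add_right cvec.scale_right_distrib)
  moreover have "B \<subseteq> {v. inner u v = 0 \<and> inner u (\<i> *\<^sub>C v) = 0}" using assms(1) by auto
  ultimately have "cspan B \<subseteq> {v. inner u v = 0 \<and> inner u (\<i> *\<^sub>C v) = 0}" by (intro cvec.span_minimal)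
  then show ?thesis using assms(2) by auto
qed

locale low_spectrum = dominated_semigroup \<Omega> T for \<Omega> :: "'a::euclidean_space set" and T +
  fixes H :: "('a L2 \<times> 'a L2) set" and t :: real
  assumes H: "generator (L2_on \<Omega>) T = {(f, - g) | f g. (f, g) \<in> H}"
    and t: "ereal t < inf_ess_spectrum (L2_on \<Omega>) H"
begin

lemma gen_eq: "sg.gen = H"
proof -
  have "(f, g) \<in> sg.gen \<longleftrightarrow> (f, - g) \<in> generator X T" for f g
  proof -
    have "((\<lambda>h. (S h f - f) /\<^sub>R h) \<longlongrightarrow> - g) (at_right 0) \<longleftrightarrow> ((\<lambda>h. (T h f - f) /\<^sub>R h) \<longlongrightarrow> - g) (at_right 0)"
      if "f \<in> X" using that by (simp add: S_on)
    moreover have "- g \<in> X \<longleftrightarrow> g \<in> X"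
      using L2_on_scaleC[OF \<Omega>, of g "- 1"] L2_on_scaleC[OF \<Omega>, of "- g" "- 1"] by (auto simp: cvec.scale_minus_left)
    ultimately show ?thesis by (auto simp: sg.gen_def generator_def)
  qed
  also have "(f, - g) \<in> generator X T \<longleftrightarrow> (f, g) \<in> H" for f g
    unfolding H by (auto simp: neg_equal_iff_equal)
  finally show ?thesis by auto
qed

lemma eigenspace_gen: "e \<in> eigenspace H (complex_of_real \<mu>) \<longleftrightarrow> (e, \<mu> *\<^sub>R e) \<in> sg.gen"
  by (simp add: eigenspace_def gen_eq scaleR_L2_def)

lemma not_regular_spectrum:
  assumes "\<not> sg.regular \<nu>" shows "complex_of_real \<nu> \<in> op_spectrum X H"
proof (rule ccontr)
  assume "\<not> ?thesis"
  then obtain R where R: "bounded_clinear_on X R"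
    "{(g - complex_of_real \<nu> *\<^sub>C f, f) | f g. (f, g) \<in> H} = {(h, R h) | h. h \<in> X}"
    unfolding op_spectrum_def resolvent_set_def by auto
  obtain K where K: "\<And>h. h \<in> X \<Longrightarrow> norm (R h) \<le> K * norm h" using R(1) unfolding bounded_clinear_on_def by blast
  have "norm f \<le> K * norm (g - \<nu> *\<^sub>R f)" if "(f, g) \<in> sg.gen" for f g
  proof -
    have "(g - complex_of_real \<nu> *\<^sub>C f, f) \<in> {(h, R h) | h. h \<in> X}"
      unfolding R(2)[symmetric] using that gen_eq by auto
    then have "f = R (g - complex_of_real \<nu> *\<^sub>C f)" "g - complex_of_real \<nu> *\<^sub>C f \<in> X" by auto
    then show ?thesis using K[of "g - complex_of_real \<nu> *\<^sub>C f"] unfolding scaleR_L2_def by metis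
  qed
  then show False using assms unfolding sg.regular_def by blast
qed

lemma spectrum_discrete:
  assumes "complex_of_real \<nu> \<in> op_spectrum X H" "\<nu> \<le> t"
  shows "complex_of_real \<nu> \<in> discrete_spectrum X H"
proof (rule ccontr)
  assume "\<not> ?thesis"
  then have "complex_of_real \<nu> \<in> ess_spectrum X H" using assms by (simp add: ess_spectrum_def)
  then have "inf_ess_spectrum X H \<le> ereal \<nu>"
    unfolding inf_ess_spectrum_def by (intro Inf_lower) auto
  also have "\<dots> \<le> ereal t" using assms by simp
  finally show False using t by simp
qed

lemma spectrum_gap:
  assumes "complex_of_real \<mu> \<in> op_spectrum X H" "\<mu> \<le> t"
  shows "\<exists>\<delta>>0. \<forall>\<nu>. \<bar>\<nu> - \<mu>\<bar> < \<delta> \<and> \<nu> \<noteq> \<mu> \<longrightarrow> complex_of_real \<nu> \<notin> op_spectrum X H"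
proof -
  have "complex_of_real \<mu> isolated_in op_spectrum X H"
    using spectrum_discrete[OF assms] by (simp add: discrete_spectrum_def)
  then obtain U where U: "open U" "U \<inter> op_spectrum X H = {complex_of_real \<mu>}"
    unfolding isolated_in_def by auto
  then have "complex_of_real \<mu> \<in> U" by auto
  then obtain \<delta> where \<delta>: "\<delta> > 0" "ball (complex_of_real \<mu>) \<delta> \<subseteq> U" using U(1) open_contains_ball by metis
  have "complex_of_real \<nu> \<notin> op_spectrum X H" if "\<bar>\<nu> - \<mu>\<bar> < \<delta>" "\<nu> \<noteq> \<mu>" for \<nu>
  proof
    assume *: "complex_of_real \<nu> \<in> op_spectrum X H"
    have "dist (complex_of_real \<mu>) (complex_of_real \<nu>) = \<bar>\<nu> - \<mu>\<bar>"
      by (simp add: dist_norm abs_minus_commute flip: of_real_diff)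
    then have "complex_of_real \<nu> \<in> U" using that \<delta> by auto
    then have "complex_of_real \<nu> = complex_of_real \<mu>" using U(2) * by blast
    then show False using that(2) by simp
  qed
  then show ?thesis using \<delta>(1) by blast
qed

lemma regular_no_eigenvector:
  assumes "sg.regular \<mu>" "(e, \<mu> *\<^sub>R e) \<in> sg.gen" shows "e = 0"
  using assms unfolding sg.regular_def by force

lemma eigenvalue_nonneg:
  assumes "(e, \<mu> *\<^sub>R e) \<in> sg.gen" "e \<noteq> 0" shows "\<mu> \<ge> 0"
proof -
  have "e \<in> X" using assms by (simp add: sg.gen_def)
  then have "norm (S 1 e) \<le> norm e" by (intro S_contr) auto
  then have "exp (- \<mu>) * norm e \<le> 1 * norm e" using sg.eigenvector_semigroup[OF assms(1), of 1] by simp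
  then show ?thesis using assms(2) by simp
qed

definition low_eigenvalues :: "real set" where
  "low_eigenvalues = {\<mu>. \<mu> \<le> t \<and> eigenvalue H (complex_of_real \<mu>)}"

lemma low_eigenvalueE:
  assumes "\<mu> \<in> low_eigenvalues"
  obtains e where "\<mu> \<le> t" "e \<noteq> 0" "(e, \<mu> *\<^sub>R e) \<in> sg.gen" "0 \<le> \<mu>" "\<not> sg.regular \<mu>"
  using assms regular_no_eigenvector eigenvalue_nonneg
  by (auto simp: low_eigenvalues_def eigenvalue_def eigenspace_gen)

text \<open>Infinitely many would accumulate at some \<open>x\<close> in \<open>{0..t}\<close>. If
  \<open>x\<close> is regular, eigenvalues close to \<open>x\<close> violate the bound that defines
  regularity; otherwise \<open>x\<close> is a spectral point at most \<open>t\<close>, hence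
  isolated in the spectrum.\<close>

lemma finite_low_eigenvalues: "finite low_eigenvalues"
proof (rule ccontr)
  assume inf: "infinite low_eigenvalues"
  have "low_eigenvalues \<subseteq> {0..t}" by (auto elim: low_eigenvalueE)
  then obtain x where x: "x \<in> {0..t}" "x islimpt low_eigenvalues"
    using Heine_Borel_imp_Bolzano_Weierstrass[OF compact_Icc inf] by blast
  show False
  proof (cases "sg.regular x")
    case True
    then obtain K where K: "\<And>f g. (f, g) \<in> sg.gen \<Longrightarrow> norm f \<le> K * norm (g - x *\<^sub>R f)"
      unfolding sg.regular_def by blast
    have "1 / (\<bar>K\<bar> + 1) > 0" by simp
    then obtain \<mu> where \<mu>: "\<mu> \<in> low_eigenvalues" "\<bar>\<mu> - x\<bar> < 1 / (\<bar>K\<bar> + 1)"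
      using x(2) unfolding islimpt_approachable dist_real_def by blast
    obtain e where e: "e \<noteq> 0" "(e, \<mu> *\<^sub>R e) \<in> sg.gen" using \<mu>(1) by (rule low_eigenvalueE)
    have "norm e \<le> K * norm (\<mu> *\<^sub>R e - x *\<^sub>R e)" by (rule K[OF e(2)])
    also have "norm (\<mu> *\<^sub>R e - x *\<^sub>R e) = \<bar>\<mu> - x\<bar> * norm e" by (simp add: scaleR_diff_left[symmetric])
    also have "K * (\<bar>\<mu> - x\<bar> * norm e) \<le> (\<bar>K\<bar> + 1) * (\<bar>\<mu> - x\<bar> * norm e)" by (intro mult_right_mono) auto
    finally have "1 * norm e \<le> ((\<bar>K\<bar> + 1) * \<bar>\<mu> - x\<bar>) * norm e" by simp
    then have "1 \<le> (\<bar>K\<bar> + 1) * \<bar>\<mu> - x\<bar>" using e(1) by (subst (asm) mult_le_cancel_right) auto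
    then show False using \<mu>(2) by (simp add: field_simps)
  next
    case False
    then have "complex_of_real x \<in> op_spectrum X H" by (rule not_regular_spectrum)
    then obtain \<delta> where \<delta>: "\<delta> > 0" "\<And>\<nu>. \<bar>\<nu> - x\<bar> < \<delta> \<Longrightarrow> \<nu> \<noteq> x \<Longrightarrow> complex_of_real \<nu> \<notin> op_spectrum X H"
      using spectrum_gap[of x] x(1) by auto
    obtain \<mu> where \<mu>: "\<mu> \<in> low_eigenvalues" "\<mu> \<noteq> x" "\<bar>\<mu> - x\<bar> < \<delta>"
      using x(2) \<delta>(1) unfolding islimpt_approachable by (auto simp: dist_real_def)
    have "\<not> sg.regular \<mu>" using \<mu>(1) by (rule low_eigenvalueE)
    then show False using not_regular_spectrum \<delta>(2)[OF \<mu>(3,2)] by blast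
  qed
qed

text \<open>One half of the min-max principle: orthogonally to at most
  \<open>eigenvalue_count H t\<close> complex directions the energy is at least \<open>t\<close>.
  The set \<open>J\<close> collects bases of the eigenspaces.\<close>

theorem finite_test_set:
  obtains J where "finite J" "card J \<le> eigenvalue_count H t"
    "\<And>u s. u \<in> X \<Longrightarrow> (\<And>e. e \<in> J \<Longrightarrow> inner u e = 0 \<and> inner u (\<i> *\<^sub>C e) = 0) \<Longrightarrow> s > 0 \<Longrightarrow>
       inner (S s u) u \<le> exp (- t * s) * (norm u)\<^sup>2"
proof -
  \<comment> \<open>Finite dimension has to be extracted from discreteness of the spectrum first: an
    infinite basis would have cardinality 0 and bound nothing.\<close>
  have "\<exists>B. finite B \<and> eigenspace H (complex_of_real \<mu>) \<subseteq> cspan B \<and> card B = cdim (eigenspace H (complex_of_real \<mu>))"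
    if \<mu>: "\<mu> \<in> low_eigenvalues" for \<mu>
  proof -
    have "\<mu> \<le> t" "\<not> sg.regular \<mu>" using \<mu> by (auto elim: low_eigenvalueE)
    then have "complex_of_real \<mu> \<in> discrete_spectrum X H"
      by (intro spectrum_discrete not_regular_spectrum)
    then obtain B0 where B0: "finite B0" "eigenspace H (complex_of_real \<mu>) \<subseteq> cspan B0"
      by (auto simp: discrete_spectrum_def)
    obtain B where B: "B \<subseteq> eigenspace H (complex_of_real \<mu>)" "cvec.independent B"
      "eigenspace H (complex_of_real \<mu>) \<subseteq> cspan B" "card B = cdim (eigenspace H (complex_of_real \<mu>))"
      by (rule cvec.basis_exists)
    have "finite B" using cvec.independent_span_bound[OF B0(1) B(2)] B(1) B0(2) by blast
    then show ?thesis using B by blast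
  qed
  then obtain B where B: "\<And>\<mu>. \<mu> \<in> low_eigenvalues \<Longrightarrow> finite (B \<mu>)"
    "\<And>\<mu>. \<mu> \<in> low_eigenvalues \<Longrightarrow> eigenspace H (complex_of_real \<mu>) \<subseteq> cspan (B \<mu>)"
    "\<And>\<mu>. \<mu> \<in> low_eigenvalues \<Longrightarrow> card (B \<mu>) = cdim (eigenspace H (complex_of_real \<mu>))"
    by metis
  show ?thesis
  proof
    show "finite (\<Union>\<mu>\<in>low_eigenvalues. B \<mu>)" using finite_low_eigenvalues B(1) by blast
    have "card (\<Union>\<mu>\<in>low_eigenvalues. B \<mu>) \<le> (\<Sum>\<mu>\<in>low_eigenvalues. card (B \<mu>))"
      by (rule card_UN_le[OF finite_low_eigenvalues])
    also have "\<dots> = eigenvalue_count H t"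
      using B(3) by (simp add: eigenvalue_count_def low_eigenvalues_def)
    finally show "card (\<Union>\<mu>\<in>low_eigenvalues. B \<mu>) \<le> eigenvalue_count H t" .
  next
    fix u s assume u: "u \<in> X" and o: "\<And>e. e \<in> (\<Union>\<mu>\<in>low_eigenvalues. B \<mu>) \<Longrightarrow> inner u e = 0 \<and> inner u (\<i> *\<^sub>C e) = 0" and s: "s > (0::real)"
    show "inner (S s u) u \<le> exp (- t * s) * (norm u)\<^sup>2"
    proof (rule sg.form_bound_orthogonal_to_low_eigenvectors[OF _ u _ s])
      fix \<mu> assume "0 \<le> \<mu>" "\<mu> < t" "\<not> sg.regular \<mu>"
      then obtain \<delta> where \<delta>: "\<delta> > 0" "\<And>\<nu>. \<bar>\<nu> - \<mu>\<bar> < \<delta> \<Longrightarrow> \<nu> \<noteq> \<mu> \<Longrightarrow> complex_of_real \<nu> \<notin> op_spectrum X H"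
        using spectrum_gap[OF not_regular_spectrum, of \<mu>] by auto
      have "sg.regular \<nu>" if "\<mu> < \<nu>" "\<nu> < \<mu> + \<delta>" for \<nu>
        using not_regular_spectrum[of \<nu>] \<delta>(2)[of \<nu>] that by auto
      then show "\<exists>\<delta>>0. \<forall>\<nu>. \<mu> < \<nu> \<and> \<nu> < \<mu> + \<delta> \<longrightarrow> sg.regular \<nu>" using \<delta>(1) by blast
    next
      fix \<mu> e assume *: "\<mu> < t" "(e, \<mu> *\<^sub>R e) \<in> sg.gen"
      show "inner u e = 0"
      proof (cases "e = 0")
        case False
        then have \<mu>: "\<mu> \<in> low_eigenvalues" using * by (auto simp: low_eigenvalues_def eigenvalue_def eigenspace_gen)
        then have "e \<in> cspan (B \<mu>)" using B(2)[OF \<mu>] * by (auto simp: eigenspace_gen)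
        then show ?thesis using o \<mu> by (intro inner_cspan_eq_0[of "B \<mu>"]) auto
      qed simp
    qed
  qed
qed

end

section \<open>Partition of unity and exponential weights\<close>

lemma cosh_ge_quadratic: "1 + u\<^sup>2 / 2 \<le> cosh (u::real)"
proof -
  let ?f = "\<lambda>n. if even n then u ^ n /\<^sub>R fact n else 0"
  have s: "?f sums cosh u" by (rule cosh_converges)
  have "sum ?f {..<3} \<le> suminf ?f"
    by (rule sum_le_suminf) (use s in \<open>auto simp: sums_iff zero_le_even_power\<close>)
  then show ?thesis using s by (simp add: sums_iff eval_nat_numeral field_simps)
qed

lemma cos_ge_quadratic: "1 - u\<^sup>2 / 2 \<le> cos (u::real)"
proof -
  have "(sin (u / 2))\<^sup>2 \<le> (u / 2)\<^sup>2" using abs_sin_x_le_abs_x[of "u / 2"] by (simp add: abs_le_square_iff[symmetric])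
  then show ?thesis using cos_double_sin[of "u / 2"] by (simp add: power_divide)
qed

text \<open>With this profile the squares of the integer translates add up to 1: at each point at
  most two translates are nonzero, and their values are the cosine and the sine of one
  angle.\<close>

definition bump :: "real \<Rightarrow> real" where
  "bump y = (if \<bar>y\<bar> < 1 then cos (pi * y / 2) else 0)"

lemma bump_bounds: "0 \<le> bump y" "bump y \<le> 1"
proof -
  have "0 \<le> cos (pi * y / 2)" if "\<bar>y\<bar> < 1"
  proof (rule cos_ge_zero)
    have "pi * (-1) \<le> pi * y" "pi * y \<le> pi * 1" using that by (intro mult_left_mono; simp)+
    then show "- (pi / 2) \<le> pi * y / 2" "pi * y / 2 \<le> pi / 2" by auto
  qed
  then show "0 \<le> bump y" "bump y \<le> 1" by (auto simp: bump_def)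
qed

lemma bump_measurable [measurable]: "bump \<in> borel_measurable borel"
  unfolding bump_def[abs_def] by measurable

lemma bump_floor:
  assumes "0 \<le> p" "p < 1" shows "bump p = cos (pi * p / 2)" "bump (p - 1) = sin (pi * p / 2)"
proof -
  show "bump p = cos (pi * p / 2)" using assms by (simp add: bump_def)
  have "cos (pi * (p - 1) / 2) = sin (pi * p / 2)"
    using cos_sin_eq[of "pi * (p - 1) / 2"] by (simp add: algebra_simps diff_divide_distrib cos_diff)
  then show "bump (p - 1) = sin (pi * p / 2)" using assms by (auto simp: bump_def)
qed

lemma sum_bump:
  fixes y :: real and f :: "int \<Rightarrow> real"
  assumes "\<bar>y\<bar> < real n"
  defines "m \<equiv> \<lfloor>y\<rfloor>" and "p \<equiv> frac y"
  shows "(\<Sum>i\<in>{- int n..int n}. bump (y - of_int i) * f i) = cos (pi * p / 2) * f m + sin (pi * p / 2) * f (m + 1)"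
proof -
  have mn: "m \<in> {- int n..int n}" "m + 1 \<in> {- int n..int n}" using assms(1) unfolding m_def by (auto; linarith)+
  have p: "0 \<le> p" "p < 1" "y = of_int m + p" unfolding p_def m_def using frac_lt_1[of y] by (auto simp: frac_def)
  have "(\<Sum>i\<in>{- int n..int n}. bump (y - of_int i) * f i) = (\<Sum>i\<in>{m, m + 1}. bump (y - of_int i) * f i)"
  proof (rule sum.mono_neutral_right)
    show "\<forall>i\<in>{- int n..int n} - {m, m + 1}. bump (y - of_int i) * f i = 0"
    proof
      fix i assume "i \<in> {- int n..int n} - {m, m + 1}"
      then have "i \<le> m - 1 \<or> i \<ge> m + 2" by auto
      then have "1 \<le> \<bar>y - of_int i\<bar>"
      proof
        assume "i \<le> m - 1"
        then have "real_of_int i \<le> of_int m - 1" by linarith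
        then show ?thesis using p by linarith
      next
        assume "i \<ge> m + 2"
        then have "real_of_int i \<ge> of_int m + 2" by linarith
        then show ?thesis using p by linarith
      qed
      then show "bump (y - of_int i) * f i = 0" by (simp add: bump_def)
    qed
  qed (use mn in auto)
  also have "\<dots> = bump p * f m + bump (p - 1) * f (m + 1)" by (simp add: p(3))
  finally show ?thesis using bump_floor[OF p(1,2)] by simp
qed

lemma sum_bump_square:
  assumes "\<bar>y\<bar> < real n" shows "(\<Sum>i\<in>{- int n..int n}. (bump (y - of_int i))\<^sup>2) = 1"
proof -
  have p: "0 \<le> frac y" "frac y < 1" "y - of_int \<lfloor>y\<rfloor> = frac y" "y - of_int (\<lfloor>y\<rfloor> + 1) = frac y - 1"
    using frac_lt_1[of y] by (auto simp: frac_def)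
  show ?thesis using sum_bump[OF assms, of "\<lambda>i. bump (y - of_int i)"] bump_floor[OF p(1,2)]
    unfolding power2_eq_square p by (simp add: power2_eq_square[symmetric])
qed

text \<open>The vector of translates turns by a right angle per unit length. While \<open>y'\<close>
  stays in the unit interval of \<open>y\<close>, the inner product is exactly the cosine. In the
  next interval a term is lost whose contribution to the cosine is nonpositive.\<close>

lemma sum_bump_mult_aux:
  assumes "\<bar>y\<bar> < real n" and le: "y \<le> y'"
  shows "cos (pi * (y' - y) / 2) \<le> (\<Sum>i\<in>{- int n..int n}. bump (y - of_int i) * bump (y' - of_int i))
    \<or> 1 \<le> y' - y"
proof -
  define m p q where "m = \<lfloor>y\<rfloor>" and "p = frac y" and "q = y' - of_int m"
  have p: "0 \<le> p" "p < 1" "y = of_int m + p" unfolding p_def m_def using frac_lt_1[of y] by (auto simp: frac_def)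
  have s: "(\<Sum>i\<in>{- int n..int n}. bump (y - of_int i) * bump (y' - of_int i))
      = cos (pi * p / 2) * bump q + sin (pi * p / 2) * bump (q - 1)"
    using sum_bump[OF assms(1), of "\<lambda>i. bump (y' - of_int i)"] by (simp add: q_def p_def m_def algebra_simps)
  have d: "cos (pi * (y' - y) / 2) = cos (pi * q / 2) * cos (pi * p / 2) + sin (pi * q / 2) * sin (pi * p / 2)"
    using cos_diff[of "pi * q / 2" "pi * p / 2"] by (simp add: q_def p(3) algebra_simps diff_divide_distrib add_divide_distrib)
  have q0: "p \<le> q" using le p by (simp add: q_def)
  consider "q < 1" | "1 \<le> q" "q < 2" | "2 \<le> q" by linarith
  then show ?thesis
  proof cases
    case 1
    then have "bump q = cos (pi * q / 2)" "bump (q - 1) = sin (pi * q / 2)" using bump_floor[of q] q0 p by auto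
    then show ?thesis unfolding s d by (simp add: mult.commute)
  next
    case 2
    then have b0: "bump q = 0" by (simp add: bump_def)
    have b1: "bump (q - 1) = sin (pi * q / 2)"
      using bump_floor(1)[of "q - 1"] 2 cos_sin_eq[of "pi * (q - 1) / 2"]
      by (simp add: algebra_simps diff_divide_distrib cos_diff)
    have "cos (pi * q / 2) \<le> 0"
    proof -
      have "0 \<le> sin (pi * (q - 1) / 2)" using 2 by (intro sin_ge_zero) (auto simp: field_simps)
      moreover have "cos (pi * q / 2) = - sin (pi * (q - 1) / 2)"
        by (simp add: algebra_simps diff_divide_distrib sin_diff)
      ultimately show ?thesis by simp
    qed
    moreover have "0 \<le> cos (pi * p / 2)" using bump_bounds(1)[of p] bump_floor(1)[OF p(1,2)] by simp
    ultimately have "cos (pi * q / 2) * cos (pi * p / 2) \<le> 0" by (simp add: mult_nonpos_nonneg)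
    then show ?thesis unfolding s d b0 b1 by (simp add: mult.commute)
  next
    case 3
    then show ?thesis using p q0 by (simp add: q_def)
  qed
qed

text \<open>The natural bound \<open>\<delta>\<^sup>2 / 2\<close> is relaxed to
  \<open>cosh \<delta> - 1\<close>, because the heat average of \<open>cosh\<close> is
  explicit.\<close>

lemma sum_bump_mult:
  assumes "\<bar>y\<bar> < real n" "\<bar>y'\<bar> < real n"
  defines "c \<equiv> (\<Sum>i\<in>{- int n..int n}. bump (y - of_int i) * bump (y' - of_int i))"
  shows "0 \<le> c" "c \<le> 1" "1 - c \<le> cosh (pi * (y - y') / 2) - 1"
proof -
  show c0: "0 \<le> c" unfolding c_def by (intro sum_nonneg mult_nonneg_nonneg bump_bounds)
  have "c \<le> (\<Sum>i\<in>{- int n..int n}. ((bump (y - of_int i))\<^sup>2 + (bump (y' - of_int i))\<^sup>2) / 2)"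
    unfolding c_def
  proof (rule sum_mono)
    fix i
    show "bump (y - of_int i) * bump (y' - of_int i) \<le> ((bump (y - of_int i))\<^sup>2 + (bump (y' - of_int i))\<^sup>2) / 2"
      using sum_squares_bound[of "bump (y - of_int i)" "bump (y' - of_int i)"] by simp
  qed
  also have "\<dots> = 1"
    using sum_bump_square[OF assms(1)] sum_bump_square[OF assms(2)]
    by (simp add: sum_divide_distrib[symmetric] sum.distrib)
  finally show "c \<le> 1" .
  define \<delta> where "\<delta> = pi * (y - y') / 2"
  have "cos \<delta> \<le> c \<or> 1 \<le> \<bar>y - y'\<bar>"
  proof (cases "y \<le> y'")
    case True
    have "pi * (y' - y) / 2 = - \<delta>" by (simp add: \<delta>_def algebra_simps diff_divide_distrib)
    then have "cos \<delta> = cos (pi * (y' - y) / 2)" by (simp only: cos_minus)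
    then show ?thesis using sum_bump_mult_aux[OF assms(1) True] unfolding c_def by auto
  next
    case False
    then have le: "y' \<le> y" by simp
    have "c = (\<Sum>i\<in>{- int n..int n}. bump (y' - of_int i) * bump (y - of_int i))" unfolding c_def by (simp add: mult.commute)
    then show ?thesis using sum_bump_mult_aux[OF assms(2) le] unfolding \<delta>_def by auto
  qed
  then have "1 - c \<le> \<delta>\<^sup>2 / 2"
  proof
    assume "cos \<delta> \<le> c" then show ?thesis using cos_ge_quadratic[of \<delta>] by simp
  next
    \<comment> \<open>For distant points \<open>\<bar>\<delta>\<bar>\<close> is at least 3/2, so
      \<open>\<delta>\<^sup>2 / 2\<close> exceeds 1 and \<open>0 \<le> c\<close> is enough.\<close>
    assume "1 \<le> \<bar>y - y'\<bar>"
    then have "3 * 1 \<le> pi * \<bar>y - y'\<bar>" using pi_gt3 by (intro mult_mono) auto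
    then have "3 / 2 \<le> \<bar>\<delta>\<bar>" by (simp add: \<delta>_def abs_mult)
    then have "(3/2)\<^sup>2 \<le> \<bar>\<delta>\<bar>\<^sup>2" by (intro power_mono) auto
    then show ?thesis using c0 by (simp add: power2_eq_square)
  qed
  also have "\<dots> \<le> cosh \<delta> - 1" using cosh_ge_quadratic[of \<delta>] by simp
  finally show "1 - c \<le> cosh (pi * (y - y') / 2) - 1" unfolding \<delta>_def .
qed

text \<open>Splits the defect of a product into the coordinates; \<open>prod_upper\<close>
  reassembles the coordinate bounds into a product of \<open>cosh\<close>.\<close>

lemma prod_lower: "finite A \<Longrightarrow> (\<And>e. e \<in> A \<Longrightarrow> 0 \<le> c e \<and> c e \<le> 1) \<Longrightarrow> 1 - (\<Sum>e\<in>A. 1 - c e) \<le> (\<Prod>e\<in>A. c e :: real)"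
proof (induction A rule: finite_induct)
  case (insert x A)
  have P: "0 \<le> (\<Prod>e\<in>A. c e)" "(\<Prod>e\<in>A. c e) \<le> 1" using insert.prems by (auto intro!: prod_nonneg prod_le_1)
  have "0 \<le> (1 - c x) * (1 - (\<Prod>e\<in>A. c e))" using P insert.prems by (intro mult_nonneg_nonneg) auto
  then show ?case using insert by (simp add: algebra_simps)
qed simp

lemma prod_upper: "finite A \<Longrightarrow> (\<And>e. e \<in> A \<Longrightarrow> 1 \<le> c e) \<Longrightarrow> (\<Sum>e\<in>A. c e - 1) + 1 \<le> (\<Prod>e\<in>A. c e :: real)"
proof (induction A rule: finite_induct)
  case (insert x A)
  have P: "1 \<le> (\<Prod>e\<in>A. c e)" using insert.prems by (auto intro!: prod_ge_1)
  have "0 \<le> (c x - 1) * ((\<Prod>e\<in>A. c e) - 1)" using P insert.prems by (intro mult_nonneg_nonneg) auto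
  then show ?case using insert by (simp add: algebra_simps)
qed simp

section \<open>Cubic cells and their cutoffs\<close>

definition cutoff :: "real \<Rightarrow> ('a \<Rightarrow> int) \<Rightarrow> 'a::euclidean_space \<Rightarrow> real" where
  "cutoff h k x = (\<Prod>e\<in>Basis. bump (x \<bullet> e / h - of_int (k e)))"

text \<open>An open cube of side \<open>2 * h\<close>, whereas the centres have spacing
  \<open>h\<close>; neighbouring cells therefore overlap.\<close>

definition cell :: "real \<Rightarrow> ('a \<Rightarrow> int) \<Rightarrow> 'a::euclidean_space set" where
  "cell h k = {x. \<forall>e\<in>Basis. \<bar>x \<bullet> e / h - of_int (k e)\<bar> < 1}"

text \<open>Indices are extensional on \<open>Basis\<close>, so distinct indices differ in some
  coordinate.\<close>

definition box_indices :: "nat \<Rightarrow> ('a::euclidean_space \<Rightarrow> int) set" where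
  "box_indices n = PiE Basis (\<lambda>_. {- int n..int n})"

lemma finite_box_indices: "finite (box_indices n)"
  unfolding box_indices_def by (intro finite_PiE) auto

lemma cutoff_bounds: "0 \<le> cutoff h k x" "cutoff h k x \<le> 1"
  unfolding cutoff_def by (auto intro!: prod_nonneg prod_le_1 bump_bounds)

lemma cutoff_measurable [measurable]: "cutoff h k \<in> borel_measurable borel"
  unfolding cutoff_def[abs_def] by measurable

lemma cutoff_outside: "x \<notin> cell h k \<Longrightarrow> cutoff h k x = 0"
  unfolding cell_def cutoff_def by (auto simp: bump_def intro!: prod_zero)

lemma large_box:
  fixes x :: "'a::euclidean_space"
  shows "\<exists>N. \<forall>n\<ge>N. \<forall>e\<in>Basis. \<bar>x \<bullet> e / h\<bar> < real n"
proof -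
  obtain N where N: "(\<Sum>e\<in>Basis. \<bar>x \<bullet> e / h\<bar>) < real N" using reals_Archimedean2 by blast
  have "\<bar>x \<bullet> e / h\<bar> < real n" if "e \<in> Basis" "n \<ge> N" for e n
  proof -
    have "\<bar>x \<bullet> e / h\<bar> \<le> (\<Sum>e\<in>Basis. \<bar>x \<bullet> e / h\<bar>)" using that by (intro member_le_sum) auto
    then show ?thesis using N that by (simp add: order.strict_trans2)
  qed
  then show ?thesis by blast
qed

lemma sum_cutoff_mult:
  "(\<Sum>k\<in>box_indices n. cutoff h k x * cutoff h k y)
    = (\<Prod>e\<in>Basis. \<Sum>i\<in>{- int n..int n}. bump (x \<bullet> e / h - of_int i) * bump (y \<bullet> e / h - of_int i))"
  unfolding box_indices_def cutoff_def by (subst prod_sum_PiE) (auto simp: prod.distrib)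

lemma sum_cutoff_square:
  assumes "\<And>e. e \<in> Basis \<Longrightarrow> \<bar>x \<bullet> e / h\<bar> < real n"
  shows "(\<Sum>k\<in>box_indices n. (cutoff h k x)\<^sup>2) = 1"
  using sum_cutoff_mult[of h x x n] sum_bump_square assms
  by (simp add: power2_eq_square)

lemma subset_box_indices:
  assumes "finite K" "K \<subseteq> PiE Basis (\<lambda>_. UNIV)"
  shows "\<exists>N. \<forall>n\<ge>N. K \<subseteq> (box_indices n :: ('a::euclidean_space \<Rightarrow> int) set)"
proof -
  have fin: "finite (\<Union>k\<in>K. k ` (Basis::'a set))" using assms by auto
  define N where "N = nat (\<Sum>i\<in>(\<Union>k\<in>K. k ` (Basis::'a set)). \<bar>i\<bar>)"
  have "k e \<in> {- int n..int n}" if "k \<in> K" "e \<in> Basis" "n \<ge> N" for k e n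
  proof -
    have "\<bar>k e\<bar> \<le> (\<Sum>i\<in>(\<Union>k\<in>K. k ` (Basis::'a set)). \<bar>i\<bar>)"
      using fin that by (intro member_le_sum) auto
    then show ?thesis using that by (auto simp: N_def)
  qed
  then show ?thesis using assms(2) unfolding box_indices_def by (intro exI[of _ N]) (auto simp: PiE_iff)
qed

text \<open>The pointwise error of the localisation, with \<open>p\<close> and \<open>q\<close>
  standing for the values of \<open>1 / sqrt w\<close> at two points. Over a full box the squares of
  the cutoffs sum to 1, and the left-hand side becomes \<open>(p - q)\<^sup>2\<close> plus
  \<open>2 * p * q\<close> times the defect of the product of the one-dimensional
  correlations.\<close>

lemma sum_cutoff_difference:
  fixes x y :: "'a::euclidean_space"
  assumes K: "finite K" "K \<subseteq> PiE Basis (\<lambda>_. UNIV)" and h: "h > 0" and pq: "0 \<le> p" "0 \<le> q"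
  shows "(\<Sum>k\<in>K. (cutoff h k x * p - cutoff h k y * q)\<^sup>2)
    \<le> (p - q)\<^sup>2 + p * q * (2 * ((\<Prod>e\<in>Basis. cosh (pi / (2 * h) * ((y - x) \<bullet> e))) - 1))"
proof -
  obtain N1 where N1: "\<And>n. n \<ge> N1 \<Longrightarrow> K \<subseteq> box_indices n" using subset_box_indices[OF K] by blast
  obtain N2 where N2: "\<And>n e. n \<ge> N2 \<Longrightarrow> e \<in> Basis \<Longrightarrow> \<bar>x \<bullet> e / h\<bar> < real n" using large_box[of x h] by blast
  obtain N3 where N3: "\<And>n e. n \<ge> N3 \<Longrightarrow> e \<in> Basis \<Longrightarrow> \<bar>y \<bullet> e / h\<bar> < real n" using large_box[of y h] by blast
  \<comment> \<open>All terms are nonnegative, so \<open>K\<close> may be enlarged to a box in which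
    the cutoffs are complete at both points.\<close>
  define n where "n = max N1 (max N2 N3)"
  have n: "K \<subseteq> box_indices n" "\<And>e. e \<in> Basis \<Longrightarrow> \<bar>x \<bullet> e / h\<bar> < real n" "\<And>e. e \<in> Basis \<Longrightarrow> \<bar>y \<bullet> e / h\<bar> < real n"
    using N1 N2 N3 by (auto simp: n_def)
  define c where "c e = (\<Sum>i\<in>{- int n..int n}. bump (x \<bullet> e / h - of_int i) * bump (y \<bullet> e / h - of_int i))" for e
  define C where "C e = cosh (pi / (2 * h) * ((y - x) \<bullet> e))" for e
  have c: "0 \<le> c e" "c e \<le> 1" "1 - c e \<le> C e - 1" if "e \<in> Basis" for e
  proof -
    have "pi * (x \<bullet> e / h - y \<bullet> e / h) / 2 = - (pi / (2 * h) * ((y - x) \<bullet> e))"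
      using h by (simp add: inner_diff_left field_simps)
    then have "cosh (pi * (x \<bullet> e / h - y \<bullet> e / h) / 2) = C e"
      unfolding C_def by (simp only: cosh_minus)
    then show "0 \<le> c e" "c e \<le> 1" "1 - c e \<le> C e - 1"
      using sum_bump_mult[OF n(2)[OF that] n(3)[OF that]] unfolding c_def by auto
  qed
  have "1 - (\<Prod>e\<in>Basis. c e) \<le> (\<Sum>e\<in>Basis. 1 - c e)" using prod_lower[of Basis c] c by force
  also have "\<dots> \<le> (\<Sum>e\<in>Basis. C e - 1)" by (intro sum_mono c)
  also have "\<dots> \<le> (\<Prod>e\<in>Basis. C e) - 1" using prod_upper[of Basis C] by (simp add: C_def cosh_real_ge_1)
  finally have c1: "1 - (\<Prod>e\<in>Basis. c e) \<le> (\<Prod>e\<in>Basis. C e) - 1" .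
  have "(\<Sum>k\<in>K. (cutoff h k x * p - cutoff h k y * q)\<^sup>2) \<le> (\<Sum>k\<in>box_indices n. (cutoff h k x * p - cutoff h k y * q)\<^sup>2)"
    by (intro sum_mono2 finite_box_indices n) auto
  also have "\<dots> = (\<Sum>k\<in>box_indices n. (cutoff h k x)\<^sup>2) * p\<^sup>2 + (\<Sum>k\<in>box_indices n. (cutoff h k y)\<^sup>2) * q\<^sup>2
      - 2 * (p * q) * (\<Sum>k\<in>box_indices n. cutoff h k x * cutoff h k y)"
    unfolding sum_distrib_right sum_distrib_left sum.distrib[symmetric] sum_subtractf[symmetric]
    by (intro sum.cong refl) (simp add: power2_eq_square algebra_simps)
  also have "\<dots> = p\<^sup>2 + q\<^sup>2 - 2 * (p * q) * (\<Prod>e\<in>Basis. c e)"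
    using sum_cutoff_square[OF n(2)] sum_cutoff_square[OF n(3)] by (simp add: sum_cutoff_mult c_def)
  also have "\<dots> = (p - q)\<^sup>2 + p * q * (2 * (1 - (\<Prod>e\<in>Basis. c e)))"
    by (simp add: power2_eq_square algebra_simps)
  also have "\<dots> \<le> (p - q)\<^sup>2 + p * q * (2 * ((\<Prod>e\<in>Basis. C e) - 1))"
    using c1 pq by (intro add_left_mono mult_left_mono) auto
  finally show ?thesis unfolding C_def .
qed

section \<open>Exponential weights\<close>

definition centre :: "real \<Rightarrow> ('a \<Rightarrow> int) \<Rightarrow> 'a::euclidean_space" where
  "centre h k = (\<Sum>e\<in>Basis. (h * of_int (k e)) *\<^sub>R e)"

lemma centre_inner: "e \<in> Basis \<Longrightarrow> centre h k \<bullet> e = h * of_int (k e)"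
  unfolding centre_def by (simp add: inner_sum_left inner_Basis if_distrib sum.delta cong: if_cong)

definition coshprod :: "real \<Rightarrow> 'a::euclidean_space \<Rightarrow> 'a \<Rightarrow> real" where
  "coshprod b p x = (\<Prod>e\<in>Basis. cosh (b * ((x - p) \<bullet> e)))"

lemma coshprod_pos: "0 < coshprod b p x"
  unfolding coshprod_def by (intro prod_pos) (simp add: cosh_real_pos)

lemma coshprod_ge_1: "1 \<le> coshprod b p x"
  unfolding coshprod_def by (intro prod_ge_1) (simp add: cosh_real_ge_1)

lemma inverse_coshprod_nonneg: "0 \<le> 1 / coshprod b p x"
  using coshprod_pos[of b p x] by simp

lemma coshprod_measurable [measurable]: "coshprod b p \<in> borel_measurable borel"
  unfolding coshprod_def[abs_def] by measurable

lemma coshprod_commute: "coshprod b x y = coshprod b y x"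
  unfolding coshprod_def
  by (intro prod.cong refl) (metis (no_types, opaque_lifting) cosh_minus inner_minus_left minus_diff_eq mult_minus_right)

lemma coshprod_measurable_pair [measurable]: "(\<lambda>(x, y). coshprod b x (y::'a::euclidean_space)) \<in> borel_measurable (borel \<Otimes>\<^sub>M borel)"
  unfolding coshprod_def by measurable

text \<open>The weight W of the overview raised by \<open>\<epsilon>\<close>, which bounds its
  reciprocal. With \<open>P\<close> the set of centres of low cells it is of order 1 near them and
  decays at rate \<open>b\<close> to \<open>\<epsilon>\<close> away from them.\<close>

definition weight :: "real \<Rightarrow> real \<Rightarrow> 'a set \<Rightarrow> 'a::euclidean_space \<Rightarrow> real" where
  "weight \<epsilon> b P x = \<epsilon> + (\<Sum>p\<in>P. 1 / coshprod b p x)"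

lemma weight_ge: "\<epsilon> \<le> weight \<epsilon> b P x"
  unfolding weight_def using sum_nonneg[of P, OF inverse_coshprod_nonneg] by simp

lemma weight_measurable [measurable]: "weight \<epsilon> b P \<in> borel_measurable borel"
  unfolding weight_def[abs_def] by measurable

text \<open>The square of the reverse triangle inequality for Euclidean norms of vectors with squared entries \<open>a\<close>, \<open>a'\<close>.\<close>

lemma sqrt_add_difference:
  assumes "0 \<le> p" "0 \<le> q" "0 \<le> a" "0 \<le> a'"
  shows "(sqrt (p + a) - sqrt (q + a'))\<^sup>2 \<le> (sqrt p - sqrt q)\<^sup>2 + (sqrt a - sqrt a')\<^sup>2"
proof -
  have "(sqrt p * sqrt q + sqrt a * sqrt a')\<^sup>2 \<le> (p + a) * (q + a')"
  proof -
    have "0 \<le> (sqrt p * sqrt a' - sqrt a * sqrt q)\<^sup>2" by simp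
    moreover have "(p + a) * (q + a') - (sqrt p * sqrt q + sqrt a * sqrt a')\<^sup>2 = (sqrt p * sqrt a' - sqrt a * sqrt q)\<^sup>2"
    proof -
      obtain P Q A A' where "p = P\<^sup>2" "q = Q\<^sup>2" "a = A\<^sup>2" "a' = A'\<^sup>2" "P \<ge> 0" "Q \<ge> 0" "A \<ge> 0" "A' \<ge> 0"
        using assms by (metis real_sqrt_ge_zero real_sqrt_pow2)
      then show ?thesis by (simp add: power2_eq_square algebra_simps)
    qed
    ultimately show ?thesis by linarith
  qed
  then have "sqrt p * sqrt q + sqrt a * sqrt a' \<le> sqrt ((p + a) * (q + a'))"
    using assms by (intro real_le_rsqrt)
  then show ?thesis using assms by (simp add: power2_diff real_sqrt_mult)
qed

text \<open>Iterating the reverse triangle inequality separates the centres, so each summand of the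
  weight can be treated alone.\<close>

lemma sqrt_weight_difference:
  assumes "\<epsilon> \<ge> 0"
  shows "(sqrt (weight \<epsilon> b P x) - sqrt (weight \<epsilon> b P y))\<^sup>2
    \<le> (\<Sum>p\<in>P. (sqrt (1 / coshprod b p x) - sqrt (1 / coshprod b p y))\<^sup>2)"
  unfolding weight_def
proof (induction P rule: infinite_finite_induct)
  case (insert p P)
  have nn: "0 \<le> \<epsilon> + (\<Sum>p\<in>P. 1 / coshprod b p x)" for x
    using assms by (intro add_nonneg_nonneg sum_nonneg inverse_coshprod_nonneg)
  have "(sqrt (\<epsilon> + (\<Sum>p\<in>insert p P. 1 / coshprod b p x)) - sqrt (\<epsilon> + (\<Sum>p\<in>insert p P. 1 / coshprod b p y)))\<^sup>2
     = (sqrt ((\<epsilon> + (\<Sum>p\<in>P. 1 / coshprod b p x)) + 1 / coshprod b p x) - sqrt ((\<epsilon> + (\<Sum>p\<in>P. 1 / coshprod b p y)) + 1 / coshprod b p y))\<^sup>2"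
    using insert by (simp add: algebra_simps)
  also have "\<dots> \<le> (sqrt (\<epsilon> + (\<Sum>p\<in>P. 1 / coshprod b p x)) - sqrt (\<epsilon> + (\<Sum>p\<in>P. 1 / coshprod b p y)))\<^sup>2
      + (sqrt (1 / coshprod b p x) - sqrt (1 / coshprod b p y))\<^sup>2"
    using coshprod_pos[of b p] by (intro sqrt_add_difference nn) (auto intro: less_imp_le)
  finally show ?case using insert by simp
qed auto

text \<open>The right-hand side is \<open>(a - a')\<^sup>2 / a'\<close>, which exceeds the left-hand
  side by the factor \<open>(sqrt a + sqrt a')\<^sup>2 / a'\<close>. Ratios, unlike square roots,
  have a controlled heat average.\<close>

lemma sqrt_difference_ratio:
  assumes "a > 0" "a' > 0"
  shows "(sqrt a - sqrt a')\<^sup>2 \<le> a * (a / a' + a' / a - 2)"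
proof -
  obtain u v where uv: "a = u\<^sup>2" "a' = v\<^sup>2" "u > 0" "v > 0"
    using assms by (metis real_sqrt_gt_zero real_sqrt_pow2 less_imp_le)
  have "u\<^sup>2 * (u\<^sup>2 / v\<^sup>2 + v\<^sup>2 / u\<^sup>2 - 2) = (u * (u / v) - v)\<^sup>2"
    using uv by (simp add: power2_eq_square field_simps)
  also have "u * (u / v) - v = (u - v) * ((u + v) / v)" using uv by (simp add: field_simps)
  also have "(\<dots>)\<^sup>2 = (u - v)\<^sup>2 * ((u + v) / v)\<^sup>2" by (simp only: power_mult_distrib)
  also have "\<dots> \<ge> (u - v)\<^sup>2 * 1"
    using uv by (intro mult_left_mono one_le_power) (auto simp: field_simps)
  finally show ?thesis using uv by simp
qed

lemma inverse_sqrt_weight_difference: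
  assumes "\<epsilon> > 0"
  shows "(1 / sqrt (weight \<epsilon> b P x) - 1 / sqrt (weight \<epsilon> b P y))\<^sup>2
    \<le> (\<Sum>p\<in>P. (sqrt (1 / coshprod b p x) - sqrt (1 / coshprod b p y))\<^sup>2) * (1 / weight \<epsilon> b P x * (1 / weight \<epsilon> b P y))"
proof -
  have w: "0 < weight \<epsilon> b P x" "0 < weight \<epsilon> b P y"
    using weight_ge[of \<epsilon> b P x] weight_ge[of \<epsilon> b P y] assms by linarith+
  have "(1 / sqrt (weight \<epsilon> b P x) - 1 / sqrt (weight \<epsilon> b P y))\<^sup>2
      = (sqrt (weight \<epsilon> b P x) - sqrt (weight \<epsilon> b P y))\<^sup>2 * (1 / weight \<epsilon> b P x * (1 / weight \<epsilon> b P y))"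
  proof -
    obtain u v where uv: "weight \<epsilon> b P x = u\<^sup>2" "weight \<epsilon> b P y = v\<^sup>2" "u > 0" "v > 0"
      using w by (metis real_sqrt_gt_zero real_sqrt_pow2 less_imp_le)
    then show ?thesis by (simp add: power2_eq_square field_simps)
  qed
  also have "\<dots> \<le> (\<Sum>p\<in>P. (sqrt (1 / coshprod b p x) - sqrt (1 / coshprod b p y))\<^sup>2) * (1 / weight \<epsilon> b P x * (1 / weight \<epsilon> b P y))"
    using w assms by (intro mult_right_mono sqrt_weight_difference) auto
  finally show ?thesis .
qed

section \<open>Heat averages of the variation of the weight\<close>

lemma nn_integral_heat_kernel_minus_const:
  fixes x :: "'a::euclidean_space"
  assumes s: "s > 0" and [measurable]: "f \<in> borel_measurable borel" and f: "\<And>y. 0 \<le> f y" and c: "0 \<le> c"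
    and le: "(\<integral>\<^sup>+y. ennreal (heat_kernel s (x - y) * (f y + c)) \<partial>lborel) \<le> ennreal M"
  shows "(\<integral>\<^sup>+y. ennreal (heat_kernel s (x - y) * f y) \<partial>lborel) \<le> ennreal (M - c)"
proof -
  have "(\<integral>\<^sup>+y. ennreal (heat_kernel s (x - y) * (f y + c)) \<partial>lborel)
     = (\<integral>\<^sup>+y. ennreal (heat_kernel s (x - y) * f y) + ennreal (heat_kernel s (x - y)) * ennreal c \<partial>lborel)"
    using c f by (intro nn_integral_cong) (simp add: distrib_left ennreal_plus heat_kernel_nonneg ennreal_mult)
  also have "\<dots> = (\<integral>\<^sup>+y. ennreal (heat_kernel s (x - y) * f y) \<partial>lborel) + ennreal c"
    by (subst nn_integral_add) (auto simp: nn_integral_multc nn_integral_heat_kernel[OF s])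
  finally have "(\<integral>\<^sup>+y. ennreal (heat_kernel s (x - y) * f y) \<partial>lborel) + ennreal c \<le> ennreal M" using le by simp
  then have "(\<integral>\<^sup>+y. ennreal (heat_kernel s (x - y) * f y) \<partial>lborel) \<le> ennreal M - ennreal c"
    by (simp add: ennreal_le_minus_iff)
  then show ?thesis using c by (simp add: ennreal_minus)
qed

text \<open>Heat averaging multiplies \<open>coshprod\<close>, and also its reciprocal, by at most
  \<open>exp (real DIM('a) * s * b\<^sup>2)\<close>. The mass of the kernel being 1, the constant 2
  can be subtracted, which leaves a quantity of order \<open>s\<close>.\<close>

lemma nn_integral_heat_kernel_ratio:
  fixes x p :: "'a::euclidean_space"
  assumes s: "s > 0"
  shows "(\<integral>\<^sup>+y. ennreal (heat_kernel s (x - y) * (coshprod b p y / coshprod b p x + coshprod b p x / coshprod b p y - 2)) \<partial>lborel)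
    \<le> ennreal (2 * (exp (real DIM('a) * s * b\<^sup>2) - 1))"
proof -
  let ?E = "exp (real DIM('a) * s * b\<^sup>2)" and ?C = "coshprod b p"
  have "(\<integral>\<^sup>+y. ennreal (heat_kernel s (x - y) * (?C y / ?C x + ?C x / ?C y - 2)) \<partial>lborel) \<le> ennreal (2 * ?E - 2)"
  proof (rule nn_integral_heat_kernel_minus_const[OF s])
    show "0 \<le> ?C y / ?C x + ?C x / ?C y - 2" for y
    proof -
      have "?C y / ?C x + ?C x / ?C y - 2 = (?C y - ?C x)\<^sup>2 / (?C x * ?C y)"
        using coshprod_pos[of b p x] coshprod_pos[of b p y] by (simp add: field_simps power2_eq_square)
      then show ?thesis using coshprod_pos[of b p x] coshprod_pos[of b p y] by simp
    qed
    have "(\<integral>\<^sup>+y. ennreal (heat_kernel s (x - y) * (?C y / ?C x + ?C x / ?C y - 2 + 2)) \<partial>lborel)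
      = (\<integral>\<^sup>+y. ennreal (1 / ?C x) * ennreal (heat_kernel s (x - y) * ?C y) + ennreal (?C x) * ennreal (heat_kernel s (x - y) * (1 / ?C y)) \<partial>lborel)"
    proof (rule nn_integral_cong)
      fix y
      have "heat_kernel s (x - y) * (?C y / ?C x + ?C x / ?C y - 2 + 2) = 1 / ?C x * (heat_kernel s (x - y) * ?C y) + ?C x * (heat_kernel s (x - y) * (1 / ?C y))"
        by (simp add: algebra_simps)
      then show "ennreal (heat_kernel s (x - y) * (?C y / ?C x + ?C x / ?C y - 2 + 2))
          = ennreal (1 / ?C x) * ennreal (heat_kernel s (x - y) * ?C y) + ennreal (?C x) * ennreal (heat_kernel s (x - y) * (1 / ?C y))"
        using coshprod_pos[of b p x] coshprod_pos[of b p y]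
        by (simp only: ennreal_mult[symmetric] ennreal_plus[symmetric] heat_kernel_nonneg mult_nonneg_nonneg less_imp_le inverse_coshprod_nonneg)
    qed
    also have "\<dots> = ennreal (1 / ?C x) * (\<integral>\<^sup>+y. ennreal (heat_kernel s (x - y) * ?C y) \<partial>lborel)
        + ennreal (?C x) * (\<integral>\<^sup>+y. ennreal (heat_kernel s (x - y) * (1 / ?C y)) \<partial>lborel)"
      by (subst nn_integral_add, simp, simp, subst nn_integral_cmult, simp, subst nn_integral_cmult, simp, simp)
    also have "\<dots> \<le> ennreal (1 / ?C x) * ennreal (?E * ?C x) + ennreal (?C x) * ennreal (?E * (1 / ?C x))"
      unfolding coshprod_def
      by (intro add_mono mult_left_mono eq_refl[OF nn_integral_heat_kernel_cosh[OF s]] nn_integral_heat_kernel_sech[OF s]) auto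
    also have "\<dots> = ennreal (2 * ?E)"
    proof -
      have "1 / ?C x * (?E * ?C x) + ?C x * (?E * (1 / ?C x)) = 2 * ?E" using coshprod_pos[of b p x] by simp
      moreover have "0 \<le> ?E * ?C x" "0 \<le> ?E * (1 / ?C x)" "0 \<le> ?C x" "0 \<le> 1 / ?C x" using coshprod_pos[of b p x] by (auto intro: less_imp_le)
      ultimately show ?thesis by (metis ennreal_mult ennreal_plus mult_nonneg_nonneg)
    qed
    finally show "(\<integral>\<^sup>+y. ennreal (heat_kernel s (x - y) * (?C y / ?C x + ?C x / ?C y - 2 + 2)) \<partial>lborel) \<le> ennreal (2 * ?E)" .
  qed auto
  then show ?thesis by (simp add: algebra_simps)
qed

lemma nn_integral_heat_kernel_weight_difference:
  fixes x :: "'a::euclidean_space"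
  assumes s: "s > 0"
  shows "(\<integral>\<^sup>+y. ennreal (heat_kernel s (x - y) * (\<Sum>p\<in>P. (sqrt (1 / coshprod b p x) - sqrt (1 / coshprod b p y))\<^sup>2)) \<partial>lborel)
    \<le> ennreal (2 * (exp (real DIM('a) * s * b\<^sup>2) - 1) * (\<Sum>p\<in>P. 1 / coshprod b p x))"
proof -
  let ?E = "exp (real DIM('a) * s * b\<^sup>2)"
  let ?r = "\<lambda>p y. coshprod b p y / coshprod b p x + coshprod b p x / coshprod b p y - 2"
  have E: "0 \<le> 2 * (?E - 1)" using s by simp
  have "(\<integral>\<^sup>+y. ennreal (heat_kernel s (x - y) * (\<Sum>p\<in>P. (sqrt (1 / coshprod b p x) - sqrt (1 / coshprod b p y))\<^sup>2)) \<partial>lborel)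
     = (\<integral>\<^sup>+y. (\<Sum>p\<in>P. ennreal (heat_kernel s (x - y) * (sqrt (1 / coshprod b p x) - sqrt (1 / coshprod b p y))\<^sup>2)) \<partial>lborel)"
    by (intro nn_integral_cong) (simp add: sum_distrib_left sum_ennreal heat_kernel_nonneg)
  also have "\<dots> = (\<Sum>p\<in>P. (\<integral>\<^sup>+y. ennreal (heat_kernel s (x - y) * (sqrt (1 / coshprod b p x) - sqrt (1 / coshprod b p y))\<^sup>2) \<partial>lborel))"
    by (rule nn_integral_sum) measurable
  also have "\<dots> \<le> (\<Sum>p\<in>P. ennreal (1 / coshprod b p x * (2 * (?E - 1))))"
  proof (rule sum_mono)
    fix p
    have "(\<integral>\<^sup>+y. ennreal (heat_kernel s (x - y) * (sqrt (1 / coshprod b p x) - sqrt (1 / coshprod b p y))\<^sup>2) \<partial>lborel)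
      \<le> (\<integral>\<^sup>+y. ennreal (1 / coshprod b p x) * ennreal (heat_kernel s (x - y) * ?r p y) \<partial>lborel)"
    proof (rule nn_integral_mono)
      fix y
      have "(sqrt (1 / coshprod b p x) - sqrt (1 / coshprod b p y))\<^sup>2 \<le> 1 / coshprod b p x * ?r p y"
        using sqrt_difference_ratio[of "1 / coshprod b p x" "1 / coshprod b p y"] coshprod_pos[of b p x] coshprod_pos[of b p y] by simp
      from mult_left_mono[OF this heat_kernel_nonneg]
      have "heat_kernel s (x - y) * (sqrt (1 / coshprod b p x) - sqrt (1 / coshprod b p y))\<^sup>2 \<le> 1 / coshprod b p x * (heat_kernel s (x - y) * ?r p y)"
        by (simp only: mult.left_commute)
      then show "ennreal (heat_kernel s (x - y) * (sqrt (1 / coshprod b p x) - sqrt (1 / coshprod b p y))\<^sup>2)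
          \<le> ennreal (1 / coshprod b p x) * ennreal (heat_kernel s (x - y) * ?r p y)"
        unfolding ennreal_mult'[OF inverse_coshprod_nonneg, symmetric] by (rule ennreal_leI)
    qed
    also have "\<dots> = ennreal (1 / coshprod b p x) * (\<integral>\<^sup>+y. ennreal (heat_kernel s (x - y) * ?r p y) \<partial>lborel)"
      by (rule nn_integral_cmult) measurable
    also have "\<dots> \<le> ennreal (1 / coshprod b p x) * ennreal (2 * (?E - 1))"
      by (intro mult_left_mono nn_integral_heat_kernel_ratio[OF s]) auto
    also have "\<dots> = ennreal (1 / coshprod b p x * (2 * (?E - 1)))" by (rule ennreal_mult'[OF inverse_coshprod_nonneg, symmetric])
    finally show "(\<integral>\<^sup>+y. ennreal (heat_kernel s (x - y) * (sqrt (1 / coshprod b p x) - sqrt (1 / coshprod b p y))\<^sup>2) \<partial>lborel)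
        \<le> ennreal (1 / coshprod b p x * (2 * (?E - 1)))" .
  qed
  also have "\<dots> = ennreal (\<Sum>p\<in>P. 1 / coshprod b p x * (2 * (?E - 1)))"
    by (rule sum_ennreal) (rule mult_nonneg_nonneg[OF inverse_coshprod_nonneg E])
  also have "(\<Sum>p\<in>P. 1 / coshprod b p x * (2 * (?E - 1))) = 2 * (?E - 1) * (\<Sum>p\<in>P. 1 / coshprod b p x)"
    by (simp only: sum_distrib_right mult.commute[of "2 * (?E - 1)"])
  finally show ?thesis .
qed

text \<open>\<open>M1\<close> is the error caused by the weight and \<open>M2\<close> the one caused
  by the partition of unity. They go with different amplitudes \<open>u1\<close> and
  \<open>u2\<close>: the average of \<open>M1\<close> is bounded by a multiple of
  \<open>w x\<close>, that of \<open>M2\<close> by a constant, and either way the Schur test ends in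
  the integral of \<open>(a x)\<^sup>2 / w x\<close>.\<close>

lemma heat_form_cutoff_weight:
  fixes a :: "'a::euclidean_space \<Rightarrow> real" and P :: "'a set" and b :: real
  assumes [measurable]: "a \<in> borel_measurable borel" and s: "s > 0" and h: "h > 0" and \<epsilon>: "\<epsilon> > 0"
    and K: "finite K" "K \<subseteq> PiE Basis (\<lambda>_. UNIV)"
  defines "w \<equiv> weight \<epsilon> b P"
  shows "heat_form s (\<lambda>x y. (\<Sum>k\<in>K. (cutoff h k x * (1 / sqrt (w x)) - cutoff h k y * (1 / sqrt (w y)))\<^sup>2) * (\<bar>a x\<bar> * \<bar>a y\<bar>))
    \<le> ennreal (2 * (exp (real DIM('a) * s * b\<^sup>2) - 1) + 2 * (exp (real DIM('a) * s * (pi / (2 * h))\<^sup>2) - 1))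
       * (\<integral>\<^sup>+x. ennreal ((a x)\<^sup>2 / w x) \<partial>lborel)"
proof -
  define \<beta> where "\<beta> = pi / (2 * h)"
  define E where "E = 2 * (exp (real DIM('a) * s * b\<^sup>2) - 1)"
  define E' where "E' = 2 * (exp (real DIM('a) * s * \<beta>\<^sup>2) - 1)"
  have E0: "0 \<le> E" "0 \<le> E'" using s by (auto simp: E_def E'_def)
  have [measurable]: "w \<in> borel_measurable borel" unfolding w_def by measurable
  have w: "0 < w x" for x using weight_ge[of \<epsilon> b P x] \<epsilon> unfolding w_def by linarith
  define M1 where "M1 x y = (\<Sum>p\<in>P. (sqrt (1 / coshprod b p x) - sqrt (1 / coshprod b p y))\<^sup>2)" for x y
  define M2 where "M2 x y = 2 * (coshprod \<beta> x y - 1)" for x y :: 'a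
  have m1[measurable]: "(\<lambda>(x, y). M1 x y) \<in> borel_measurable (borel \<Otimes>\<^sub>M borel)" unfolding M1_def by measurable
  have m2[measurable]: "(\<lambda>(x, y). M2 x y) \<in> borel_measurable (borel \<Otimes>\<^sub>M borel)" unfolding M2_def by measurable
  have M1: "0 \<le> M1 x y" "M1 x y = M1 y x" for x y by (auto simp: M1_def power2_commute intro!: sum_nonneg)
  have M2: "0 \<le> M2 x y" "M2 x y = M2 y x" for x y using coshprod_ge_1[of \<beta> x y] by (auto simp: M2_def coshprod_commute)
  define u1 where "u1 x = \<bar>a x\<bar> / w x" for x
  define u2 where "u2 x = \<bar>a x\<bar> / sqrt (w x)" for x
  have [measurable]: "u1 \<in> borel_measurable borel" "u2 \<in> borel_measurable borel" unfolding u1_def u2_def by measurable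
  have u0: "0 \<le> u1 x" "0 \<le> u2 x" for x using w[of x] by (auto simp: u1_def u2_def)
  have "heat_form s (\<lambda>x y. (\<Sum>k\<in>K. (cutoff h k x * (1 / sqrt (w x)) - cutoff h k y * (1 / sqrt (w y)))\<^sup>2) * (\<bar>a x\<bar> * \<bar>a y\<bar>))
      \<le> heat_form s (\<lambda>x y. M1 x y * (u1 x * u1 y) + M2 x y * (u2 x * u2 y))"
  proof (rule heat_form_mono)
    fix x y
    let ?p = "1 / sqrt (w x)" and ?q = "1 / sqrt (w y)"
    have "(\<Sum>k\<in>K. (cutoff h k x * ?p - cutoff h k y * ?q)\<^sup>2) \<le> (?p - ?q)\<^sup>2 + ?p * ?q * M2 x y"
      using sum_cutoff_difference[OF K h, of ?p ?q x y] w[of x] w[of y]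
      by (simp add: M2_def coshprod_def \<beta>_def less_imp_le)
    also have "(?p - ?q)\<^sup>2 \<le> M1 x y * (1 / w x * (1 / w y))"
      unfolding M1_def w_def by (rule inverse_sqrt_weight_difference[OF \<epsilon>])
    finally have "(\<Sum>k\<in>K. (cutoff h k x * ?p - cutoff h k y * ?q)\<^sup>2) * (\<bar>a x\<bar> * \<bar>a y\<bar>)
      \<le> (M1 x y * (1 / w x * (1 / w y)) + ?p * ?q * M2 x y) * (\<bar>a x\<bar> * \<bar>a y\<bar>)"
      by (intro mult_right_mono) auto
    also have "\<dots> = M1 x y * (u1 x * u1 y) + M2 x y * (u2 x * u2 y)"
      by (simp add: u1_def u2_def algebra_simps)
    finally show "(\<Sum>k\<in>K. (cutoff h k x * ?p - cutoff h k y * ?q)\<^sup>2) * (\<bar>a x\<bar> * \<bar>a y\<bar>)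
      \<le> M1 x y * (u1 x * u1 y) + M2 x y * (u2 x * u2 y)" .
  qed
  also have "\<dots> = heat_form s (\<lambda>x y. M1 x y * (u1 x * u1 y)) + heat_form s (\<lambda>x y. M2 x y * (u2 x * u2 y))"
    by (rule heat_form_add) (auto intro!: mult_nonneg_nonneg M1 M2 u0)
  also have "heat_form s (\<lambda>x y. M1 x y * (u1 x * u1 y))
      \<le> (\<integral>\<^sup>+x. (\<integral>\<^sup>+y. ennreal (heat_kernel s (x - y) * M1 x y) \<partial>lborel) * ennreal ((u1 x)\<^sup>2) \<partial>lborel)"
    by (rule heat_form_Schur[OF m1 _ M1]) simp
  also have "\<dots> \<le> (\<integral>\<^sup>+x. ennreal E * ennreal ((a x)\<^sup>2 / w x) \<partial>lborel)"
  proof (rule nn_integral_mono)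
    fix x
    have sw: "(\<Sum>p\<in>P. 1 / coshprod b p x) \<le> w x" using \<epsilon> by (simp add: w_def weight_def)
    have "(\<integral>\<^sup>+y. ennreal (heat_kernel s (x - y) * M1 x y) \<partial>lborel) * ennreal ((u1 x)\<^sup>2)
        \<le> ennreal (E * (\<Sum>p\<in>P. 1 / coshprod b p x)) * ennreal ((u1 x)\<^sup>2)"
      unfolding M1_def E_def by (intro mult_right_mono nn_integral_heat_kernel_weight_difference[OF s]) simp
    also have "\<dots> \<le> ennreal (E * w x) * ennreal ((u1 x)\<^sup>2)"
      by (intro mult_right_mono ennreal_leI mult_left_mono sw E0) auto
    also have "\<dots> = ennreal (E * w x * (u1 x)\<^sup>2)" by (rule ennreal_mult''[symmetric]) simp
    also have "E * w x * (u1 x)\<^sup>2 = E * ((a x)\<^sup>2 / w x)" using w[of x] by (simp add: u1_def power_divide power2_eq_square)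
    also have "ennreal \<dots> = ennreal E * ennreal ((a x)\<^sup>2 / w x)" by (rule ennreal_mult'[OF E0(1)])
    finally show "(\<integral>\<^sup>+y. ennreal (heat_kernel s (x - y) * M1 x y) \<partial>lborel) * ennreal ((u1 x)\<^sup>2) \<le> ennreal E * ennreal ((a x)\<^sup>2 / w x)" .
  qed
  also have "\<dots> = ennreal E * (\<integral>\<^sup>+x. ennreal ((a x)\<^sup>2 / w x) \<partial>lborel)" by (rule nn_integral_cmult) measurable
  also have "heat_form s (\<lambda>x y. M2 x y * (u2 x * u2 y))
      \<le> (\<integral>\<^sup>+x. (\<integral>\<^sup>+y. ennreal (heat_kernel s (x - y) * M2 x y) \<partial>lborel) * ennreal ((u2 x)\<^sup>2) \<partial>lborel)"
    by (rule heat_form_Schur[OF m2 _ M2]) simp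
  also have "\<dots> \<le> (\<integral>\<^sup>+x. ennreal E' * ennreal ((a x)\<^sup>2 / w x) \<partial>lborel)"
  proof (rule nn_integral_mono)
    fix x
    have "(\<integral>\<^sup>+y. ennreal (heat_kernel s (x - y) * M2 x y) \<partial>lborel) \<le> ennreal (2 * exp (real DIM('a) * s * \<beta>\<^sup>2) - 2)"
    proof (rule nn_integral_heat_kernel_minus_const[OF s])
      show "(\<lambda>y. M2 x y) \<in> borel_measurable borel" by measurable
      have "(\<integral>\<^sup>+y. ennreal (heat_kernel s (x - y) * (M2 x y + 2)) \<partial>lborel) = (\<integral>\<^sup>+y. ennreal 2 * ennreal (heat_kernel s (x - y) * coshprod \<beta> x y) \<partial>lborel)"
        by (intro nn_integral_cong, subst ennreal_mult'[symmetric]) (auto simp: M2_def algebra_simps)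
      also have "\<dots> = ennreal 2 * (\<integral>\<^sup>+y. ennreal (heat_kernel s (x - y) * coshprod \<beta> x y) \<partial>lborel)"
        by (rule nn_integral_cmult) measurable
      also have "\<dots> = ennreal 2 * ennreal (exp (real DIM('a) * s * \<beta>\<^sup>2))"
        unfolding coshprod_def by (subst nn_integral_heat_kernel_cosh[OF s]) simp
      also have "\<dots> = ennreal (2 * exp (real DIM('a) * s * \<beta>\<^sup>2))" by (rule ennreal_mult'[symmetric]) simp
      finally show "(\<integral>\<^sup>+y. ennreal (heat_kernel s (x - y) * (M2 x y + 2)) \<partial>lborel) \<le> ennreal (2 * exp (real DIM('a) * s * \<beta>\<^sup>2))" by simp
    qed (auto simp: M2)
    then have "(\<integral>\<^sup>+y. ennreal (heat_kernel s (x - y) * M2 x y) \<partial>lborel) \<le> ennreal E'" by (simp add: E'_def algebra_simps)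
    moreover have "(u2 x)\<^sup>2 = (a x)\<^sup>2 / w x" using w[of x] by (simp add: u2_def power_divide less_imp_le)
    ultimately show "(\<integral>\<^sup>+y. ennreal (heat_kernel s (x - y) * M2 x y) \<partial>lborel) * ennreal ((u2 x)\<^sup>2) \<le> ennreal E' * ennreal ((a x)\<^sup>2 / w x)"
      by (simp add: mult_right_mono)
  qed
  also have "\<dots> = ennreal E' * (\<integral>\<^sup>+x. ennreal ((a x)\<^sup>2 / w x) \<partial>lborel)" by (rule nn_integral_cmult) measurable
  finally have "heat_form s (\<lambda>x y. (\<Sum>k\<in>K. (cutoff h k x * (1 / sqrt (w x)) - cutoff h k y * (1 / sqrt (w y)))\<^sup>2) * (\<bar>a x\<bar> * \<bar>a y\<bar>))
    \<le> ennreal E * (\<integral>\<^sup>+x. ennreal ((a x)\<^sup>2 / w x) \<partial>lborel) + ennreal E' * (\<integral>\<^sup>+x. ennreal ((a x)\<^sup>2 / w x) \<partial>lborel)"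
    by (simp add: add_mono)
  also have "\<dots> = ennreal (E + E') * (\<integral>\<^sup>+x. ennreal ((a x)\<^sup>2 / w x) \<partial>lborel)"
    using E0 by (simp add: distrib_right)
  finally show ?thesis unfolding E_def E'_def \<beta>_def .
qed

section \<open>Localisation\<close>

lemma rfun_tendsto:
  assumes a: "\<And>n. sq_integrable (f n)" "sq_integrable g" "sq_integrable a" and le: "\<And>n x. \<bar>f n x - g x\<bar> \<le> C / real (Suc n) * \<bar>a x\<bar>" and C: "C \<ge> 0"
  shows "(\<lambda>n. rfun (f n)) \<longlonglongrightarrow> rfun g"
proof -
  have b: "norm (rfun (f n) - rfun g) \<le> C / real (Suc n) * norm (rfun a)" for n
  proof -
    have "(norm (rfun (f n) - rfun g))\<^sup>2 = (\<integral>x. (f n x - g x)\<^sup>2 \<partial>lborel)"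
      using rfun_diff[OF a(1) a(2)] norm_rfun[OF sq_integrable_diff[OF a(1) a(2)]] by simp
    also have "\<dots> \<le> (\<integral>x. (C / real (Suc n))\<^sup>2 * (a x)\<^sup>2 \<partial>lborel)"
    proof (rule integral_mono)
      show "integrable lborel (\<lambda>x. (f n x - g x)\<^sup>2)" using sq_integrable_diff[OF a(1) a(2)] by (simp add: sq_integrable_def)
      show "integrable lborel (\<lambda>x. (C / real (Suc n))\<^sup>2 * (a x)\<^sup>2)" using a(3) by (simp add: sq_integrable_def)
      show "(f n x - g x)\<^sup>2 \<le> (C / real (Suc n))\<^sup>2 * (a x)\<^sup>2" for x
      proof -
        have "\<bar>f n x - g x\<bar>\<^sup>2 \<le> (C / real (Suc n) * \<bar>a x\<bar>)\<^sup>2" by (intro power_mono le) simp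
        then show ?thesis by (simp only: power_mult_distrib power2_abs)
      qed
    qed
    also have "\<dots> = (C / real (Suc n))\<^sup>2 * (\<integral>x. (a x)\<^sup>2 \<partial>lborel)" by simp
    also have "\<dots> = (C / real (Suc n) * norm (rfun a))\<^sup>2" by (simp only: norm_rfun[OF a(3)] power_mult_distrib)
    finally show ?thesis by (rule power2_le_imp_le) (use C in simp)
  qed
  have "(\<lambda>n. C / real (Suc n) * norm (rfun a)) \<longlonglongrightarrow> 0"
    by (intro tendsto_mult_left_zero LIMSEQ_Suc[OF lim_const_over_n])
  then have "(\<lambda>n. rfun (f n) - rfun g) \<longlonglongrightarrow> 0"
    by (rule Lim_null_comparison[rotated]) (use b in auto)
  then show ?thesis by (simp add: Lim_null[symmetric])
qed

section \<open>Commutators with multiplication operators\<close>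

context dominated_semigroup
begin

text \<open>If \<open>S s\<close> has an integral kernel \<open>K\<close>, this is half of the double integral of
  \<open>K(x, y) (\<theta>(x) - \<theta>(y))\<^sup>2 a(x) a(y)\<close>.\<close>

definition commutator_form :: "real \<Rightarrow> ('a \<Rightarrow> real) \<Rightarrow> ('a \<Rightarrow> real) \<Rightarrow> real" where
  "commutator_form s \<theta> a = inner (S s (rfun a)) (rfun (\<lambda>x. (\<theta> x)\<^sup>2 * a x)) - inner (S s (rfun (\<lambda>x. \<theta> x * a x))) (rfun (\<lambda>x. \<theta> x * a x))"

text \<open>For finitely many values, cutting \<open>a\<close> along the level sets of
  \<open>\<theta>\<close> gives a symmetric matrix \<open>B\<close> in place of a kernel.
  Symmetrising turns the commutator into half the sum of \<open>(c - d)\<^sup>2 * B c d\<close>,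
  whose entries are dominated one by one.\<close>

lemma commutator_form_simple:
  assumes a: "sq_integrable a" "rfun a \<in> X" and \<theta>[measurable]: "\<theta> \<in> borel_measurable borel" and fin: "finite (range \<theta>)" and s: "s > 0"
  shows "ennreal (commutator_form s \<theta> a) \<le> ennreal (1/2) * heat_form s (\<lambda>x y. (\<theta> x - \<theta> y)\<^sup>2 * (\<bar>a x\<bar> * \<bar>a y\<bar>))"
proof -
  have [measurable]: "a \<in> borel_measurable borel" using a by (auto simp: sq_integrable_def)
  define R where "R = range \<theta>"
  define ac where "ac c x = (if \<theta> x = c then a x else 0)" for c x
  have acm[measurable]: "ac c \<in> borel_measurable borel" for c unfolding ac_def by measurable
  have ac: "sq_integrable (ac c)" for c by (rule sq_integrable_bound[OF a(1), of _ 1]) (auto simp: ac_def)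
  have acX: "rfun (ac c) \<in> X" for c by (rule rfun_in_L2_on_mono[OF a(2,1) ac]) (simp add: ac_def)
  interpret l: bounded_linear "S s" using S_bl s by simp
  have dec: "rfun (\<lambda>x. F (\<theta> x) * a x) = (\<Sum>c\<in>R. F c *\<^sub>R rfun (ac c))" for F
  proof -
    have "(\<Sum>c\<in>R. F c *\<^sub>R rfun (ac c)) = rfun (\<lambda>x. \<Sum>c\<in>R. F c * ac c x)"
      using rfun_sum[of R "\<lambda>c x. F c * ac c x"] ac by (simp add: rfun_scale sq_integrable_scale)
    also have "(\<lambda>x. \<Sum>c\<in>R. F c * ac c x) = (\<lambda>x. F (\<theta> x) * a x)"
    proof
      fix x
      have "(\<Sum>c\<in>R. F c * ac c x) = (\<Sum>c\<in>R. if \<theta> x = c then F c * a x else 0)" by (intro sum.cong) (auto simp: ac_def)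
      then show "(\<Sum>c\<in>R. F c * ac c x) = F (\<theta> x) * a x" using fin by (simp add: sum.delta R_def)
    qed
    finally show ?thesis by simp
  qed
  define B where "B c d = inner (S s (rfun (ac c))) (rfun (ac d))" for c d
  have Bsym: "B c d = B d c" for c d
    using S_sym[of s "rfun (ac c)" "rfun (ac d)"] s acX by (simp add: B_def inner_commute)
  have e1: "inner (S s (rfun a)) (rfun (\<lambda>x. (\<theta> x)\<^sup>2 * a x)) = (\<Sum>c\<in>R. \<Sum>d\<in>R. d\<^sup>2 * B c d)"
  proof -
    have d: "rfun a = (\<Sum>c\<in>R. rfun (ac c))" using dec[of "\<lambda>_. 1"] by simp
    show ?thesis
      unfolding dec[of "\<lambda>c. c\<^sup>2"] d l.sum inner_sum_left
      by (simp only: inner_sum_right inner_scaleR_right B_def)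
  qed
  have e2: "inner (S s (rfun (\<lambda>x. \<theta> x * a x))) (rfun (\<lambda>x. \<theta> x * a x)) = (\<Sum>c\<in>R. \<Sum>d\<in>R. c * d * B c d)"
    unfolding dec[of "\<lambda>c. c"] l.sum inner_sum_left
    by (simp only: inner_sum_right l.scaleR inner_scaleR_left inner_scaleR_right B_def mult.assoc mult.left_commute)
  have e3: "(\<Sum>c\<in>R. \<Sum>d\<in>R. d\<^sup>2 * B c d) = (\<Sum>c\<in>R. \<Sum>d\<in>R. c\<^sup>2 * B c d)"
    by (subst sum.swap) (simp add: Bsym)
  have "2 * commutator_form s \<theta> a = (\<Sum>c\<in>R. \<Sum>d\<in>R. d\<^sup>2 * B c d) + (\<Sum>c\<in>R. \<Sum>d\<in>R. c\<^sup>2 * B c d) - 2 * (\<Sum>c\<in>R. \<Sum>d\<in>R. c * d * B c d)"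
    unfolding commutator_form_def e1 e2 using e3 by simp
  also have "\<dots> = (\<Sum>c\<in>R. \<Sum>d\<in>R. (c - d)\<^sup>2 * B c d)"
    unfolding sum_distrib_left sum.distrib[symmetric] sum_subtractf[symmetric]
    by (intro sum.cong refl) (simp add: power2_diff algebra_simps)
  also have "\<dots> \<le> (\<Sum>c\<in>R. \<Sum>d\<in>R. (c - d)\<^sup>2 * \<bar>B c d\<bar>)"
    by (intro sum_mono mult_left_mono) auto
  finally have "commutator_form s \<theta> a \<le> 1/2 * (\<Sum>c\<in>R. \<Sum>d\<in>R. (c - d)\<^sup>2 * \<bar>B c d\<bar>)" by simp
  then have "ennreal (commutator_form s \<theta> a) \<le> ennreal (1/2 * (\<Sum>c\<in>R. \<Sum>d\<in>R. (c - d)\<^sup>2 * \<bar>B c d\<bar>))" by (rule ennreal_leI)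
  also have "\<dots> = ennreal (1/2) * ennreal (\<Sum>c\<in>R. \<Sum>d\<in>R. (c - d)\<^sup>2 * \<bar>B c d\<bar>)"
    by (rule ennreal_mult') simp
  also have "ennreal (\<Sum>c\<in>R. \<Sum>d\<in>R. (c - d)\<^sup>2 * \<bar>B c d\<bar>) = (\<Sum>c\<in>R. \<Sum>d\<in>R. ennreal ((c - d)\<^sup>2) * ennreal \<bar>B c d\<bar>)"
    by (simp add: sum_ennreal[symmetric] sum_nonneg ennreal_mult)
  also have "\<dots> \<le> (\<Sum>c\<in>R. \<Sum>d\<in>R. ennreal ((c - d)\<^sup>2) * heat_form s (\<lambda>x y. \<bar>ac d x\<bar> * \<bar>ac c y\<bar>))"
    unfolding B_def by (intro sum_mono mult_left_mono form_abs_le ac acX s) simp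
  also have "\<dots> = (\<Sum>c\<in>R. \<Sum>d\<in>R. heat_form s (\<lambda>x y. (c - d)\<^sup>2 * (\<bar>ac d x\<bar> * \<bar>ac c y\<bar>)))"
    by (intro sum.cong refl heat_form_cmult[symmetric]) auto
  also have "\<dots> = (\<Sum>c\<in>R. heat_form s (\<lambda>x y. \<Sum>d\<in>R. (c - d)\<^sup>2 * (\<bar>ac d x\<bar> * \<bar>ac c y\<bar>)))"
    by (intro sum.cong refl heat_form_sum[symmetric]) auto
  also have "\<dots> = heat_form s (\<lambda>x y. \<Sum>c\<in>R. \<Sum>d\<in>R. (c - d)\<^sup>2 * (\<bar>ac d x\<bar> * \<bar>ac c y\<bar>))"
    by (rule heat_form_sum[symmetric]) (auto intro!: sum_nonneg simp: split_beta')
  also have "(\<lambda>x y. \<Sum>c\<in>R. \<Sum>d\<in>R. (c - d)\<^sup>2 * (\<bar>ac d x\<bar> * \<bar>ac c y\<bar>)) = (\<lambda>x y. (\<theta> x - \<theta> y)\<^sup>2 * (\<bar>a x\<bar> * \<bar>a y\<bar>))"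
  proof (intro ext)
    fix x y
    have "(\<Sum>c\<in>R. \<Sum>d\<in>R. (c - d)\<^sup>2 * (\<bar>ac d x\<bar> * \<bar>ac c y\<bar>))
       = (\<Sum>c\<in>R. if \<theta> y = c then (\<Sum>d\<in>R. if \<theta> x = d then (c - d)\<^sup>2 * (\<bar>a x\<bar> * \<bar>a y\<bar>) else 0) else 0)"
      by (auto intro!: sum.cong sum.neutral simp: ac_def)
    also have "\<dots> = (\<theta> y - \<theta> x)\<^sup>2 * (\<bar>a x\<bar> * \<bar>a y\<bar>)" using fin by (simp add: sum.delta R_def)
    finally show "(\<Sum>c\<in>R. \<Sum>d\<in>R. (c - d)\<^sup>2 * (\<bar>ac d x\<bar> * \<bar>ac c y\<bar>)) = (\<theta> x - \<theta> y)\<^sup>2 * (\<bar>a x\<bar> * \<bar>a y\<bar>)"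
      by (simp add: power2_commute)
  qed
  finally show ?thesis by (simp add: mult_left_mono)
qed

text \<open>Rounding \<open>\<theta>\<close> down to multiples of \<open>1 / real (Suc n)\<close>
  gives functions of finite range that converge uniformly.\<close>

lemma commutator_form_le:
  assumes a: "sq_integrable a" "rfun a \<in> X" and \<theta>[measurable]: "\<theta> \<in> borel_measurable borel" and M: "\<And>x. \<bar>\<theta> x\<bar> \<le> M" and s: "s > 0"
  shows "ennreal (commutator_form s \<theta> a) \<le> ennreal (1/2) * heat_form s (\<lambda>x y. (\<theta> x - \<theta> y)\<^sup>2 * (\<bar>a x\<bar> * \<bar>a y\<bar>))"
proof -
  have [measurable]: "a \<in> borel_measurable borel" using a by (auto simp: sq_integrable_def)
  have M0: "0 \<le> M" using M[of undefined] by linarith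
  define \<theta>n where "\<theta>n n x = of_int \<lfloor>real (Suc n) * \<theta> x\<rfloor> / real (Suc n)" for n x
  have m[measurable]: "\<theta>n n \<in> borel_measurable borel" for n unfolding \<theta>n_def by measurable
  have d: "\<bar>\<theta>n n x - \<theta> x\<bar> \<le> 1 / real (Suc n)" for n x
  proof -
    have "\<theta>n n x - \<theta> x = (of_int \<lfloor>real (Suc n) * \<theta> x\<rfloor> - real (Suc n) * \<theta> x) / real (Suc n)"
      by (simp add: \<theta>n_def diff_divide_distrib del: of_nat_Suc)
    moreover have "\<bar>of_int \<lfloor>real (Suc n) * \<theta> x\<rfloor> - real (Suc n) * \<theta> x\<bar> \<le> 1" by linarith
    ultimately show ?thesis by (simp add: abs_divide divide_right_mono del: of_nat_Suc)
  qed
  have n1: "1 / real (Suc n) \<le> 1" for n by simp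
  have bn: "\<bar>\<theta>n n x\<bar> \<le> M + 1" for n x using d[of n x] M[of x] n1[of n] by linarith
  have fin: "finite (range (\<theta>n n))" for n
  proof -
    have "\<bar>real (Suc n) * \<theta> x\<bar> \<le> real (Suc n) * M" for x unfolding abs_mult by (intro mult_mono M) auto
    then have "\<lfloor>real (Suc n) * \<theta> x\<rfloor> \<in> {\<lfloor>- (real (Suc n) * M)\<rfloor>..\<lfloor>real (Suc n) * M\<rfloor>}" for x
      by (auto intro!: floor_mono simp: abs_le_iff minus_le_iff)
    then have "range (\<theta>n n) \<subseteq> (\<lambda>i. of_int i / real (Suc n)) ` {\<lfloor>- (real (Suc n) * M)\<rfloor>..\<lfloor>real (Suc n) * M\<rfloor>}"
      unfolding \<theta>n_def by blast
    then show ?thesis by (rule finite_subset) simp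
  qed
  interpret l: bounded_linear "S s" using S_bl s by simp
  have sq1: "sq_integrable (\<lambda>x. \<theta> x * a x)" by (rule sq_integrable_mult_bounded[OF a(1) _ M]) simp
  have sq1n: "sq_integrable (\<lambda>x. \<theta>n n x * a x)" for n by (rule sq_integrable_mult_bounded[OF a(1) _ bn]) simp
  have M2: "\<bar>(\<theta> x)\<^sup>2\<bar> \<le> M\<^sup>2" for x using power_mono[OF M[of x], of 2] by simp
  have bn2: "\<bar>(\<theta>n n x)\<^sup>2\<bar> \<le> (M + 1)\<^sup>2" for n x using power_mono[OF bn[of n x], of 2] by simp
  have sq2: "sq_integrable (\<lambda>x. (\<theta> x)\<^sup>2 * a x)" by (rule sq_integrable_mult_bounded[OF a(1) _ M2]) simp
  have sq2n: "sq_integrable (\<lambda>x. (\<theta>n n x)\<^sup>2 * a x)" for n by (rule sq_integrable_mult_bounded[OF a(1) _ bn2]) simp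
  have t1: "(\<lambda>n. rfun (\<lambda>x. \<theta>n n x * a x)) \<longlonglongrightarrow> rfun (\<lambda>x. \<theta> x * a x)"
  proof (rule rfun_tendsto[OF sq1n sq1 a(1), where C = 1])
    fix n x
    show "\<bar>\<theta>n n x * a x - \<theta> x * a x\<bar> \<le> 1 / real (Suc n) * \<bar>a x\<bar>"
      unfolding left_diff_distrib[symmetric] abs_mult by (intro mult_right_mono d) simp
  qed simp
  have t2: "(\<lambda>n. rfun (\<lambda>x. (\<theta>n n x)\<^sup>2 * a x)) \<longlonglongrightarrow> rfun (\<lambda>x. (\<theta> x)\<^sup>2 * a x)"
  proof (rule rfun_tendsto[OF sq2n sq2 a(1), where C = "2 * M + 1"])
    fix n x
    have "\<bar>(\<theta>n n x)\<^sup>2 - (\<theta> x)\<^sup>2\<bar> = \<bar>\<theta>n n x - \<theta> x\<bar> * \<bar>\<theta>n n x + \<theta> x\<bar>"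
      by (simp add: abs_mult[symmetric] power2_eq_square algebra_simps)
    also have "\<dots> \<le> 1 / real (Suc n) * (2 * M + 1)"
      using bn[of n x] M[of x] by (intro mult_mono d) auto
    finally show "\<bar>(\<theta>n n x)\<^sup>2 * a x - (\<theta> x)\<^sup>2 * a x\<bar> \<le> (2 * M + 1) / real (Suc n) * \<bar>a x\<bar>"
      unfolding left_diff_distrib[symmetric] abs_mult by (intro mult_right_mono) auto
  qed (use M0 in simp)
  have tl: "(\<lambda>n. ennreal (commutator_form s (\<theta>n n) a)) \<longlonglongrightarrow> ennreal (commutator_form s \<theta> a)"
    unfolding commutator_form_def by (intro tendsto_ennrealI tendsto_intros t1 t2 l.tendsto)
  define k where "k = heat_form s (\<lambda>x y. (\<theta> x - \<theta> y)\<^sup>2 * (\<bar>a x\<bar> * \<bar>a y\<bar>))"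
  \<comment> \<open>Rounding raises \<open>(\<theta> x - \<theta> y)\<^sup>2\<close> by at most
    \<open>(8 * M + 4) / real (Suc n)\<close>; the other factor bounds the heat form of the moduli
    of \<open>a\<close>.\<close>
  define D where "D = (8 * M + 4) * (norm (rfun a))\<^sup>2"
  have le: "ennreal (commutator_form s (\<theta>n n) a) \<le> ennreal (1/2) * (k + ennreal (D / real (Suc n)))" for n
  proof -
    have "heat_form s (\<lambda>x y. (\<theta>n n x - \<theta>n n y)\<^sup>2 * (\<bar>a x\<bar> * \<bar>a y\<bar>))
       \<le> heat_form s (\<lambda>x y. (\<theta> x - \<theta> y)\<^sup>2 * (\<bar>a x\<bar> * \<bar>a y\<bar>) + (8 * M + 4) / real (Suc n) * (\<bar>a x\<bar> * \<bar>a y\<bar>))"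
    proof (rule heat_form_mono)
      fix x y
      define u e where "u = \<theta> x - \<theta> y" and "e = (\<theta>n n x - \<theta> x) - (\<theta>n n y - \<theta> y)"
      have u: "\<bar>u\<bar> \<le> 2 * M" using M[of x] M[of y] by (simp add: u_def)
      have e: "\<bar>e\<bar> \<le> 2 / real (Suc n)" using d[of n x] d[of n y] by (simp add: e_def)
      moreover have "2 / real (Suc n) \<le> 2" by (simp add: field_simps)
      ultimately have e2: "\<bar>e\<bar> \<le> 2" by linarith
      have "(\<theta>n n x - \<theta>n n y)\<^sup>2 = u\<^sup>2 + e * (2 * u + e)"
        by (simp add: u_def e_def power2_eq_square algebra_simps)
      also have "e * (2 * u + e) \<le> \<bar>e\<bar> * \<bar>2 * u + e\<bar>" by (simp add: abs_mult[symmetric])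
      also have "\<dots> \<le> 2 / real (Suc n) * (2 * (2 * M) + 2)" using u e2 by (intro mult_mono e) auto
      finally have "(\<theta>n n x - \<theta>n n y)\<^sup>2 \<le> (\<theta> x - \<theta> y)\<^sup>2 + (8 * M + 4) / real (Suc n)"
        by (simp add: u_def field_simps)
      from mult_right_mono[OF this, of "\<bar>a x\<bar> * \<bar>a y\<bar>"]
      show "(\<theta>n n x - \<theta>n n y)\<^sup>2 * (\<bar>a x\<bar> * \<bar>a y\<bar>)
        \<le> (\<theta> x - \<theta> y)\<^sup>2 * (\<bar>a x\<bar> * \<bar>a y\<bar>) + (8 * M + 4) / real (Suc n) * (\<bar>a x\<bar> * \<bar>a y\<bar>)"
        by (simp only: distrib_right) simp
    qed
    also have "\<dots> = k + heat_form s (\<lambda>x y. (8 * M + 4) / real (Suc n) * (\<bar>a x\<bar> * \<bar>a y\<bar>))"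
      unfolding k_def using M0 by (intro heat_form_add) (auto intro!: mult_nonneg_nonneg divide_nonneg_nonneg)
    also have "heat_form s (\<lambda>x y. (8 * M + 4) / real (Suc n) * (\<bar>a x\<bar> * \<bar>a y\<bar>)) = ennreal ((8 * M + 4) / real (Suc n)) * heat_form s (\<lambda>x y. \<bar>a x\<bar> * \<bar>a y\<bar>)"
      using M0 by (intro heat_form_cmult) auto
    also have "\<dots> \<le> ennreal ((8 * M + 4) / real (Suc n)) * ennreal ((norm (rfun a))\<^sup>2)"
      by (intro mult_left_mono heat_form_le_norm[OF a(1) s]) simp
    also have "\<dots> = ennreal (D / real (Suc n))"
      unfolding D_def by (subst ennreal_mult''[symmetric]) (auto simp: field_simps)
    finally show ?thesis
      using commutator_form_simple[OF a m fin s, of n] by (meson add_left_mono mult_left_mono order.trans zero_le)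
  qed
  have tr: "(\<lambda>n. ennreal (1/2) * (k + ennreal (D / real (Suc n)))) \<longlonglongrightarrow> ennreal (1/2) * (k + ennreal 0)"
    by (rule ennreal_tendsto_cmult[OF ennreal_less_top])
       (intro tendsto_add tendsto_const tendsto_ennrealI LIMSEQ_Suc[OF lim_const_over_n])
  show ?thesis using LIMSEQ_le[OF tl tr] le by (auto simp: k_def)
qed

end

lemma exp_quotient_tendsto: "(\<lambda>n. (exp (c * (1/2) ^ n) - 1) * 2 ^ n) \<longlonglongrightarrow> (c::real)"
proof -
  have "((\<lambda>x. exp (c * x)) has_real_derivative c) (at 0)"
    by (auto intro!: derivative_eq_intros)
  then have 1: "((\<lambda>x. (exp (c * x) - 1) / x) \<longlongrightarrow> c) (at 0)" by (simp add: has_field_derivative_iff)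
  have "filterlim (\<lambda>n. (1/2::real) ^ n) (at 0) sequentially"
  proof (rule filterlim_atI)
    show "(\<lambda>n. (1/2::real) ^ n) \<longlonglongrightarrow> 0" by (rule LIMSEQ_power_zero) simp
    show "\<forall>\<^sub>F n in sequentially. (1/2::real) ^ n \<noteq> 0" by (rule always_eventually) simp
  qed
  from filterlim_compose[OF 1 this]
  have "(\<lambda>n. (exp (c * (1/2) ^ n) - 1) / (1/2) ^ n) \<longlonglongrightarrow> c" .
  moreover have "y / (1/2) ^ n = y * 2 ^ n" for y :: real and n by (simp add: power_divide)
  ultimately show ?thesis by (simp only:)
qed

lemma sum_cutoff_le_1:
  fixes x :: "'a::euclidean_space"
  assumes K: "finite K" "K \<subseteq> PiE Basis (\<lambda>_. UNIV)"
  shows "(\<Sum>k\<in>K. (cutoff h k x)\<^sup>2) \<le> 1"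
proof -
  obtain N1 where N1: "\<And>n. n \<ge> N1 \<Longrightarrow> K \<subseteq> box_indices n" using subset_box_indices[OF K] by blast
  obtain N2 where N2: "\<And>n e. n \<ge> N2 \<Longrightarrow> e \<in> Basis \<Longrightarrow> \<bar>x \<bullet> e / h\<bar> < real n" using large_box[of x h] by blast
  define n where "n = max N1 N2"
  have "(\<Sum>k\<in>K. (cutoff h k x)\<^sup>2) \<le> (\<Sum>k\<in>box_indices n. (cutoff h k x)\<^sup>2)"
    using N1[of n] by (intro sum_mono2 finite_box_indices) (auto simp: n_def)
  also have "\<dots> = 1" using N2[of n] by (intro sum_cutoff_square) (auto simp: n_def)
  finally show ?thesis .
qed

text \<open>Keeps the weight at least \<open>1 / cosh (b * h) ^ DIM('a)\<close> on each cell whose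
  centre contributes to it.\<close>

lemma coshprod_cell:
  assumes "x \<in> cell h k" "h > 0" "b > 0"
  shows "coshprod b (centre h k) (x::'a::euclidean_space) \<le> cosh (b * h) ^ DIM('a)"
proof -
  have "cosh (b * ((x - centre h k) \<bullet> e)) \<le> cosh (b * h)" if e: "e \<in> Basis" for e
  proof -
    have "\<bar>x \<bullet> e / h - of_int (k e)\<bar> < 1" using assms(1) e by (auto simp: cell_def)
    then have "\<bar>(x - centre h k) \<bullet> e\<bar> \<le> h"
    proof -
      have "(x - centre h k) \<bullet> e = h * (x \<bullet> e / h - of_int (k e))"
        using assms e by (simp add: inner_diff_left centre_inner algebra_simps)
      then have "\<bar>(x - centre h k) \<bullet> e\<bar> = h * \<bar>x \<bullet> e / h - of_int (k e)\<bar>" using assms by (simp add: abs_mult)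
      also have "\<dots> \<le> h * 1" using \<open>\<bar>x \<bullet> e / h - of_int (k e)\<bar> < 1\<close> assms by (intro mult_left_mono) auto
      finally show ?thesis by simp
    qed
    then have "\<bar>b * ((x - centre h k) \<bullet> e)\<bar> \<le> b * h" using assms by (simp add: abs_mult)
    then have "cosh \<bar>b * ((x - centre h k) \<bullet> e)\<bar> \<le> cosh (b * h)" by (subst cosh_real_nonneg_le_iff) auto
    then show ?thesis by (simp add: cosh_real_abs)
  qed
  then have "coshprod b (centre h k) x \<le> (\<Prod>e\<in>(Basis::'a set). cosh (b * h))"
    unfolding coshprod_def by (intro prod_mono) (auto simp: cosh_real_nonneg)
  then show ?thesis by simp
qed

text \<open>The summands may be negative: commutator forms have no definite sign, and
  \<open>ennreal\<close> cuts negative values off.\<close>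

lemma ennreal_sum_le: "ennreal (\<Sum>k\<in>K. f k) \<le> (\<Sum>k\<in>K. ennreal (f k))"
proof (induction K rule: infinite_finite_induct)
  case (insert k K)
  have "ennreal (f k + (\<Sum>k\<in>K. f k)) \<le> ennreal (max 0 (f k) + max 0 (\<Sum>k\<in>K. f k))" by (intro ennreal_leI) auto
  also have "\<dots> = ennreal (f k) + ennreal (\<Sum>k\<in>K. f k)" by (simp add: ennreal_plus max_def ennreal_neg)
  finally show ?case using insert by (simp add: add_left_mono order.trans)
qed auto

section \<open>Energy of localised eigenfunctions\<close>

context dominated_semigroup
begin

text \<open>Increases with \<open>n\<close>; its supremum, possibly infinite, is the quadratic form
  of the negative generator.\<close>

definition form_quotient :: "nat \<Rightarrow> 'a L2 \<Rightarrow> real" where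
  "form_quotient n v = ((norm v)\<^sup>2 - inner (S ((1/2) ^ n) v) v) * 2 ^ n"

text \<open>Expanding the squared norm of \<open>S (s / 2) v - v\<close> compares the times
  \<open>s\<close> and \<open>s / 2\<close>, so dyadic times turn monotonicity into a single halving
  step.\<close>

lemma form_quotient_mono:
  assumes v: "v \<in> X" and "m \<le> n" shows "form_quotient m v \<le> form_quotient n v"
proof -
  have "form_quotient n v \<le> form_quotient (Suc n) v" for n
  proof -
    let ?s = "(1/2::real) ^ n"
    have "0 \<le> (norm (S (?s / 2) v - v))\<^sup>2" by simp
    also have "\<dots> = inner (S ?s v) v - 2 * inner (S (?s / 2) v) v + (norm v)\<^sup>2"
      using sg.half[of ?s v] v by (simp add: power2_norm_eq_inner inner_diff inner_commute)
    finally have "(norm v)\<^sup>2 - inner (S ?s v) v \<le> 2 * ((norm v)\<^sup>2 - inner (S (?s / 2) v) v)" by simp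
    from mult_right_mono[OF this, of "2 ^ n"] show ?thesis by (simp add: form_quotient_def algebra_simps)
  qed
  then show ?thesis using assms(2) by (rule lift_Suc_mono_le)
qed

definition test_fun :: "real \<Rightarrow> ('a \<Rightarrow> int) \<Rightarrow> ('a \<Rightarrow> real) \<Rightarrow> bool" where
  "test_fun h k a \<longleftrightarrow> sq_integrable a \<and> rfun a \<in> X \<and> (\<forall>x. x \<notin> cell h k \<longrightarrow> a x = 0)"

text \<open>The Rayleigh quotient of some function in the cell is below \<open>t\<close>. The
  constant \<open>c\<close> makes the strict inequality uniform in \<open>n\<close>, so the form
  domain need not be named.\<close>

definition low_energy :: "real \<Rightarrow> real \<Rightarrow> ('a \<Rightarrow> int) \<Rightarrow> bool" where
  "low_energy h t k \<longleftrightarrow> (\<exists>a c. test_fun h k a \<and> rfun a \<noteq> 0 \<and> c < t \<and> (\<forall>n. form_quotient n (rfun a) \<le> c * (norm (rfun a))\<^sup>2))"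

text \<open>None of the cells in \<open>K\<close> is low, so the pieces carry at least
  \<open>t\<close> times their mass as energy. On the other hand their energy is \<open>lam\<close>
  times their mass plus the commutators.\<close>

lemma localised_energy:
  fixes a :: "'a \<Rightarrow> real" and P :: "'a set" and b :: real
  assumes a: "sq_integrable a" "rfun a \<in> X" and eig: "\<And>s. s \<ge> 0 \<Longrightarrow> S s (rfun a) = exp (- lam * s) *\<^sub>R rfun a"
    and h: "h > 0" and \<epsilon>: "\<epsilon> > 0" and K: "finite K" "K \<subseteq> PiE Basis (\<lambda>_. UNIV)" and good: "\<And>k. k \<in> K \<Longrightarrow> \<not> low_energy h t k"
  defines "w \<equiv> weight \<epsilon> b P"
  shows "(t - lam) * (\<Sum>k\<in>K. (norm (rfun (\<lambda>x. cutoff h k x * (1 / sqrt (w x)) * a x)))\<^sup>2)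
    \<le> real DIM('a) * (b\<^sup>2 + (pi / (2 * h))\<^sup>2) * (\<integral>x. (a x)\<^sup>2 / w x \<partial>lborel)"
proof -
  have am[measurable]: "a \<in> borel_measurable borel" using a by (auto simp: sq_integrable_def)
  have [measurable]: "w \<in> borel_measurable borel" unfolding w_def by measurable
  have we: "\<epsilon> \<le> w x" for x unfolding w_def by (rule weight_ge)
  have w: "0 < w x" for x using we[of x] \<epsilon> by linarith
  define \<theta> where "\<theta> k x = cutoff h k x * (1 / sqrt (w x))" for k x
  have [measurable]: "\<theta> k \<in> borel_measurable borel" for k unfolding \<theta>_def by measurable
  have \<theta>: "\<bar>\<theta> k x\<bar> \<le> 1 / sqrt \<epsilon>" for k x
  proof -
    have "cutoff h k x * (1 / sqrt (w x)) \<le> 1 * (1 / sqrt \<epsilon>)"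
      using cutoff_bounds[of h k x] we[of x] \<epsilon> w[of x] by (intro mult_mono) (auto intro: frac_le)
    then show ?thesis using cutoff_bounds[of h k x] w[of x] by (simp add: \<theta>_def abs_mult less_imp_le)
  qed
  define v where "v k = rfun (\<lambda>x. \<theta> k x * a x)" for k
  define N where "N k = (norm (v k))\<^sup>2" for k
  have sv: "sq_integrable (\<lambda>x. \<theta> k x * a x)" for k by (rule sq_integrable_mult_bounded[OF a(1) _ \<theta>]) simp
  have vX: "v k \<in> X" for k unfolding v_def by (rule rfun_in_L2_on_mono[OF a(2,1) sv]) simp
  have th2: "\<bar>(\<theta> k x)\<^sup>2\<bar> \<le> (1 / sqrt \<epsilon>)\<^sup>2" for k x using power_mono[OF \<theta>[of k x], of 2] by simp
  have sv2: "sq_integrable (\<lambda>x. (\<theta> k x)\<^sup>2 * a x)" for k by (rule sq_integrable_mult_bounded[OF a(1) _ th2]) simp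
  have tf: "test_fun h k (\<lambda>x. \<theta> k x * a x)" for k
    unfolding test_fun_def using sv vX by (auto simp: v_def \<theta>_def cutoff_outside)
  have N_eq: "inner (rfun a) (rfun (\<lambda>x. (\<theta> k x)\<^sup>2 * a x)) = N k" for k
    unfolding N_def v_def norm_rfun[OF sv] inner_rfun[OF a(1) sv2] by (simp add: power2_eq_square mult_ac)
  \<comment> \<open>The eigenvalue equation makes the quotient of each piece explicit up to its
    commutator.\<close>
  have q: "form_quotient n (v k) = (1 - exp (- lam * (1/2) ^ n)) * 2 ^ n * N k + commutator_form ((1/2) ^ n) (\<theta> k) a * 2 ^ n" for n k
  proof -
    have e: "S ((1/2) ^ n) (rfun a) = exp (- lam * (1/2) ^ n) *\<^sub>R rfun a" by (rule eig) simp
    have "commutator_form ((1/2) ^ n) (\<theta> k) a = exp (- lam * (1/2) ^ n) * N k - inner (S ((1/2) ^ n) (v k)) (v k)"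
      unfolding commutator_form_def v_def[symmetric] e inner_scaleR_left N_eq ..
    then show ?thesis unfolding form_quotient_def N_def by (simp add: left_diff_distrib)
  qed
  define \<Phi> where "\<Phi> = (\<integral>x. (a x)\<^sup>2 / w x \<partial>lborel)"
  have \<Phi>i: "integrable lborel (\<lambda>x. (a x)\<^sup>2 / w x)"
  proof (rule Bochner_Integration.integrable_bound)
    show "integrable lborel (\<lambda>x. (1 / \<epsilon>) * (a x)\<^sup>2)" using a by (simp add: sq_integrable_def)
    show "AE x in lborel. norm ((a x)\<^sup>2 / w x) \<le> norm ((1 / \<epsilon>) * (a x)\<^sup>2)"
      using we w \<epsilon> by (auto intro!: AE_I2 divide_left_mono simp: less_imp_le abs_of_pos)
  qed simp
  have \<Phi>0: "0 \<le> \<Phi>" unfolding \<Phi>_def using w by (intro integral_nonneg_AE) (auto simp: less_imp_le)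
  have \<Phi>n: "(\<integral>\<^sup>+x. ennreal ((a x)\<^sup>2 / w x) \<partial>lborel) = ennreal \<Phi>"
    unfolding \<Phi>_def using w by (intro nn_integral_eq_integral[OF \<Phi>i]) (auto simp: less_imp_le)
  define E where "E s = (exp (real DIM('a) * b\<^sup>2 * s) - 1) + (exp (real DIM('a) * (pi / (2 * h))\<^sup>2 * s) - 1)" for s
  have E0: "0 \<le> E s" if "s > 0" for s
    unfolding E_def by (intro add_nonneg_nonneg) (use that in simp_all)
  have cle: "(\<Sum>k\<in>K. commutator_form s (\<theta> k) a) \<le> E s * \<Phi>" if s: "s > 0" for s
  proof -
    have "ennreal (\<Sum>k\<in>K. commutator_form s (\<theta> k) a) \<le> (\<Sum>k\<in>K. ennreal (commutator_form s (\<theta> k) a))" by (rule ennreal_sum_le)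
    also have "\<dots> \<le> (\<Sum>k\<in>K. ennreal (1/2) * heat_form s (\<lambda>x y. (\<theta> k x - \<theta> k y)\<^sup>2 * (\<bar>a x\<bar> * \<bar>a y\<bar>)))"
      by (intro sum_mono commutator_form_le[OF a _ \<theta> s]) simp
    also have "\<dots> = ennreal (1/2) * heat_form s (\<lambda>x y. \<Sum>k\<in>K. (\<theta> k x - \<theta> k y)\<^sup>2 * (\<bar>a x\<bar> * \<bar>a y\<bar>))"
      by (subst heat_form_sum) (auto simp: sum_distrib_left)
    also have "\<dots> \<le> ennreal (1/2) * (ennreal (2 * (exp (real DIM('a) * s * b\<^sup>2) - 1) + 2 * (exp (real DIM('a) * s * (pi / (2 * h))\<^sup>2) - 1)) * ennreal \<Phi>)"
      using heat_form_cutoff_weight[OF am s h \<epsilon> K, where P = P and b = b]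
      unfolding w_def[symmetric] \<Phi>n sum_distrib_right[symmetric] \<theta>_def by (intro mult_left_mono) simp_all
    also have "\<dots> = ennreal (1/2) * (ennreal (2 * E s) * ennreal \<Phi>)"
      by (simp add: E_def mult_ac)
    also have "\<dots> = ennreal (E s * \<Phi>)"
    proof -
      have "ennreal (2 * E s) * ennreal \<Phi> = ennreal (2 * E s * \<Phi>)" using E0[OF s] \<Phi>0 by (intro ennreal_mult[symmetric]) auto
      moreover have "ennreal (1/2) * ennreal (2 * E s * \<Phi>) = ennreal (1/2 * (2 * E s * \<Phi>))" by (rule ennreal_mult'[symmetric]) simp
      ultimately show ?thesis by simp
    qed
    finally show ?thesis using E0[OF s] \<Phi>0 by (subst (asm) ennreal_le_iff) auto
  qed
  define m where "m = (\<Sum>k\<in>K. N k)"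
  have m0: "0 \<le> m" by (simp add: m_def N_def sum_nonneg)
  define R where "R n = (1 - exp (- lam * (1/2) ^ n)) * 2 ^ n * m + E ((1/2) ^ n) * 2 ^ n * \<Phi>" for n
  have R_eq: "R n = - ((exp (- lam * (1/2) ^ n) - 1) * 2 ^ n) * m + ((exp (real DIM('a) * b\<^sup>2 * (1/2) ^ n) - 1) * 2 ^ n
      + (exp (real DIM('a) * (pi / (2 * h))\<^sup>2 * (1/2) ^ n) - 1) * 2 ^ n) * \<Phi>" for n
    unfolding R_def E_def by (simp add: algebra_simps)
  have Rlim: "R \<longlonglongrightarrow> - (- lam) * m + (real DIM('a) * b\<^sup>2 + real DIM('a) * (pi / (2 * h))\<^sup>2) * \<Phi>"
    unfolding R_eq[abs_def] by (intro tendsto_intros exp_quotient_tendsto)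
  have qR: "(\<Sum>k\<in>K. form_quotient n (v k)) \<le> R n" for n
  proof -
    have "(\<Sum>k\<in>K. form_quotient n (v k)) = (1 - exp (- lam * (1/2) ^ n)) * 2 ^ n * m + (\<Sum>k\<in>K. commutator_form ((1/2) ^ n) (\<theta> k) a) * 2 ^ n"
      unfolding q m_def by (simp only: sum.distrib sum_distrib_left sum_distrib_right)
    also have "\<dots> \<le> R n" unfolding R_def
      using mult_right_mono[OF cle[of "(1/2) ^ n"], of "2 ^ n"] by (simp add: mult_ac)
    finally show ?thesis .
  qed
  define L where "L = lam * m + (real DIM('a) * b\<^sup>2 + real DIM('a) * (pi / (2 * h))\<^sup>2) * \<Phi>"
  \<comment> \<open>Failure of \<open>low_energy\<close> says that for each \<open>c < t\<close> the
    quotients eventually exceed \<open>c * N k\<close>, unless the piece vanishes. Hence the bound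
    is first obtained for \<open>c\<close> and extended to \<open>t\<close> afterwards.\<close>
  have cL: "c * m \<le> L" if c: "c < t" for c
  proof -
    have "\<exists>n. \<forall>j\<ge>n. c * N k \<le> form_quotient j (v k)" if k: "k \<in> K" for k
    proof (cases "v k = 0")
      case True
      then show ?thesis using sg.form_decreasing[of 0 _ "v k"] by (auto simp: N_def form_quotient_def)
    next
      case False
      then obtain n where "c * N k < form_quotient n (v k)"
        using good[OF k] c tf[of k] unfolding low_energy_def v_def N_def by (meson not_le)
      then show ?thesis using form_quotient_mono[OF vX] by (meson less_imp_le order.trans)
    qed
    then obtain n where n: "\<And>k j. k \<in> K \<Longrightarrow> j \<ge> n k \<Longrightarrow> c * N k \<le> form_quotient j (v k)" by metis
    have "c * m \<le> R j" if j: "j \<ge> (\<Sum>k\<in>K. n k)" for j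
    proof -
      have "c * m = (\<Sum>k\<in>K. c * N k)" by (simp add: m_def sum_distrib_left)
      also have "\<dots> \<le> (\<Sum>k\<in>K. form_quotient j (v k))"
      proof (rule sum_mono)
        fix k assume k: "k \<in> K"
        have "n k \<le> (\<Sum>k\<in>K. n k)" using k K(1) by (intro member_le_sum) auto
        then show "c * N k \<le> form_quotient j (v k)" using n[OF k] j by simp
      qed
      also have "\<dots> \<le> R j" by (rule qR)
      finally show ?thesis .
    qed
    then show ?thesis using LIMSEQ_le_const[OF Rlim] by (auto simp: L_def)
  qed
  have "t * m \<le> L"
  proof (rule ccontr)
    assume *: "\<not> ?thesis"
    then have m: "m > 0" using cL[of "t - 1"] m0 by (cases "m = 0") auto
    define c where "c = (t + L / m) / 2"
    have "L / m < t" using * m by (simp add: field_simps)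
    then have "c < t" by (simp add: c_def)
    moreover have "c * m = (t * m + L) / 2" using m by (simp add: c_def field_simps)
    ultimately show False using cL[of c] * by simp
  qed
  then show ?thesis
    by (simp add: L_def m_def N_def v_def \<theta>_def \<Phi>_def algebra_simps)
qed

text \<open>The partition of unity splits the integral \<open>\<Phi>\<close> of
  \<open>(a x)\<^sup>2 / w x\<close>: indices outside \<open>B\<close> contribute at most
  \<open>\<kappa> * \<Phi>\<close>, those in \<open>B\<close> at most \<open>C\<close> times the
  squared norm. As \<open>\<epsilon> > 0\<close> makes \<open>\<Phi>\<close> finite, the first part
  can be absorbed.\<close>

lemma weighted_estimate:
  fixes a :: "'a \<Rightarrow> real" and b :: real
  assumes a: "sq_integrable a" "rfun a \<in> X" and eig: "\<And>s. s \<ge> 0 \<Longrightarrow> S s (rfun a) = exp (- lam * s) *\<^sub>R rfun a"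
    and h: "h > 0" and b: "b > 0" and \<epsilon>: "\<epsilon> > 0" and lt: "lam < t"
    and B: "finite B" "\<And>k. k \<in> PiE Basis (\<lambda>_. UNIV) \<Longrightarrow> low_energy h t k \<Longrightarrow> k \<in> B"
    and \<kappa>: "real DIM('a) * (b\<^sup>2 + (pi / (2 * h))\<^sup>2) = \<kappa> * (t - lam)" "\<kappa> < 1"
  defines "w \<equiv> weight \<epsilon> b (centre h ` B)"
  shows "(\<integral>\<^sup>+x. ennreal ((a x)\<^sup>2 / w x) \<partial>lborel) \<le> ennreal (cosh (b * h) ^ DIM('a) / (1 - \<kappa>) * (norm (rfun a))\<^sup>2)"
proof -
  have am[measurable]: "a \<in> borel_measurable borel" using a by (auto simp: sq_integrable_def)
  have [measurable]: "w \<in> borel_measurable borel" unfolding w_def by measurable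
  have we: "\<epsilon> \<le> w x" for x unfolding w_def by (rule weight_ge)
  have w: "0 < w x" for x using we[of x] \<epsilon> by linarith
  define g where "g x = (a x)\<^sup>2 / w x" for x
  have [measurable]: "g \<in> borel_measurable borel" unfolding g_def by measurable
  have g0: "0 \<le> g x" for x using w[of x] by (simp add: g_def)
  have gi: "integrable lborel g"
  proof (rule Bochner_Integration.integrable_bound)
    show "integrable lborel (\<lambda>x. (1 / \<epsilon>) * (a x)\<^sup>2)" using a by (simp add: sq_integrable_def)
    show "AE x in lborel. norm (g x) \<le> norm ((1 / \<epsilon>) * (a x)\<^sup>2)"
      using we w \<epsilon> by (auto intro!: AE_I2 divide_left_mono simp: g_def less_imp_le abs_of_pos)
  qed simp
  define \<Phi> where "\<Phi> = (\<integral>x. g x \<partial>lborel)"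
  have \<Phi>n: "(\<integral>\<^sup>+x. ennreal (g x) \<partial>lborel) = ennreal \<Phi>"
    unfolding \<Phi>_def using g0 by (intro nn_integral_eq_integral[OF gi]) auto
  have \<Phi>0: "0 \<le> \<Phi>" unfolding \<Phi>_def using g0 by (intro integral_nonneg_AE) auto
  define C where "C = cosh (b * h) ^ DIM('a)"
  have C0: "0 < C" unfolding C_def by (intro zero_less_power cosh_real_pos)
  define K where "K n = box_indices n - B" for n
  have box: "box_indices n \<subseteq> PiE (Basis::'a set) (\<lambda>_. UNIV)" for n by (auto simp: box_indices_def PiE_iff)
  have K: "finite (K n)" "K n \<subseteq> PiE Basis (\<lambda>_. UNIV)" "\<And>k. k \<in> K n \<Longrightarrow> \<not> low_energy h t k" for n
    using box[of n] B(2) by (auto simp: K_def finite_box_indices)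
  \<comment> \<open>Inside a cell with index in \<open>B\<close> one summand of \<open>w\<close> is
    at least \<open>1 / C\<close>; outside all of them the cutoffs in question vanish.\<close>
  have bad_part: "(\<Sum>k\<in>box_indices n \<inter> B. (cutoff h k x)\<^sup>2) * g x \<le> C * (a x)\<^sup>2" for n x
  proof (cases "\<exists>k\<in>B. x \<in> cell h k")
    case True
    then obtain k where k: "k \<in> B" "x \<in> cell h k" by auto
    have "1 / coshprod b (centre h k) x \<le> (\<Sum>p\<in>centre h ` B. 1 / coshprod b p x)"
      using B(1) k(1) by (intro member_le_sum inverse_coshprod_nonneg) auto
    also have "\<dots> \<le> w x" using \<epsilon> by (simp add: w_def weight_def)
    finally have "1 \<le> w x * coshprod b (centre h k) x" using coshprod_pos[of b "centre h k" x] by (simp add: field_simps)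
    also have "\<dots> \<le> w x * C" unfolding C_def using w[of x] by (intro mult_left_mono coshprod_cell[OF k(2) h b]) auto
    finally have "1 / w x \<le> C" using w[of x] by (simp add: field_simps)
    from mult_right_mono[OF this, of "(a x)\<^sup>2"] have "g x \<le> C * (a x)\<^sup>2" by (simp add: g_def)
    moreover have "(\<Sum>k\<in>box_indices n \<inter> B. (cutoff h k x)\<^sup>2) \<le> 1"
      using box[of n] by (intro sum_cutoff_le_1) (auto simp: finite_box_indices)
    ultimately show ?thesis using mult_right_mono[of "\<Sum>k\<in>box_indices n \<inter> B. (cutoff h k x)\<^sup>2" 1 "g x"] g0[of x] by simp
  next
    case False
    then have "(\<Sum>k\<in>box_indices n \<inter> B. (cutoff h k x)\<^sup>2) = 0" by (intro sum.neutral) (auto simp: cutoff_outside)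
    then show ?thesis using C0 by simp
  qed
  have good_part: "(\<integral>\<^sup>+x. ennreal ((\<Sum>k\<in>K n. (cutoff h k x)\<^sup>2) * g x) \<partial>lborel) \<le> ennreal (\<kappa> * \<Phi>)" for n
  proof -
    have sv: "sq_integrable (\<lambda>x. cutoff h k x * (1 / sqrt (w x)) * a x)" for k
    proof (rule sq_integrable_bound[OF a(1), of _ "1 / sqrt \<epsilon>"])
      show "\<bar>cutoff h k x * (1 / sqrt (w x)) * a x\<bar> \<le> 1 / sqrt \<epsilon> * \<bar>a x\<bar>" for x
      proof -
        have "\<bar>cutoff h k x * (1 / sqrt (w x))\<bar> \<le> 1 * (1 / sqrt \<epsilon>)"
          unfolding abs_mult using cutoff_bounds[of h k x] we[of x] \<epsilon> w[of x]
          by (intro mult_mono) (auto intro: frac_le)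
        then show ?thesis unfolding abs_mult[of _ "a x"] by (intro mult_right_mono) auto
      qed
    qed measurable
    have "(\<integral>\<^sup>+x. ennreal ((\<Sum>k\<in>K n. (cutoff h k x)\<^sup>2) * g x) \<partial>lborel)
        = (\<integral>\<^sup>+x. (\<Sum>k\<in>K n. ennreal ((cutoff h k x * (1 / sqrt (w x)) * a x)\<^sup>2)) \<partial>lborel)"
    proof (rule nn_integral_cong)
      fix x
      have "(\<Sum>k\<in>K n. (cutoff h k x)\<^sup>2) * g x = (\<Sum>k\<in>K n. (cutoff h k x * (1 / sqrt (w x)) * a x)\<^sup>2)"
        using w[of x] by (simp add: g_def sum_distrib_right sum_divide_distrib power_mult_distrib power_divide less_imp_le)
      then show "ennreal ((\<Sum>k\<in>K n. (cutoff h k x)\<^sup>2) * g x) = (\<Sum>k\<in>K n. ennreal ((cutoff h k x * (1 / sqrt (w x)) * a x)\<^sup>2))"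
        by (simp add: sum_ennreal)
    qed
    also have "\<dots> = (\<Sum>k\<in>K n. (\<integral>\<^sup>+x. ennreal ((cutoff h k x * (1 / sqrt (w x)) * a x)\<^sup>2) \<partial>lborel))"
      by (rule nn_integral_sum) measurable
    also have "\<dots> = ennreal (\<Sum>k\<in>K n. (norm (rfun (\<lambda>x. cutoff h k x * (1 / sqrt (w x)) * a x)))\<^sup>2)"
      unfolding nn_norm_rfun[OF sv, symmetric] by (rule sum_ennreal) simp
    also have "\<dots> \<le> ennreal (\<kappa> * \<Phi>)"
    proof (rule ennreal_leI)
      have "(t - lam) * (\<Sum>k\<in>K n. (norm (rfun (\<lambda>x. cutoff h k x * (1 / sqrt (w x)) * a x)))\<^sup>2) \<le> (t - lam) * (\<kappa> * \<Phi>)"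
        using localised_energy[OF a eig h \<epsilon> K(1,2) K(3), where P = "centre h ` B" and b = b] \<kappa>(1)
        unfolding w_def[symmetric] g_def[symmetric] \<Phi>_def[symmetric] by (simp add: mult_ac)
      then show "(\<Sum>k\<in>K n. (norm (rfun (\<lambda>x. cutoff h k x * (1 / sqrt (w x)) * a x)))\<^sup>2) \<le> \<kappa> * \<Phi>"
        using lt by simp
    qed
    finally show ?thesis .
  qed
  have \<kappa>0: "0 \<le> \<kappa>"
  proof -
    have "0 \<le> \<kappa> * (t - lam)" unfolding \<kappa>(1)[symmetric] by (intro mult_nonneg_nonneg add_nonneg_nonneg) auto
    then show ?thesis using lt by (simp add: zero_le_mult_iff)
  qed
  have F: "(\<integral>\<^sup>+x. ennreal ((\<Sum>k\<in>box_indices n. (cutoff h k x)\<^sup>2) * g x) \<partial>lborel) \<le> ennreal (\<kappa> * \<Phi> + C * (norm (rfun a))\<^sup>2)" for n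
  proof -
    have "(\<integral>\<^sup>+x. ennreal ((\<Sum>k\<in>box_indices n. (cutoff h k x)\<^sup>2) * g x) \<partial>lborel)
       \<le> (\<integral>\<^sup>+x. ennreal ((\<Sum>k\<in>K n. (cutoff h k x)\<^sup>2) * g x) + ennreal C * ennreal ((a x)\<^sup>2) \<partial>lborel)"
    proof (rule nn_integral_mono)
      fix x
      have "box_indices n = K n \<union> (box_indices n \<inter> B)" by (auto simp: K_def)
      then have "(\<Sum>k\<in>box_indices n. (cutoff h k x)\<^sup>2) = (\<Sum>k\<in>K n. (cutoff h k x)\<^sup>2) + (\<Sum>k\<in>box_indices n \<inter> B. (cutoff h k x)\<^sup>2)"
        using sum.union_disjoint[of "K n" "box_indices n \<inter> B" "\<lambda>k. (cutoff h k x)\<^sup>2"] K(1)[of n] finite_box_indices[where 'a = 'a]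
        by (auto simp: K_def)
      then have "(\<Sum>k\<in>box_indices n. (cutoff h k x)\<^sup>2) * g x \<le> (\<Sum>k\<in>K n. (cutoff h k x)\<^sup>2) * g x + C * (a x)\<^sup>2"
        using bad_part[where n = n and x = x] by (simp add: distrib_right)
      then have "ennreal ((\<Sum>k\<in>box_indices n. (cutoff h k x)\<^sup>2) * g x) \<le> ennreal ((\<Sum>k\<in>K n. (cutoff h k x)\<^sup>2) * g x + C * (a x)\<^sup>2)"
        by (rule ennreal_leI)
      also have "\<dots> = ennreal ((\<Sum>k\<in>K n. (cutoff h k x)\<^sup>2) * g x) + ennreal C * ennreal ((a x)\<^sup>2)"
        using g0[of x] C0 by (subst ennreal_plus) (auto intro!: mult_nonneg_nonneg sum_nonneg simp: ennreal_mult)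
      finally show "ennreal ((\<Sum>k\<in>box_indices n. (cutoff h k x)\<^sup>2) * g x) \<le> ennreal ((\<Sum>k\<in>K n. (cutoff h k x)\<^sup>2) * g x) + ennreal C * ennreal ((a x)\<^sup>2)" .
    qed
    also have "\<dots> = (\<integral>\<^sup>+x. ennreal ((\<Sum>k\<in>K n. (cutoff h k x)\<^sup>2) * g x) \<partial>lborel) + ennreal C * ennreal ((norm (rfun a))\<^sup>2)"
      unfolding nn_norm_rfun[OF a(1)] by (subst nn_integral_add, simp, simp, subst nn_integral_cmult, simp, simp)
    also have "\<dots> \<le> ennreal (\<kappa> * \<Phi>) + ennreal C * ennreal ((norm (rfun a))\<^sup>2)" by (intro add_right_mono good_part)
    also have "\<dots> = ennreal (\<kappa> * \<Phi> + C * (norm (rfun a))\<^sup>2)"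
      using \<kappa>0 \<Phi>0 C0 by (simp add: ennreal_mult)
    finally show ?thesis .
  qed
  \<comment> \<open>At each point the squares of the cutoffs sum to 1 once the box is large enough,
    so Fatou's lemma removes the box.\<close>
  have "ennreal \<Phi> = (\<integral>\<^sup>+x. liminf (\<lambda>n. ennreal ((\<Sum>k\<in>box_indices n. (cutoff h k x)\<^sup>2) * g x)) \<partial>lborel)"
    unfolding \<Phi>n[symmetric]
  proof (rule nn_integral_cong)
    fix x :: 'a
    obtain N where N: "\<And>n e. n \<ge> N \<Longrightarrow> e \<in> Basis \<Longrightarrow> \<bar>x \<bullet> e / h\<bar> < real n" using large_box[of x h] by blast
    have "(\<lambda>n. ennreal ((\<Sum>k\<in>box_indices n. (cutoff h k x)\<^sup>2) * g x)) \<longlonglongrightarrow> ennreal (g x)"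
      by (rule tendsto_eventually, rule eventually_sequentiallyI[of N]) (simp add: sum_cutoff_square[OF N])
    then show "ennreal (g x) = liminf (\<lambda>n. ennreal ((\<Sum>k\<in>box_indices n. (cutoff h k x)\<^sup>2) * g x))"
      by (intro lim_imp_Liminf[symmetric]) simp_all
  qed
  also have "\<dots> \<le> liminf (\<lambda>n. (\<integral>\<^sup>+x. ennreal ((\<Sum>k\<in>box_indices n. (cutoff h k x)\<^sup>2) * g x) \<partial>lborel))"
    by (rule nn_integral_liminf) measurable
  also have "\<dots> \<le> liminf (\<lambda>n. ennreal (\<kappa> * \<Phi> + C * (norm (rfun a))\<^sup>2))"
    by (intro Liminf_mono always_eventually allI F)
  also have "\<dots> = ennreal (\<kappa> * \<Phi> + C * (norm (rfun a))\<^sup>2)" by (simp add: Liminf_const)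
  finally have "\<Phi> \<le> \<kappa> * \<Phi> + C * (norm (rfun a))\<^sup>2"
    using \<kappa>0 \<Phi>0 C0 by (subst (asm) ennreal_le_iff) (auto intro!: add_nonneg_nonneg mult_nonneg_nonneg)
  then have "\<Phi> \<le> C / (1 - \<kappa>) * (norm (rfun a))\<^sup>2" using \<kappa>(2) by (simp add: field_simps)
  then show ?thesis unfolding g_def[symmetric] \<Phi>n C_def by (rule ennreal_leI)
qed

end

section \<open>Counting cells of low energy\<close>

context dominated_semigroup
begin

text \<open>Gaussian decay off the diagonal. Where both functions are nonzero the factor
  \<open>q * coshprod \<beta> x y\<close> is at least 1 and may be inserted; its heat average is
  \<open>q * exp (d * s * \<beta>\<^sup>2)\<close>.\<close>

lemma form_separated_le:
  assumes a: "sq_integrable a" "rfun a \<in> X" and b: "sq_integrable b" "rfun b \<in> X" and h: "h > 0"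
    and sep: "\<And>x y. a x \<noteq> 0 \<Longrightarrow> b y \<noteq> 0 \<Longrightarrow> \<exists>e\<in>Basis. h \<le> \<bar>(x - y) \<bullet> e\<bar>"
    and s: "s > 0"
  shows "\<bar>inner (S s (rfun a)) (rfun b)\<bar> \<le> 2 * exp (- (h\<^sup>2 / (4 * real DIM('a)) / s)) * (norm (rfun (\<lambda>x. \<bar>a x\<bar> + \<bar>b x\<bar>)))\<^sup>2"
proof -
  have [measurable]: "a \<in> borel_measurable borel" "b \<in> borel_measurable borel" using a b by (auto simp: sq_integrable_def)
  define c where "c x = \<bar>a x\<bar> + \<bar>b x\<bar>" for x
  have c: "sq_integrable c" unfolding c_def by (intro sq_integrable_add sq_integrable_abs a b)
  have [measurable]: "c \<in> borel_measurable borel" using c by (auto simp: sq_integrable_def)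
  define d where "d = real DIM('a)"
  have d: "d > 0" by (simp add: d_def)
  \<comment> \<open>Minimises the exponent
    \<open>- (\<beta> * h) + d * s * \<beta>\<^sup>2\<close>.\<close>
  define \<beta> where "\<beta> = h / (2 * d * s)"
  have \<beta>: "\<beta> > 0" using h d s by (simp add: \<beta>_def)
  define q where "q = 2 * exp (- (\<beta> * h))"
  have q0: "0 \<le> q" by (simp add: q_def)
  have m: "(\<lambda>(x, y). q * coshprod \<beta> x (y::'a)) \<in> borel_measurable (borel \<Otimes>\<^sub>M borel)" by measurable
  have q1: "1 \<le> q * cosh (\<beta> * h)"
  proof -
    have "exp (\<beta> * h) \<le> 2 * cosh (\<beta> * h)" by (simp add: cosh_field_def)
    then have "exp (- (\<beta> * h)) * exp (\<beta> * h) \<le> exp (- (\<beta> * h)) * (2 * cosh (\<beta> * h))" by (intro mult_left_mono) auto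
    then show ?thesis by (simp add: q_def exp_minus mult_ac)
  qed
  have "ennreal \<bar>inner (S s (rfun a)) (rfun b)\<bar> \<le> heat_form s (\<lambda>x y. \<bar>b x\<bar> * \<bar>a y\<bar>)"
    by (rule form_abs_le[OF a b s])
  also have "\<dots> \<le> heat_form s (\<lambda>x y. (q * coshprod \<beta> x y) * (c x * c y))"
  proof (rule heat_form_mono)
    fix x y
    show "\<bar>b x\<bar> * \<bar>a y\<bar> \<le> (q * coshprod \<beta> x y) * (c x * c y)"
    proof (cases "b x = 0 \<or> a y = 0")
      case True
      then have "\<bar>b x\<bar> * \<bar>a y\<bar> = 0" by auto
      also have "0 \<le> (q * coshprod \<beta> x y) * (c x * c y)"
        by (intro mult_nonneg_nonneg q0 less_imp_le[OF coshprod_pos]) (auto simp: c_def)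
      finally show ?thesis .
    next
      case False
      then obtain e where e: "e \<in> Basis" "h \<le> \<bar>(y - x) \<bullet> e\<bar>" using sep[of y x] by auto
      have "cosh (\<beta> * h) \<le> cosh \<bar>\<beta> * ((y - x) \<bullet> e)\<bar>"
        using e \<beta> h by (subst cosh_real_nonneg_le_iff) (auto simp: abs_mult)
      also have "\<dots> = cosh (\<beta> * ((y - x) \<bullet> e))" by (rule cosh_real_abs)
      also have "\<dots> \<le> coshprod \<beta> x y"
      proof -
        have "coshprod \<beta> x y = cosh (\<beta> * ((y - x) \<bullet> e)) * (\<Prod>e\<in>Basis - {e}. cosh (\<beta> * ((y - x) \<bullet> e)))"
          unfolding coshprod_def using e(1) by (intro prod.remove) auto
        moreover have "1 \<le> (\<Prod>e\<in>Basis - {e}. cosh (\<beta> * ((y - x) \<bullet> e)))"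
          by (intro prod_ge_1) (simp add: cosh_real_ge_1)
        ultimately show ?thesis
          using mult_left_mono[of 1 "\<Prod>e\<in>Basis - {e}. cosh (\<beta> * ((y - x) \<bullet> e))" "cosh (\<beta> * ((y - x) \<bullet> e))"] cosh_real_nonneg
          by simp
      qed
      finally have "1 \<le> q * coshprod \<beta> x y" using q1 q0 by (meson mult_left_mono order.trans)
      moreover have "\<bar>b x\<bar> * \<bar>a y\<bar> \<le> c x * c y" by (intro mult_mono) (auto simp: c_def)
      moreover have "0 \<le> c x * c y" by (simp add: c_def)
      ultimately have "1 * (\<bar>b x\<bar> * \<bar>a y\<bar>) \<le> (q * coshprod \<beta> x y) * (c x * c y)" by - (rule mult_mono, auto)
      then show ?thesis by simp
    qed
  qed
  also have "\<dots> \<le> (\<integral>\<^sup>+x. (\<integral>\<^sup>+y. ennreal (heat_kernel s (x - y) * (q * coshprod \<beta> x y)) \<partial>lborel) * ennreal ((c x)\<^sup>2) \<partial>lborel)"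
  proof (rule heat_form_Schur[OF m])
    show "0 \<le> q * coshprod \<beta> x y" for x y :: 'a using q0 coshprod_pos[of \<beta> x y] by (intro mult_nonneg_nonneg) auto
    show "q * coshprod \<beta> x y = q * coshprod \<beta> y x" for x y :: 'a by (simp add: coshprod_commute)
  qed measurable
  also have "\<dots> = (\<integral>\<^sup>+x. ennreal (q * exp (d * s * \<beta>\<^sup>2)) * ennreal ((c x)\<^sup>2) \<partial>lborel)"
  proof (rule nn_integral_cong)
    fix x :: 'a
    have "(\<integral>\<^sup>+y. ennreal (heat_kernel s (x - y) * (q * coshprod \<beta> x y)) \<partial>lborel) = (\<integral>\<^sup>+y. ennreal q * ennreal (heat_kernel s (x - y) * coshprod \<beta> x y) \<partial>lborel)"
      by (intro nn_integral_cong) (simp only: ennreal_mult'[OF q0, symmetric] mult.left_commute)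
    also have "\<dots> = ennreal q * (\<integral>\<^sup>+y. ennreal (heat_kernel s (x - y) * coshprod \<beta> x y) \<partial>lborel)" by (rule nn_integral_cmult) measurable
    also have "\<dots> = ennreal q * ennreal (exp (d * s * \<beta>\<^sup>2))"
      unfolding coshprod_def d_def by (subst nn_integral_heat_kernel_cosh[OF s]) simp
    also have "\<dots> = ennreal (q * exp (d * s * \<beta>\<^sup>2))" by (rule ennreal_mult'[OF q0, symmetric])
    finally show "(\<integral>\<^sup>+y. ennreal (heat_kernel s (x - y) * (q * coshprod \<beta> x y)) \<partial>lborel) * ennreal ((c x)\<^sup>2) = ennreal (q * exp (d * s * \<beta>\<^sup>2)) * ennreal ((c x)\<^sup>2)" by simp
  qed
  also have "\<dots> = ennreal (q * exp (d * s * \<beta>\<^sup>2)) * ennreal ((norm (rfun c))\<^sup>2)"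
    unfolding nn_norm_rfun[OF c] by (rule nn_integral_cmult) measurable
  also have "\<dots> = ennreal (q * exp (d * s * \<beta>\<^sup>2) * (norm (rfun c))\<^sup>2)" by (rule ennreal_mult''[symmetric]) simp
  finally have "\<bar>inner (S s (rfun a)) (rfun b)\<bar> \<le> q * exp (d * s * \<beta>\<^sup>2) * (norm (rfun c))\<^sup>2"
    using q0 by (subst (asm) ennreal_le_iff) auto
  also have "q * exp (d * s * \<beta>\<^sup>2) = 2 * exp (- (\<beta> * h) + d * s * \<beta>\<^sup>2)" by (simp add: q_def exp_add[symmetric])
  also have "- (\<beta> * h) + d * s * \<beta>\<^sup>2 = - (h\<^sup>2 / (4 * d) / s)"
    using d s by (simp add: \<beta>_def power2_eq_square field_simps)
  finally show ?thesis unfolding c_def d_def .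
qed

text \<open>Locality of the form: the exponential smallness at time \<open>(1/2) ^ n\<close> beats
  the factor \<open>2 ^ n\<close>.\<close>

lemma form_separated_tendsto:
  assumes a: "sq_integrable a" "rfun a \<in> X" and b: "sq_integrable b" "rfun b \<in> X" and h: "h > 0"
    and sep: "\<And>x y. a x \<noteq> 0 \<Longrightarrow> b y \<noteq> 0 \<Longrightarrow> \<exists>e\<in>Basis. h \<le> \<bar>(x - y) \<bullet> e\<bar>"
  shows "(\<lambda>n. inner (S ((1/2) ^ n) (rfun a)) (rfun b) * 2 ^ n) \<longlonglongrightarrow> 0"
proof (rule Lim_null_comparison)
  define \<alpha> where "\<alpha> = h\<^sup>2 / (4 * real DIM('a))"
  define N where "N = (norm (rfun (\<lambda>x. \<bar>a x\<bar> + \<bar>b x\<bar>)))\<^sup>2"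
  have \<alpha>: "\<alpha> > 0" using h by (simp add: \<alpha>_def)
  show "\<forall>\<^sub>F n in sequentially. norm (inner (S ((1/2) ^ n) (rfun a)) (rfun b) * 2 ^ n) \<le> 4 * N / \<alpha>\<^sup>2 * (1/2) ^ n"
  proof (rule always_eventually, rule allI)
    fix n :: nat
    define M where "M = (2::real) ^ n"
    have M: "M > 0" by (simp add: M_def)
    have hM: "(1/2::real) ^ n = 1 / M" by (simp add: M_def power_divide)
    have "(\<alpha> * M)\<^sup>2 / 2 \<le> exp (\<alpha> * M)"
      using exp_lower_Taylor_quadratic[of "\<alpha> * M"] \<alpha> M by (smt (verit) mult_pos_pos)
    then have e: "exp (- (\<alpha> * M)) \<le> 2 / (\<alpha> * M)\<^sup>2"
      using \<alpha> M by (simp add: exp_minus field_simps)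
    have "\<bar>inner (S ((1/2) ^ n) (rfun a)) (rfun b)\<bar> \<le> 2 * exp (- (\<alpha> / (1/2) ^ n)) * N"
      unfolding \<alpha>_def N_def by (rule form_separated_le[OF a b h sep]) auto
    also have "\<alpha> / (1/2) ^ n = \<alpha> * M" unfolding hM by simp
    also have "2 * exp (- (\<alpha> * M)) * N \<le> 2 * (2 / (\<alpha> * M)\<^sup>2) * N"
      by (intro mult_right_mono mult_left_mono e) (auto simp: N_def)
    finally have "\<bar>inner (S ((1/2) ^ n) (rfun a)) (rfun b)\<bar> * M \<le> 2 * (2 / (\<alpha> * M)\<^sup>2) * N * M"
      using M by (intro mult_right_mono) auto
    also have "\<dots> = 4 * N / \<alpha>\<^sup>2 * (1 / M)" using M \<alpha> by (simp add: field_simps power2_eq_square)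
    finally show "norm (inner (S ((1/2) ^ n) (rfun a)) (rfun b) * 2 ^ n) \<le> 4 * N / \<alpha>\<^sup>2 * (1/2) ^ n"
      unfolding hM by (simp add: abs_mult M_def)
  qed
  show "(\<lambda>n. 4 * N / \<alpha>\<^sup>2 * (1/2) ^ n) \<longlonglongrightarrow> 0"
    by (intro tendsto_mult_right_zero LIMSEQ_power_zero) simp
qed

end

context low_spectrum
begin

text \<open>Linear combinations are taken with real coefficients, so orthogonality to a complex
  eigenvector amounts to two equations; hence the factor \<open>2\<close>.\<close>

lemma card_separated_low_energy_le:
  assumes I: "finite I" "\<And>k. k \<in> I \<Longrightarrow> low_energy h t k" and h: "h > 0"
    and sep: "\<And>k l. k \<in> I \<Longrightarrow> l \<in> I \<Longrightarrow> k \<noteq> l \<Longrightarrow> \<exists>e\<in>Basis. 3 \<le> \<bar>k e - l e\<bar>"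
  shows "card I \<le> 2 * eigenvalue_count H t"
proof (rule ccontr)
  assume neg: "\<not> ?thesis"
  obtain J where J: "finite J" "card J \<le> eigenvalue_count H t"
    "\<And>u s. u \<in> X \<Longrightarrow> (\<And>e. e \<in> J \<Longrightarrow> inner u e = 0 \<and> inner u (\<i> *\<^sub>C e) = 0) \<Longrightarrow> s > 0 \<Longrightarrow>
       inner (S s u) u \<le> exp (- t * s) * (norm u)\<^sup>2"
    using finite_test_set by blast
  obtain a \<gamma> where a: "\<And>k. k \<in> I \<Longrightarrow> test_fun h k (a k)" "\<And>k. k \<in> I \<Longrightarrow> rfun (a k) \<noteq> 0"
      "\<And>k. k \<in> I \<Longrightarrow> \<gamma> k < t" "\<And>k n. k \<in> I \<Longrightarrow> form_quotient n (rfun (a k)) \<le> \<gamma> k * (norm (rfun (a k)))\<^sup>2"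
    using I(2) unfolding low_energy_def by metis
  define v where "v k = rfun (a k)" for k
  have sqa: "sq_integrable (a k)" and vX: "v k \<in> X" and supp: "a k x \<noteq> 0 \<Longrightarrow> x \<in> cell h k" if "k \<in> I" for k x
    using a(1)[OF that] by (auto simp: test_fun_def v_def)
  have sep': "\<exists>e\<in>Basis. h \<le> \<bar>(x - y) \<bullet> e\<bar>" if kl: "k \<in> I" "l \<in> I" "k \<noteq> l" and x: "a k x \<noteq> 0" and y: "a l y \<noteq> 0" for k l x y
  proof -
    obtain e where e: "e \<in> Basis" "3 \<le> \<bar>k e - l e\<bar>" using sep[OF kl] by auto
    have "\<bar>x \<bullet> e / h - of_int (k e)\<bar> < 1" "\<bar>y \<bullet> e / h - of_int (l e)\<bar> < 1"
      using supp[OF kl(1) x] supp[OF kl(2) y] e(1) by (auto simp: cell_def)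
    moreover have "3 \<le> \<bar>real_of_int (k e) - of_int (l e)\<bar>" using e(2) by linarith
    \<comment> \<open>Each scaled coordinate is less than 1 away from its index, so of an index
      difference of 3 at least 1 remains.\<close>
    ultimately have "1 \<le> \<bar>x \<bullet> e / h - y \<bullet> e / h\<bar>" by linarith
    also have "\<dots> = \<bar>(x - y) \<bullet> e\<bar> / h" using h by (simp add: inner_diff_left diff_divide_distrib[symmetric] abs_divide)
    finally have "h \<le> \<bar>(x - y) \<bullet> e\<bar>" using h by (simp add: field_simps)
    then show ?thesis using e(1) by blast
  qed
  define F where "F k j = (if snd j then inner (v k) (fst j) else inner (v k) (\<i> *\<^sub>C fst j))" for k and j :: "'a L2 \<times> bool"
  have "card (J \<times> (UNIV :: bool set)) < card I" using neg J(2) by (simp add: card_cartesian_product)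
  from underdetermined_system[OF _ I(1) this, of F] J(1)
  obtain c where c: "\<exists>k\<in>I. c k \<noteq> 0" "\<And>j. j \<in> J \<times> UNIV \<Longrightarrow> (\<Sum>k\<in>I. c k * F k j) = 0" by auto
  define u where "u = (\<Sum>k\<in>I. c k *\<^sub>R v k)"
  have uX: "u \<in> X" unfolding u_def
    by (intro subspace_sum subspace_scale L2_on_subspace[OF \<Omega>] vX)
  have orth: "inner u e = 0 \<and> inner u (\<i> *\<^sub>C e) = 0" if "e \<in> J" for e
    using c(2)[of "(e, True)"] c(2)[of "(e, False)"] that by (simp add: u_def F_def inner_sum_left)
  have vv: "inner (v k) (v l) = 0" if kl: "k \<in> I" "l \<in> I" "k \<noteq> l" for k l
  proof -
    have z: "a k x * a l x = 0" for x
    proof (rule ccontr)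
      assume "a k x * a l x \<noteq> 0"
      then have "\<exists>e\<in>Basis. h \<le> \<bar>(x - x) \<bullet> e\<bar>" by (intro sep'[OF kl]) auto
      then show False using h by simp
    qed
    show ?thesis unfolding v_def inner_rfun[OF sqa[OF kl(1)] sqa[OF kl(2)]] z by simp
  qed
  have dbl: "(\<Sum>k\<in>I. \<Sum>l\<in>I. G k l) = (\<Sum>k\<in>I. G k k) + (\<Sum>k\<in>I. \<Sum>l\<in>I - {k}. G k l)" for G :: "_ \<Rightarrow> _ \<Rightarrow> real"
    unfolding sum.distrib[symmetric] by (intro sum.cong refl sum.remove I(1))
  have nu: "(norm u)\<^sup>2 = (\<Sum>k\<in>I. (c k)\<^sup>2 * (norm (v k))\<^sup>2)"
  proof -
    have "(norm u)\<^sup>2 = (\<Sum>k\<in>I. \<Sum>l\<in>I. c k * (c l * inner (v k) (v l)))"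
      unfolding u_def power2_norm_eq_inner inner_sum_left
      by (simp only: inner_sum_right inner_scaleR_left inner_scaleR_right sum_distrib_left mult.left_commute)
    also have "\<dots> = (\<Sum>k\<in>I. c k * (c k * inner (v k) (v k))) + (\<Sum>k\<in>I. \<Sum>l\<in>I - {k}. c k * (c l * inner (v k) (v l)))"
      by (rule dbl)
    also have "(\<Sum>k\<in>I. \<Sum>l\<in>I - {k}. c k * (c l * inner (v k) (v l))) = 0"
      by (intro sum.neutral ballI) (auto simp: vv)
    finally have "(norm u)\<^sup>2 = (\<Sum>k\<in>I. c k * (c k * inner (v k) (v k)))" by simp
    moreover have "c k * (c k * inner (v k) (v k)) = (c k)\<^sup>2 * (norm (v k))\<^sup>2" for k
      by (simp add: power2_norm_eq_inner power2_eq_square[of "c k"] mult.assoc)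
    ultimately show ?thesis by simp
  qed
  \<comment> \<open>The cross terms of the energy. They tend to 0 by locality, so in the limit the
    energy of \<open>u\<close> is the sum of the energies of its pieces.\<close>
  define cr where "cr n = (\<Sum>k\<in>I. \<Sum>l\<in>I - {k}. c k * c l * (inner (S ((1/2) ^ n) (v k)) (v l) * 2 ^ n))" for n
  have cr: "cr \<longlonglongrightarrow> 0"
  proof -
    have "cr \<longlonglongrightarrow> (\<Sum>k\<in>I. \<Sum>l\<in>I - {k}. c k * c l * 0)"
      unfolding cr_def[abs_def] v_def
      by (intro tendsto_sum tendsto_mult_left form_separated_tendsto[OF _ _ _ _ h sep'] sqa vX[unfolded v_def]) auto
    then show ?thesis by simp
  qed
  have qu: "form_quotient n u = (\<Sum>k\<in>I. (c k)\<^sup>2 * form_quotient n (v k)) - cr n" for n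
  proof -
    interpret l: bounded_linear "S ((1/2) ^ n)" by (rule S_bl) simp
    have "inner (S ((1/2) ^ n) u) u = (\<Sum>k\<in>I. \<Sum>l\<in>I. c k * c l * inner (S ((1/2) ^ n) (v k)) (v l))"
      unfolding u_def l.sum inner_sum_left 
      by (simp only: l.scaleR inner_sum_right inner_scaleR_left inner_scaleR_right sum_distrib_left mult.assoc mult.left_commute)
    also have "\<dots> = (\<Sum>k\<in>I. c k * c k * inner (S ((1/2) ^ n) (v k)) (v k)) + (\<Sum>k\<in>I. \<Sum>l\<in>I - {k}. c k * c l * inner (S ((1/2) ^ n) (v k)) (v l))"
      by (rule dbl)
    finally have "inner (S ((1/2) ^ n) u) u * 2 ^ n = (\<Sum>k\<in>I. (c k)\<^sup>2 * inner (S ((1/2) ^ n) (v k)) (v k) * 2 ^ n) + cr n"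
      unfolding cr_def by (simp add: distrib_right sum_distrib_right power2_eq_square mult.assoc)
    then show ?thesis unfolding form_quotient_def nu
      by (simp add: left_diff_distrib right_diff_distrib sum_distrib_right sum_subtractf mult.assoc)
  qed
  define L where "L = (\<Sum>k\<in>I. (c k)\<^sup>2 * (\<gamma> k * (norm (v k))\<^sup>2))"
  have le: "- ((exp (- t * (1/2) ^ n) - 1) * 2 ^ n) * (norm u)\<^sup>2 \<le> L - cr n" for n
  proof -
    have "inner (S ((1/2) ^ n) u) u \<le> exp (- t * (1/2) ^ n) * (norm u)\<^sup>2" by (rule J(3)[OF uX orth]) auto
    then have "((norm u)\<^sup>2 - exp (- t * (1/2) ^ n) * (norm u)\<^sup>2) * 2 ^ n \<le> form_quotient n u"
      unfolding form_quotient_def by (intro mult_right_mono) auto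
    also have "\<dots> \<le> L - cr n"
      unfolding qu L_def v_def by (intro diff_right_mono sum_mono mult_left_mono a(4)) auto
    finally show ?thesis by (simp add: algebra_simps)
  qed
  \<comment> \<open>Orthogonality to \<open>J\<close> forces the limiting energy of \<open>u\<close>
    up to \<open>t * (norm u)\<^sup>2\<close>, whereas \<open>L\<close>, built from energies
    strictly below \<open>t\<close>, is smaller.\<close>
  have "- (- t) * (norm u)\<^sup>2 \<le> L - 0"
  proof (rule LIMSEQ_le)
    show "(\<lambda>n. - ((exp (- t * (1/2) ^ n) - 1) * 2 ^ n) * (norm u)\<^sup>2) \<longlonglongrightarrow> - (- t) * (norm u)\<^sup>2"
      by (intro tendsto_intros exp_quotient_tendsto)
    show "(\<lambda>n. L - cr n) \<longlonglongrightarrow> L - 0" by (intro tendsto_intros cr)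
  qed (use le in blast)
  moreover have "L < t * (norm u)\<^sup>2"
  proof -
    have "L < (\<Sum>k\<in>I. (c k)\<^sup>2 * (t * (norm (v k))\<^sup>2))"
      unfolding L_def
    proof (rule sum_strict_mono_ex1[OF I(1)])
      show "\<forall>k\<in>I. (c k)\<^sup>2 * (\<gamma> k * (norm (v k))\<^sup>2) \<le> (c k)\<^sup>2 * (t * (norm (v k))\<^sup>2)"
        using less_imp_le[OF a(3)] by (intro ballI mult_left_mono mult_right_mono) auto
      obtain k where k: "k \<in> I" "c k \<noteq> 0" using c(1) by auto
      then have "(c k)\<^sup>2 * (\<gamma> k * (norm (v k))\<^sup>2) < (c k)\<^sup>2 * (t * (norm (v k))\<^sup>2)"
        using a(2,3)[OF k(1)] by (intro mult_strict_left_mono mult_strict_right_mono) (auto simp: v_def)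
      then show "\<exists>k\<in>I. (c k)\<^sup>2 * (\<gamma> k * (norm (v k))\<^sup>2) < (c k)\<^sup>2 * (t * (norm (v k))\<^sup>2)" using k(1) by blast
    qed
    also have "\<dots> = t * (norm u)\<^sup>2" unfolding nu by (simp add: sum_distrib_left mult.left_commute)
    finally show ?thesis .
  qed
  ultimately show False by simp
qed

text \<open>Indices are sorted into residue classes modulo 3, since neighbouring cells overlap and cells
  whose indices differ by 2 may touch.\<close>

lemma low_energy_finite_card:
  assumes h: "h > 0"
  defines "B \<equiv> {k \<in> PiE (Basis::'a set) (\<lambda>_. UNIV). low_energy h t k}"
  shows "finite B" "card B \<le> 3 ^ DIM('a) * (2 * eigenvalue_count H t)"
proof -
  define R where "R = PiE (Basis::'a set) (\<lambda>_. {0, 1, 2::int})"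
  define cls where "cls r = {k \<in> B. (\<lambda>e\<in>Basis. k e mod 3) = r}" for r
  have R: "finite R" "card R = 3 ^ DIM('a)" unfolding R_def by (auto intro!: finite_PiE simp: card_PiE numeral_3_eq_3)
  have "k e mod 3 \<in> {0, 1, 2}" for k :: "'a \<Rightarrow> int" and e
    using pos_mod_bound[of 3 "k e"] pos_mod_sign[of 3 "k e"] by (auto simp del: pos_mod_bound pos_mod_sign)
  then have cov: "B = (\<Union>r\<in>R. cls r)" by (auto simp: cls_def R_def)
  \<comment> \<open>A uniform bound for the finite subsets of a class yields its finiteness together
    with the bound.\<close>
  have cls: "finite (cls r) \<and> card (cls r) \<le> 2 * eigenvalue_count H t" for r
  proof (rule finite_if_finite_subsets_card_bdd)
    fix G assume G: "G \<subseteq> cls r" "finite G"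
    show "card G \<le> 2 * eigenvalue_count H t"
    proof (rule card_separated_low_energy_le[OF G(2) _ h])
      show "low_energy h t k" if "k \<in> G" for k using that G(1) by (auto simp: cls_def B_def)
      fix k l assume kl: "k \<in> G" "l \<in> G" "k \<noteq> l"
      then have K: "k \<in> PiE Basis (\<lambda>_. UNIV)" "l \<in> PiE Basis (\<lambda>_. UNIV)" "(\<lambda>e\<in>Basis. k e mod 3) = (\<lambda>e\<in>Basis. l e mod 3)"
        using G(1) by (auto simp: cls_def B_def)
      obtain e where e: "e \<in> Basis" "k e \<noteq> l e" using PiE_ext[OF K(1,2)] kl(3) by blast
      have "k e mod 3 = l e mod 3" using fun_cong[OF K(3), of e] e(1) by simp
      then have "3 dvd k e - l e" by (simp add: mod_eq_dvd_iff)
      then have "3 \<le> \<bar>k e - l e\<bar>" using e(2) dvd_imp_le_int[of "k e - l e" 3] by simp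
      then show "\<exists>e\<in>Basis. 3 \<le> \<bar>k e - l e\<bar>" using e(1) by blast
    qed
  qed
  show "finite B" unfolding cov using R(1) cls by blast
  have "card B \<le> (\<Sum>r\<in>R. card (cls r))" unfolding cov by (rule card_UN_le[OF R(1)])
  also have "\<dots> \<le> (\<Sum>r\<in>R. 2 * eigenvalue_count H t)" by (intro sum_mono) (use cls in blast)
  also have "\<dots> = 3 ^ DIM('a) * (2 * eigenvalue_count H t)" using R(2) by simp
  finally show "card B \<le> 3 ^ DIM('a) * (2 * eigenvalue_count H t)" .
qed

end

section \<open>The estimate\<close>

lemma sin_ge_cubic:
  assumes x: "0 \<le> x" shows "x - x ^ 3 / 6 \<le> sin (x::real)"
proof -
  have "sin 0 - 0 + 0 ^ 3 / 6 \<le> sin x - x + x ^ 3 / 6"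
  proof (rule DERIV_nonneg_imp_nondecreasing[OF x])
    fix y :: real
    have "((\<lambda>y. sin y - y + y ^ 3 / 6) has_real_derivative cos y - 1 + y\<^sup>2 / 2) (at y)"
      by (auto intro!: derivative_eq_intros)
    moreover have "0 \<le> cos y - 1 + y\<^sup>2 / 2" using cos_ge_quadratic[of y] by simp
    ultimately show "\<exists>d. ((\<lambda>y. sin y - y + y ^ 3 / 6) has_real_derivative d) (at y) \<and> 0 \<le> d" by blast
  qed
  then show ?thesis by simp
qed

text \<open>\<open>8/15\<close> is a sixth of \<open>16/5\<close>, so it is enough that
  \<open>sin (8/15)\<close> exceeds \<open>sin (pi / 6)\<close>. This accuracy brings
  \<open>1/4 + pi\<^sup>2 / 16\<close> down to at most 0.89.\<close>

lemma pi_le_16_5: "pi \<le> 16 / 5"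
proof (rule ccontr)
  assume "\<not> ?thesis"
  then have "sin (8/15) < sin (pi / 6)" by (intro sin_monotone_2pi) (auto)
  moreover have "1/2 < sin (8/15 :: real)" using sin_ge_cubic[of "8/15"] by (simp add: eval_nat_numeral)
  ultimately show False by (simp add: sin_30)
qed

lemma cosh_1_le: "cosh (1::real) \<le> 7 / 4"
proof -
  have e: "exp (1::real) \<le> 3" by (rule exp_le)
  have "2 \<le> exp (1::real)" using exp_ge_add_one_self[of 1] by simp
  then have "exp (- 1 :: real) \<le> 1 / 2" by (simp add: exp_minus field_simps)
  then show ?thesis using e by (simp add: cosh_field_def)
qed

lemma ln_3_ge_1: "1 \<le> ln (3::real)"
  using exp_le by (subst ln_ge_iff) auto

text \<open>The base \<open>3 * (2 * pi) * cosh 1\<close> of the power is at most 33.6 and the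
  remaining constant at most \<open>2 / 0.11\<close>, both below 35. Because
  \<open>\<gamma> \<le> t\<close> makes the logarithm at least 1, its power can be inserted as a
  factor.\<close>

lemma constant_bound:
  fixes \<gamma> t :: real and d N :: nat
  assumes d: "d > 0" and \<gamma>: "\<gamma> > 0" "\<gamma> \<le> t"
  shows "real (3 ^ d * (2 * N)) * (pi / (sqrt (\<gamma> / real d) / 2)) ^ d * (cosh 1 ^ d / (1 - (1 / 4 + pi\<^sup>2 / 16)))
    \<le> 35 ^ (d + 1) * real d powr (real d / 2) * \<gamma> powr (- (real d / 2)) * ln (3 * t / \<gamma>) ^ d * real N"
proof -
  have d0: "real d > 0" using d by simp
  define r where "r = sqrt (real d / \<gamma>)"
  have r0: "0 < r" using d0 \<gamma> by (simp add: r_def)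
  define x where "x = 2 * pi"
  have "pi / (sqrt (\<gamma> / real d) / 2) = x * r" using d0 \<gamma> by (simp add: r_def x_def real_sqrt_divide field_simps)
  then have e1: "real (3 ^ d * (2 * N)) * (pi / (sqrt (\<gamma> / real d) / 2)) ^ d * (cosh 1 ^ d / (1 - (1 / 4 + pi\<^sup>2 / 16)))
     = (3 * (2 * pi) * cosh 1) ^ d * (2 / (1 - (1 / 4 + pi\<^sup>2 / 16))) * (r ^ d * real N)"
    unfolding x_def[symmetric] by (simp add: power_mult_distrib)
  have p2: "pi\<^sup>2 \<le> (16/5)\<^sup>2" using pi_le_16_5 pi_gt_zero by (intro power_mono) auto
  have "2 / (1 - (1 / 4 + pi\<^sup>2 / 16)) \<le> 2 / (1 - (1/4 + (16/5)\<^sup>2 / 16))"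
    using p2 by (intro divide_left_mono mult_pos_pos) (auto simp: power2_eq_square)
  also have "\<dots> \<le> 35" by (simp add: power2_eq_square)
  finally have c1: "2 / (1 - (1 / 4 + pi\<^sup>2 / 16)) \<le> 35" .
  have c10: "0 \<le> 2 / (1 - (1 / 4 + pi\<^sup>2 / 16))" using p2 by (simp add: power2_eq_square)
  have "3 * (2 * pi) * cosh 1 \<le> 3 * (2 * (16/5)) * (7/4 :: real)"
    using pi_le_16_5 cosh_1_le pi_gt_zero by (intro mult_mono) (auto simp: cosh_real_nonneg)
  then have c2: "(3 * (2 * pi) * cosh 1) ^ d \<le> (35::real) ^ d"
    using pi_gt_zero by (intro power_mono) (auto simp: cosh_real_nonneg)
  have "1 \<le> ln (3 * t / \<gamma>)"
  proof -
    have "3 \<le> 3 * t / \<gamma>" using \<gamma> by (simp add: field_simps)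
    then have "ln 3 \<le> ln (3 * t / \<gamma>)" by (subst ln_le_cancel_iff) auto
    then show ?thesis using ln_3_ge_1 by linarith
  qed
  then have c3: "1 \<le> ln (3 * t / \<gamma>) ^ d" by (rule one_le_power)
  have e2: "r ^ d = real d powr (real d / 2) * \<gamma> powr (- (real d / 2))"
  proof -
    have r: "r = (real d / \<gamma>) powr (1/2)" using d0 \<gamma> by (simp add: r_def powr_half_sqrt)
    have "r ^ d = r powr real d" by (rule powr_realpow[OF r0, symmetric])
    also have "\<dots> = (real d / \<gamma>) powr (real d / 2)" by (simp add: r powr_powr)
    also have "\<dots> = real d powr (real d / 2) / \<gamma> powr (real d / 2)" using d0 \<gamma> by (intro powr_divide)
    finally show ?thesis unfolding powr_minus divide_inverse .
  qed
  have "(3 * (2 * pi) * cosh 1) ^ d * (2 / (1 - (1 / 4 + pi\<^sup>2 / 16))) * (r ^ d * real N) \<le> 35 ^ d * 35 * (r ^ d * real N)"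
    using c1 c2 c10 r0 by (intro mult_right_mono mult_mono) auto
  also have "\<dots> \<le> 35 ^ d * 35 * (r ^ d * real N) * ln (3 * t / \<gamma>) ^ d"
    using c3 r0 mult_left_mono[of 1 "ln (3 * t / \<gamma>) ^ d" "35 ^ d * 35 * (r ^ d * real N)"] by simp
  finally show ?thesis unfolding e1 e2 by (simp add: mult_ac)
qed

context dominated_semigroup
begin

text \<open>The semigroup preserves real functions, so the eigenvalue equation splits;
  \<open>norm_real_imag\<close> shows that the two differences vanish separately.\<close>

lemma eigenfunction_parts:
  assumes "(\<phi>, lam *\<^sub>R \<phi>) \<in> sg.gen"
  obtains p q where "sq_integrable p" "sq_integrable q" "\<phi> = rfun p + \<i> *\<^sub>C rfun q" "rfun p \<in> X" "rfun q \<in> X"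
    "\<And>s. s \<ge> 0 \<Longrightarrow> S s (rfun p) = exp (- lam * s) *\<^sub>R rfun p" "\<And>s. s \<ge> 0 \<Longrightarrow> S s (rfun q) = exp (- lam * s) *\<^sub>R rfun q"
proof -
  have \<phi>X: "\<phi> \<in> X" using assms by (simp add: sg.gen_def)
  obtain p q where pq: "sq_integrable p" "sq_integrable q" "\<phi> = rfun p + \<i> *\<^sub>C rfun q" by (rule L2_real_imag)
  have pX: "rfun p \<in> X" "rfun q \<in> X" using real_imag_in_L2_on[of p q \<Omega>] pq \<phi>X by auto
  have eq: "S s (rfun p) = exp (- lam * s) *\<^sub>R rfun p \<and> S s (rfun q) = exp (- lam * s) *\<^sub>R rfun q" if s: "s \<ge> 0" for s
  proof -
    interpret l: bounded_linear "S s" by (rule S_bl[OF s])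
    define e where "e = exp (- lam * s)"
    obtain u where u: "sq_integrable u" "S s (rfun p) = rfun u" by (rule S_real[OF pq(1) pX(1) s])
    obtain v where v: "sq_integrable v" "S s (rfun q) = rfun v" by (rule S_real[OF pq(2) pX(2) s])
    have "S s \<phi> = e *\<^sub>R \<phi>" unfolding e_def by (rule sg.eigenvector_semigroup[OF assms s])
    then have "rfun u + \<i> *\<^sub>C rfun v = e *\<^sub>R rfun p + e *\<^sub>R (\<i> *\<^sub>C rfun q)"
      unfolding pq(3) l.add S_scaleC[OF s pX(2)] u v by (simp add: scaleR_add_right)
    moreover have "e *\<^sub>R (\<i> *\<^sub>C rfun q) = \<i> *\<^sub>C (e *\<^sub>R rfun q)" by (simp add: scaleR_L2_def cvec.scale_left_commute)
    ultimately have "(rfun u - e *\<^sub>R rfun p) + \<i> *\<^sub>C (rfun v - e *\<^sub>R rfun q) = 0"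
      by (simp add: cvec.scale_right_diff_distrib algebra_simps)
    moreover have du: "rfun u - e *\<^sub>R rfun p = rfun (\<lambda>x. u x - e * p x)"
      by (simp add: rfun_scale[OF pq(1)] rfun_diff[OF u(1) sq_integrable_scale[OF pq(1)]])
    moreover have dv: "rfun v - e *\<^sub>R rfun q = rfun (\<lambda>x. v x - e * q x)"
      by (simp add: rfun_scale[OF pq(2)] rfun_diff[OF v(1) sq_integrable_scale[OF pq(2)]])
    ultimately have "rfun (\<lambda>x. u x - e * p x) + \<i> *\<^sub>C rfun (\<lambda>x. v x - e * q x) = 0" by simp
    then have "(norm (rfun (\<lambda>x. u x - e * p x)))\<^sup>2 + (norm (rfun (\<lambda>x. v x - e * q x)))\<^sup>2 = 0"
      using norm_real_imag[OF sq_integrable_diff[OF u(1) sq_integrable_scale[OF pq(1)]] sq_integrable_diff[OF v(1) sq_integrable_scale[OF pq(2)]], of e e] by simp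
    then have "rfun u - e *\<^sub>R rfun p = 0" "rfun v - e *\<^sub>R rfun q = 0"
      unfolding du dv by (simp_all add: sum_power2_eq_zero_iff)
    then show ?thesis using u v by (simp add: e_def)
  qed
  show ?thesis using that[OF pq pX] eq by blast
qed

end

context low_spectrum
begin

text \<open>Cauchy-Schwarz for \<open>f = sqrt w * (f / sqrt w)\<close> on a ball. There the
  integral of \<open>w\<close> is at most \<open>\<epsilon>\<close> times the volume plus
  \<open>M * D\<close>. The order of limits is forced, as \<open>\<epsilon>\<close> is not
  integrable over the whole space: first \<open>\<epsilon>\<close> tends to 0 for a fixed ball, then
  the balls grow.\<close>

lemma eigenfunction_L1_bound:
  assumes \<phi>: "(\<phi>, lam *\<^sub>R \<phi>) \<in> sg.gen" and lt: "lam < t" and h: "h > 0" and b: "b > 0"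
    and \<kappa>: "real DIM('a) * (b\<^sup>2 + (pi / (2 * h))\<^sup>2) = \<kappa> * (t - lam)" "\<kappa> < 1"
  shows "(L1_norm \<phi>)\<^sup>2 \<le> ennreal (real (3 ^ DIM('a) * (2 * eigenvalue_count H t)) * (pi / b) ^ DIM('a)
    * (cosh (b * h) ^ DIM('a) / (1 - \<kappa>)) * (norm \<phi>)\<^sup>2)"
proof -
  define B where "B = {k \<in> PiE (Basis::'a set) (\<lambda>_. UNIV). low_energy h t k}"
  define M where "M = real (3 ^ DIM('a) * (2 * eigenvalue_count H t))"
  have B: "finite B" "real (card B) \<le> M"
    using low_energy_finite_card[OF h] unfolding B_def M_def by (auto simp del: of_nat_mult of_nat_power)
  define P where "P = centre h ` B"
  have P: "finite P" "real (card P) \<le> M" using B card_image_le[OF B(1), of "centre h"] by (auto simp: P_def)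
  define C where "C = cosh (b * h) ^ DIM('a) / (1 - \<kappa>)"
  have C0: "0 \<le> C" using \<kappa>(2) by (simp add: C_def cosh_real_nonneg)
  define D where "D = (pi / b) ^ DIM('a)"
  have D0: "0 \<le> D" using b by (simp add: D_def)
  have M0: "0 \<le> M" by (simp add: M_def)
  obtain p q where pq: "sq_integrable p" "sq_integrable q" "\<phi> = rfun p + \<i> *\<^sub>C rfun q" "rfun p \<in> X" "rfun q \<in> X"
    "\<And>s. s \<ge> 0 \<Longrightarrow> S s (rfun p) = exp (- lam * s) *\<^sub>R rfun p" "\<And>s. s \<ge> 0 \<Longrightarrow> S s (rfun q) = exp (- lam * s) *\<^sub>R rfun q"
    by (rule eigenfunction_parts[OF \<phi>]) blast
  have [measurable]: "p \<in> borel_measurable borel" "q \<in> borel_measurable borel" using pq by (auto simp: sq_integrable_def)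
  define f where "f x = sqrt ((p x)\<^sup>2 + (q x)\<^sup>2)" for x
  have [measurable]: "f \<in> borel_measurable borel" unfolding f_def by measurable
  have f0: "0 \<le> f x" for x by (simp add: f_def)
  have L1: "L1_norm \<phi> = (\<integral>\<^sup>+x. ennreal (f x) \<partial>lborel)"
    unfolding pq(3) L1_norm_real_imag[OF pq(1,2)] f_def ..
  have n\<phi>: "(norm \<phi>)\<^sup>2 = (norm (rfun p))\<^sup>2 + (norm (rfun q))\<^sup>2" unfolding pq(3) by (rule norm_real_imag[OF pq(1,2)])
  have "(\<integral>\<^sup>+x\<in>ball 0 (real n). ennreal (f x) \<partial>lborel)\<^sup>2 \<le> ennreal ((\<epsilon> * measure lborel (ball (0::'a) (real n)) + M * D) * (C * (norm \<phi>)\<^sup>2))"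
    if \<epsilon>: "\<epsilon> > 0" for \<epsilon> n
  proof -
    define V where "V = measure lborel (ball (0::'a) (real n))"
    define w where "w = weight \<epsilon> b P"
    have [measurable]: "w \<in> borel_measurable borel" unfolding w_def by measurable
    have w: "0 < w x" for x using weight_ge[of \<epsilon> b P x] \<epsilon> unfolding w_def by linarith
    have m: "(\<lambda>x. ennreal (sqrt (w x)) * indicator (ball 0 (real n)) x) \<in> borel_measurable lborel"
      by (intro borel_measurable_times_ennreal borel_measurable_indicator) auto
    have "(\<integral>\<^sup>+x\<in>ball 0 (real n). ennreal (f x) \<partial>lborel) = (\<integral>\<^sup>+x. ennreal (sqrt (w x)) * indicator (ball 0 (real n)) x * ennreal (f x / sqrt (w x)) \<partial>lborel)"
    proof (rule nn_integral_cong)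
      fix x
      have "ennreal (sqrt (w x)) * ennreal (f x / sqrt (w x)) = ennreal (f x)"
        using w[of x] f0[of x] by (subst ennreal_mult[symmetric]) auto
      then show "ennreal (f x) * indicator (ball 0 (real n)) x = ennreal (sqrt (w x)) * indicator (ball 0 (real n)) x * ennreal (f x / sqrt (w x))"
        by (simp add: indicator_def)
    qed
    then have "(\<integral>\<^sup>+x\<in>ball 0 (real n). ennreal (f x) \<partial>lborel)\<^sup>2
      \<le> (\<integral>\<^sup>+x. (ennreal (sqrt (w x)) * indicator (ball 0 (real n)) x)\<^sup>2 \<partial>lborel) * (\<integral>\<^sup>+x. (ennreal (f x / sqrt (w x)))\<^sup>2 \<partial>lborel)"
      by (simp only:) (rule Cauchy_Schwarz_nn_integral[OF m], measurable)
    also have "(\<integral>\<^sup>+x. (ennreal (sqrt (w x)) * indicator (ball 0 (real n)) x)\<^sup>2 \<partial>lborel) \<le> ennreal (\<epsilon> * V + M * D)"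
    proof -
      have "(\<integral>\<^sup>+x. (ennreal (sqrt (w x)) * indicator (ball 0 (real n)) x)\<^sup>2 \<partial>lborel)
         \<le> (\<integral>\<^sup>+x. ennreal \<epsilon> * indicator (ball 0 (real n)) x + (\<Sum>p\<in>P. ennreal (1 / coshprod b p x)) \<partial>lborel)"
      proof (rule nn_integral_mono)
        fix x :: 'a
        have s: "(\<Sum>p\<in>P. ennreal (1 / coshprod b p x)) = ennreal (\<Sum>p\<in>P. 1 / coshprod b p x)"
          by (intro sum_ennreal inverse_coshprod_nonneg)
        have "(ennreal (sqrt (w x)))\<^sup>2 = ennreal (w x)" using w[of x] by (simp add: ennreal_power less_imp_le)
        also have "\<dots> = ennreal \<epsilon> + (\<Sum>p\<in>P. ennreal (1 / coshprod b p x))"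
          unfolding w_def weight_def s using \<epsilon>
          by (intro ennreal_plus sum_nonneg inverse_coshprod_nonneg) auto
        finally show "(ennreal (sqrt (w x)) * indicator (ball 0 (real n)) x)\<^sup>2 \<le> ennreal \<epsilon> * indicator (ball 0 (real n)) x + (\<Sum>p\<in>P. ennreal (1 / coshprod b p x))"
          by (simp add: indicator_def)
      qed
      also have "\<dots> = (\<integral>\<^sup>+x. ennreal \<epsilon> * indicator (ball (0::'a) (real n)) x \<partial>lborel) + (\<integral>\<^sup>+x. (\<Sum>p\<in>P. ennreal (1 / coshprod b p x)) \<partial>lborel)"
        by (intro nn_integral_add borel_measurable_times_ennreal borel_measurable_indicator borel_measurable_sum) auto
      also have "(\<integral>\<^sup>+x. ennreal \<epsilon> * indicator (ball (0::'a) (real n)) x \<partial>lborel) = ennreal \<epsilon> * emeasure lborel (ball (0::'a) (real n))"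
        by (rule nn_integral_cmult_indicator) simp
      also have "(\<integral>\<^sup>+x. (\<Sum>p\<in>P. ennreal (1 / coshprod b p x)) \<partial>lborel) = (\<Sum>p\<in>P. (\<integral>\<^sup>+x. ennreal (1 / coshprod b p x) \<partial>lborel))"
        by (rule nn_integral_sum) measurable
      also have "(\<Sum>p\<in>P. (\<integral>\<^sup>+x. ennreal (1 / coshprod b p x) \<partial>lborel)) = (\<Sum>p\<in>P. ennreal D)"
        unfolding coshprod_def D_def by (intro sum.cong refl nn_integral_prod_sech b)
      also have "\<dots> = ennreal (real (card P) * D)" using D0 by (simp add: ennreal_mult ennreal_of_nat_eq_real_of_nat)
      also have "\<dots> \<le> ennreal (M * D)" by (intro ennreal_leI mult_right_mono P D0)
      also have "emeasure lborel (ball (0::'a) (real n)) = ennreal V"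
        unfolding V_def using emeasure_lborel_ball_finite[of 0 "real n"] by (intro emeasure_eq_ennreal_measure) (auto simp: less_top)
      also have "ennreal \<epsilon> * ennreal V + ennreal (M * D) = ennreal (\<epsilon> * V + M * D)"
        using \<epsilon> M0 D0 by (simp add: ennreal_mult[symmetric] V_def flip: ennreal_plus)
      finally show ?thesis by (simp add: add_left_mono)
    qed
    also have "(\<integral>\<^sup>+x. (ennreal (f x / sqrt (w x)))\<^sup>2 \<partial>lborel) \<le> ennreal (C * (norm \<phi>)\<^sup>2)"
    proof -
      have "(\<integral>\<^sup>+x. (ennreal (f x / sqrt (w x)))\<^sup>2 \<partial>lborel) = (\<integral>\<^sup>+x. ennreal ((p x)\<^sup>2 / w x) + ennreal ((q x)\<^sup>2 / w x) \<partial>lborel)"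
      proof (rule nn_integral_cong)
        fix x
        have "(f x / sqrt (w x))\<^sup>2 = (p x)\<^sup>2 / w x + (q x)\<^sup>2 / w x"
          using w[of x] by (simp add: f_def power_divide add_divide_distrib less_imp_le)
        then show "(ennreal (f x / sqrt (w x)))\<^sup>2 = ennreal ((p x)\<^sup>2 / w x) + ennreal ((q x)\<^sup>2 / w x)"
          using w[of x] f0[of x] by (simp add: ennreal_power less_imp_le flip: ennreal_plus)
      qed
      also have "\<dots> = (\<integral>\<^sup>+x. ennreal ((p x)\<^sup>2 / w x) \<partial>lborel) + (\<integral>\<^sup>+x. ennreal ((q x)\<^sup>2 / w x) \<partial>lborel)"
        by (rule nn_integral_add) measurable
      also have "\<dots> \<le> ennreal (C * (norm (rfun p))\<^sup>2) + ennreal (C * (norm (rfun q))\<^sup>2)"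
        unfolding w_def P_def C_def
        by (intro add_mono weighted_estimate[OF pq(1,4,6) h b \<epsilon> lt B(1) _ \<kappa>] weighted_estimate[OF pq(2,5,7) h b \<epsilon> lt B(1) _ \<kappa>]) (auto simp: B_def)
      also have "\<dots> = ennreal (C * (norm \<phi>)\<^sup>2)" unfolding n\<phi> using C0 by (simp add: distrib_left)
      finally show ?thesis .
    qed
    also have "ennreal (\<epsilon> * V + M * D) * ennreal (C * (norm \<phi>)\<^sup>2) = ennreal ((\<epsilon> * V + M * D) * (C * (norm \<phi>)\<^sup>2))"
      using C0 by (intro ennreal_mult''[symmetric]) auto
    finally show ?thesis unfolding V_def by (simp add: mult_mono)
  qed
  note main = this
  define Q where "Q = M * D * (C * (norm \<phi>)\<^sup>2)"
  have Q0: "0 \<le> Q" unfolding Q_def using M0 D0 C0 by (intro mult_nonneg_nonneg) auto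
  have ball: "(\<integral>\<^sup>+x\<in>ball 0 (real n). ennreal (f x) \<partial>lborel) \<le> ennreal (sqrt Q)" for n
  proof -
    define V where "V = measure lborel (ball (0::'a) (real n))"
    let ?y = "(\<integral>\<^sup>+x\<in>ball 0 (real n). ennreal (f x) \<partial>lborel)"
    have "?y\<^sup>2 \<le> ennreal Q"
    proof (rule LIMSEQ_le_const)
      have "(\<lambda>j. (1 / real (Suc j) * V + M * D) * (C * (norm \<phi>)\<^sup>2)) \<longlonglongrightarrow> (0 * V + M * D) * (C * (norm \<phi>)\<^sup>2)"
        by (intro tendsto_intros LIMSEQ_Suc[OF lim_const_over_n])
      then show "(\<lambda>j. ennreal ((1 / real (Suc j) * V + M * D) * (C * (norm \<phi>)\<^sup>2))) \<longlonglongrightarrow> ennreal Q"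
        unfolding Q_def by (intro tendsto_ennrealI) simp
      show "\<exists>N. \<forall>j\<ge>N. ?y\<^sup>2 \<le> ennreal ((1 / real (Suc j) * V + M * D) * (C * (norm \<phi>)\<^sup>2))"
        unfolding V_def by (intro exI[of _ 0] allI impI main) simp
    qed
    then obtain y where y: "?y = ennreal y" "0 \<le> y"
      by (cases ?y) (auto simp: top_unique power2_eq_square ennreal_top_mult)
    have "y\<^sup>2 \<le> Q" using \<open>?y\<^sup>2 \<le> ennreal Q\<close> y Q0 by (simp add: ennreal_power)
    then have "y \<le> sqrt Q" by (rule real_le_rsqrt)
    then show ?thesis unfolding y(1) by (rule ennreal_leI)
  qed
  have "(\<integral>\<^sup>+x. ennreal (f x) \<partial>lborel) = (\<integral>\<^sup>+x. liminf (\<lambda>n. ennreal (f x) * indicator (ball 0 (real n)) x) \<partial>lborel)"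
  proof (rule nn_integral_cong)
    fix x :: 'a
    obtain N where N: "norm x < real N" using reals_Archimedean2 by blast
    have "(\<lambda>n. ennreal (f x) * indicator (ball 0 (real n)) x) \<longlonglongrightarrow> ennreal (f x)"
      by (rule tendsto_eventually, rule eventually_sequentiallyI[of N]) (use N in \<open>auto simp: indicator_def\<close>)
    then show "ennreal (f x) = liminf (\<lambda>n. ennreal (f x) * indicator (ball 0 (real n)) x)"
      by (intro lim_imp_Liminf[symmetric]) simp_all
  qed
  also have "\<dots> \<le> liminf (\<lambda>n. (\<integral>\<^sup>+x\<in>ball 0 (real n). ennreal (f x) \<partial>lborel))"
    by (rule nn_integral_liminf) (intro borel_measurable_times_ennreal borel_measurable_indicator, auto)
  also have "\<dots> \<le> liminf (\<lambda>n::nat. ennreal (sqrt Q))"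
    by (intro Liminf_mono always_eventually allI ball)
  also have "\<dots> = ennreal (sqrt Q)" by (simp add: Liminf_const)
  finally have "(L1_norm \<phi>)\<^sup>2 \<le> (ennreal (sqrt Q))\<^sup>2" unfolding L1 by (rule power_mono) simp
  also have "\<dots> = ennreal Q" using Q0 by (simp add: ennreal_power)
  finally show ?thesis unfolding Q_def M_def D_def C_def by (simp only: mult.assoc)
qed

end

theorem theorem1p1:
  fixes \<Omega> :: "(real ^ 'n) set"
    and T :: "real \<Rightarrow> (real ^ 'n) L2 \<Rightarrow> (real ^ 'n) L2"
    and H :: "((real ^ 'n) L2 \<times> (real ^ 'n) L2) set"
    and \<phi> :: "(real ^ 'n) L2"
    and lam t :: real
  assumes "\<Omega> \<in> sets lebesgue"
    and "C0_semigroup (L2_on \<Omega>) T"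
    and "selfadjoint_semigroup (L2_on \<Omega>) T"
    and "positivity_preserving (L2_on \<Omega>) T"
    and "generator (L2_on \<Omega>) T = {(f, - g) | f g. (f, g) \<in> H}"
    and "dominated_by_heat (L2_on \<Omega>) T"
    and "\<phi> \<in> eigenspace H (complex_of_real lam)" and "\<phi> \<noteq> 0"
    and "ereal lam < inf_ess_spectrum (L2_on \<Omega>) H"
    and "lam < t" and "ereal t < inf_ess_spectrum (L2_on \<Omega>) H"
  shows "(L1_norm \<phi>)\<^sup>2 \<le> ennreal
    ((35 ^ (CARD('n) + 1) * real CARD('n) powr (real CARD('n) / 2))
      * (t - lam) powr (- (real CARD('n) / 2))
      * ln (3 * t / (t - lam)) ^ CARD('n)
      * real (eigenvalue_count H t)
      * (norm \<phi>)\<^sup>2)"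
proof -
  interpret low_spectrum \<Omega> T H t
    using assms by unfold_locales
  have \<phi>: "(\<phi>, lam *\<^sub>R \<phi>) \<in> sg.gen" using assms(7) by (simp add: eigenspace_gen)
  \<comment> \<open>Nonnegativity of \<open>lam\<close> gives \<open>t - lam \<le> t\<close>, which
    keeps the logarithm at least 1.\<close>
  have lam0: "0 \<le> lam" by (rule eigenvalue_nonneg[OF \<phi> assms(8)])
  define d where "d = CARD('n)"
  have d: "d > 0" "real d > 0" by (auto simp: d_def)
  have DIM: "DIM(real ^ 'n) = d" by (simp add: d_def)
  define \<gamma> where "\<gamma> = t - lam"
  have \<gamma>: "\<gamma> > 0" "\<gamma> \<le> t" using assms(10) lam0 by (auto simp: \<gamma>_def)
  \<comment> \<open>This \<open>b\<close> spends a quarter of \<open>\<gamma>\<close> on the weight,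
    and \<open>h = 1 / b\<close> spends the fraction \<open>pi\<^sup>2 / 16\<close> on the partition
    of unity. Together they stay below \<open>\<gamma>\<close>, and \<open>b * h = 1\<close> turns
    the bound on low cells into a power of \<open>cosh 1\<close>.\<close>
  define b where "b = sqrt (\<gamma> / real d) / 2"
  define h where "h = 1 / b"
  have b: "b > 0" using \<gamma> d by (simp add: b_def)
  then have h: "h > 0" and bh: "b * h = 1" by (auto simp: h_def)
  have b2: "real d * b\<^sup>2 = \<gamma> / 4" using \<gamma> d by (simp add: b_def power_divide)
  have \<kappa>: "real DIM(real ^ 'n) * (b\<^sup>2 + (pi / (2 * h))\<^sup>2) = (1/4 + pi\<^sup>2 / 16) * (t - lam)"
  proof -
    have "real d * (b\<^sup>2 + (pi / (2 * h))\<^sup>2) = real d * b\<^sup>2 * (1 + pi\<^sup>2 / 4)"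
      by (simp add: h_def power_mult_distrib power_divide algebra_simps)
    then show ?thesis unfolding DIM b2 \<gamma>_def by (simp add: algebra_simps)
  qed
  have \<kappa>1: "1/4 + pi\<^sup>2 / 16 < 1"
    using power_mono[OF pi_le_16_5, of 2] pi_gt_zero by (simp add: power2_eq_square)
  have "(L1_norm \<phi>)\<^sup>2 \<le> ennreal (real (3 ^ d * (2 * eigenvalue_count H t)) * (pi / b) ^ d
      * (cosh 1 ^ d / (1 - (1/4 + pi\<^sup>2 / 16))) * (norm \<phi>)\<^sup>2)"
    using eigenfunction_L1_bound[OF \<phi> assms(10) h b \<kappa> \<kappa>1] unfolding DIM bh .
  also have "\<dots> \<le> ennreal ((35 ^ (d + 1) * real d powr (real d / 2) * \<gamma> powr (- (real d / 2)) * ln (3 * t / \<gamma>) ^ d * real (eigenvalue_count H t)) * (norm \<phi>)\<^sup>2)"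
    using constant_bound[OF d(1) \<gamma>, of "eigenvalue_count H t"] unfolding b_def
    by (intro ennreal_leI mult_right_mono) auto
  finally show ?thesis unfolding d_def \<gamma>_def .
qed

end
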